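(* Let $$1\rightarrow (K,K_1)\rightarrow (G,N_G(K_1))\stackrel{p}{\rightarrow}(Q,Q_1)\rightarrow 1$$ be a short exact sequence of pairs of finitely generated groups, with $K$ non-elementary and strongly hyperbolic relative to the (proper) cusp subgroup $K_1$. Suppose that $G$ preserves cusps, i.e. for every $g\in G$ there exists $k\in K$ with $gK_1g^{-1}=kK_1k^{-1}$. Then $Q_1=Q$, and there is a quasi-isometric section $s\colon Q\to N_G(K_1)$, i.e. a map $s\colon Q\to N_G(K_1)$ with $p\circ s=\mathrm{id}_Q$ and constants $R\geq 1$, $\epsilon\geq 0$ such that $$\frac{1}{R}d_Q(q,q')-\epsilon \leq d_{N_G(K_1)}(s(q),s(q'))\leq R\,d_Q(q,q')+\epsilon\quad\text{for all } q,q'\in Q.$$ Further, if $G$ is weakly hyperbolic relative to $K_1$, then $Q$ is hyperbolic.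
   Context: $N_G(K_1)$ is the normalizer of $K_1$ in $G$. A short exact sequence of pairs means that $1\to K\to G\to Q\to 1$ is exact and restricts to an exact sequence $1\to K_1\to N_G(K_1)\to Q_1\to 1$; all six groups are finitely generated. $d_Q$ and $d_{N_G(K_1)}$ denote word metrics with respect to finite generating sets of $Q$ and $N_G(K_1)$. Non-elementary means that $K$ is neither virtually cyclic nor equal to $K_1$. Relative hyperbolicity (Farb). Let $G$ be a finitely generated group, $H$ a finitely generated subgroup, and $\Gamma_G$ the Cayley graph of $G$ with respect to a finite generating set. The coned-off Cayley graph $\widehat{\Gamma}_G$ is obtained from $\Gamma_G$ by adding, for each left coset $gH$, a new vertex $v(gH)$ and an edge of length $1/2$ from each element of $gH$ to $v(gH)$. $G$ is weakly hyperbolic relative to $H$ if $\widehat{\Gamma}_G$ is Gromov hyperbolic. A path penetrates $gH$ if it passes through $v(gH)$. An electric $P$-quasigeodesic is a $P$-quasigeodesic in $\widehat{\Gamma}_G$; it is without backtracking if it does not return to any left coset of $H$ after leaving it. The pair $(G,H)$ satisfies bounded coset penetration if for every $P\geq 1$ there is a constant $D=D(P)$ such that for any two electric $P$-quasigeodesics $\alpha,\beta$ without backtracking with the same endpoints: (1) if $\alpha$ penetrates $gH$ but $\beta$ does not, then $\alpha$ travels a $\Gamma_G$-distance of at most $D$ in $gH$; (2) if both penetrate $gH$, then the vertices at which $\alpha$ and $\beta$ first enter $gH$ are at $\Gamma_G$-distance at most $D$, and similarly for the last exit vertices. $G$ is strongly hyperbolic relative to $H$ (and $H$ is then called a cusp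 subgroup) if it is weakly hyperbolic relative to $H$ and $(G,H)$ satisfies bounded coset penetration. *)

theory Defs
  imports Complex_Main "HOL-Algebra.Elementary_Groups" "HOL-Algebra.Exact_Sequence" "HOL-Algebra.Group_Action"
    "HOL-Algebra.Left_Coset"
begin

section \<open>Finite generation and word metrics\<close>

definition finite_generating_set :: "('a, 'm) monoid_scheme \<Rightarrow> 'a set \<Rightarrow> bool" where
  "finite_generating_set G S \<longleftrightarrow> finite S \<and> S \<subseteq> carrier G \<and> generate G S = carrier G"

definition finitely_generated :: "('a, 'm) monoid_scheme \<Rightarrow> bool" where
  "finitely_generated G \<longleftrightarrow> (\<exists>S. finite_generating_set G S)"

definition symmetrized :: "('a, 'm) monoid_scheme \<Rightarrow> 'a set \<Rightarrow> 'a set" where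
  "symmetrized G S = S \<union> m_inv G ` S"

definition word_length :: "('a, 'm) monoid_scheme \<Rightarrow> 'a set \<Rightarrow> 'a \<Rightarrow> nat" where
  "word_length G S g =
     (LEAST n. \<exists>ws. length ws = n \<and> set ws \<subseteq> symmetrized G S \<and> foldr (\<lambda>a b. a \<otimes>\<^bsub>G\<^esub> b) ws \<one>\<^bsub>G\<^esub> = g)"

definition word_dist :: "('a, 'm) monoid_scheme \<Rightarrow> 'a set \<Rightarrow> 'a \<Rightarrow> 'a \<Rightarrow> real" where
  "word_dist G S x y = real (word_length G S (inv\<^bsub>G\<^esub> x \<otimes>\<^bsub>G\<^esub> y))"

definition virtually_cyclic :: "('a, 'm) monoid_scheme \<Rightarrow> bool" where
  "virtually_cyclic G \<longleftrightarrow>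
     (\<exists>C. subgroup C G \<and> cyclic_group (G\<lparr>carrier := C\<rparr>) \<and> finite (rcosets\<^bsub>G\<^esub> C))"

definition non_elementary :: "('a, 'm) monoid_scheme \<Rightarrow> 'a set \<Rightarrow> bool" where
  "non_elementary K K1 \<longleftrightarrow> \<not> virtually_cyclic K \<and> K1 \<noteq> carrier K"


section \<open>Short exact sequences\<close>

text \<open>The library's \<^const>\<open>short_exact_sequence\<close> forces all groups to live on one element type;
  this is the same notion with independent types.\<close>

definition short_exact ::
  "('k \<Rightarrow> 'g) \<Rightarrow> ('g \<Rightarrow> 'q) \<Rightarrow> ('k, 'm) monoid_scheme \<Rightarrow> ('g, 'n) monoid_scheme \<Rightarrow> ('q, 'o) monoid_scheme \<Rightarrow> bool"
  where
  "short_exact i p K G Q \<longleftrightarrow>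
     group K \<and> group G \<and> group Q \<and> i \<in> mon K G \<and> p \<in> epi G Q \<and> kernel G Q p = i ` carrier K"

text \<open>The normalizer is that of the image of \<open>K1\<close> in \<open>G\<close>.\<close>

abbreviation normalizer_group :: "('g, 'n) monoid_scheme \<Rightarrow> 'g set \<Rightarrow> ('g, 'n) monoid_scheme" where
  "normalizer_group G H \<equiv> G\<lparr>carrier := normalizer G H\<rparr>"

definition short_exact_pairs ::
  "('k \<Rightarrow> 'g) \<Rightarrow> ('g \<Rightarrow> 'q) \<Rightarrow> ('k, 'm) monoid_scheme \<Rightarrow> 'k set \<Rightarrow> ('g, 'n) monoid_scheme
    \<Rightarrow> ('q, 'o) monoid_scheme \<Rightarrow> 'q set \<Rightarrow> bool" where
  "short_exact_pairs i p K K1 G Q Q1 \<longleftrightarrow>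
     subgroup K1 K \<and> subgroup Q1 Q \<and>
     short_exact i p K G Q \<and>
     short_exact i p (K\<lparr>carrier := K1\<rparr>) (normalizer_group G (i ` K1)) (Q\<lparr>carrier := Q1\<rparr>)"

definition preserves_cusps ::
  "('k \<Rightarrow> 'g) \<Rightarrow> ('k, 'm) monoid_scheme \<Rightarrow> 'k set \<Rightarrow> ('g, 'n) monoid_scheme \<Rightarrow> bool" where
  "preserves_cusps i K K1 G \<longleftrightarrow>
     (\<forall>g\<in>carrier G. \<exists>k\<in>carrier K.
        g <#\<^bsub>G\<^esub> (i ` K1) #>\<^bsub>G\<^esub> inv\<^bsub>G\<^esub> g = i k <#\<^bsub>G\<^esub> (i ` K1) #>\<^bsub>G\<^esub> inv\<^bsub>G\<^esub> (i k))"


section \<open>Metric graphs and Gromov hyperbolicity\<close>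

record 'v metric_graph =
  verts :: "'v set"
  adj :: "'v \<Rightarrow> 'v \<Rightarrow> bool"
  elen :: "'v \<Rightarrow> 'v \<Rightarrow> real"

text \<open>An edge path is given by the list of vertices it traverses; \<open>path_length \<Gamma> xs i j\<close> is the
  length of the part between the vertices with indices \<open>i\<close> and \<open>j\<close>.\<close>

definition edge_path :: "'v metric_graph \<Rightarrow> 'v list \<Rightarrow> bool" where
  "edge_path \<Gamma> xs \<longleftrightarrow> xs \<noteq> [] \<and> set xs \<subseteq> verts \<Gamma> \<and> successively (adj \<Gamma>) xs"

definition path_length :: "'v metric_graph \<Rightarrow> 'v list \<Rightarrow> nat \<Rightarrow> nat \<Rightarrow> real" where
  "path_length \<Gamma> xs i j = (\<Sum>k\<in>{i..<j}. elen \<Gamma> (xs ! k) (xs ! Suc k))"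

definition vertex_dist :: "'v metric_graph \<Rightarrow> 'v \<Rightarrow> 'v \<Rightarrow> real" where
  "vertex_dist \<Gamma> u v =
     Inf {path_length \<Gamma> xs 0 (length xs - 1) | xs. edge_path \<Gamma> xs \<and> hd xs = u \<and> last xs = v}"

text \<open>The geometric realization: \<open>(u, v, t)\<close> is the point at distance \<open>t\<close> from \<open>u\<close> on the edge
  \<open>uv\<close>, and \<open>(u, u, 0)\<close> is the vertex \<open>u\<close>. The same point may have several names (for instance
  \<open>(u, v, t)\<close> and \<open>(v, u, elen \<Gamma> u v - t)\<close>), at \<open>point_dist\<close> zero from one another. A path between two points
  either stays inside a common edge or runs through an end of each of the two edges.\<close>

definition graph_points :: "'v metric_graph \<Rightarrow> ('v \<times> 'v \<times> real) set" where
  "graph_points \<Gamma> =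
     {(u, u, 0) | u. u \<in> verts \<Gamma>} \<union>
     {(u, v, t) | u v t. u \<in> verts \<Gamma> \<and> v \<in> verts \<Gamma> \<and> adj \<Gamma> u v \<and> 0 \<le> t \<and> t \<le> elen \<Gamma> u v}"

fun edge_ends :: "'v metric_graph \<Rightarrow> 'v \<times> 'v \<times> real \<Rightarrow> ('v \<times> real) set" where
  "edge_ends \<Gamma> (u, v, t) = {(u, t), (v, elen \<Gamma> u v - t)}"

fun along_edge :: "'v metric_graph \<Rightarrow> 'v \<times> 'v \<times> real \<Rightarrow> 'v \<times> 'v \<times> real \<Rightarrow> real set" where
  "along_edge \<Gamma> (u, v, s) (u', v', t) =
     (if u = u' \<and> v = v' then {\<bar>s - t\<bar>} else {}) \<union>
     (if u = v' \<and> v = u' then {\<bar>s - (elen \<Gamma> u v - t)\<bar>} else {})"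

definition point_dist :: "'v metric_graph \<Rightarrow> 'v \<times> 'v \<times> real \<Rightarrow> 'v \<times> 'v \<times> real \<Rightarrow> real" where
  "point_dist \<Gamma> x y =
     Min (along_edge \<Gamma> x y \<union>
          (\<lambda>((u, a), (v, b)). a + vertex_dist \<Gamma> u v + b) ` (edge_ends \<Gamma> x \<times> edge_ends \<Gamma> y))"

definition gromov_product :: "('p \<Rightarrow> 'p \<Rightarrow> real) \<Rightarrow> 'p \<Rightarrow> 'p \<Rightarrow> 'p \<Rightarrow> real" where
  "gromov_product d w x y = (d x w + d y w - d x y) / 2"

definition gromov_hyperbolic :: "'p set \<Rightarrow> ('p \<Rightarrow> 'p \<Rightarrow> real) \<Rightarrow> bool" where
  "gromov_hyperbolic M d \<longleftrightarrow>
     (\<exists>\<delta>\<ge>0. \<forall>w\<in>M. \<forall>x\<in>M. \<forall>y\<in>M. \<forall>z\<in>M.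
        gromov_product d w x z \<ge> min (gromov_product d w x y) (gromov_product d w y z) - \<delta>)"

definition hyperbolic_graph :: "'v metric_graph \<Rightarrow> bool" where
  "hyperbolic_graph \<Gamma> \<longleftrightarrow> gromov_hyperbolic (graph_points \<Gamma>) (point_dist \<Gamma>)"

text \<open>A \<open>P\<close>-quasigeodesic is a \<open>(P, P)\<close>-quasigeodesic for the arc length parametrization,
  tested at the vertices of an edge path.\<close>

definition quasigeodesic :: "'v metric_graph \<Rightarrow> real \<Rightarrow> 'v list \<Rightarrow> bool" where
  "quasigeodesic \<Gamma> P xs \<longleftrightarrow>
     edge_path \<Gamma> xs \<and>
     (\<forall>i j. i \<le> j \<and> j < length xs \<longrightarrow>
        (1 / P) * path_length \<Gamma> xs i j - P \<le> vertex_dist \<Gamma> (xs ! i) (xs ! j) \<and>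
        vertex_dist \<Gamma> (xs ! i) (xs ! j) \<le> P * path_length \<Gamma> xs i j + P)"


section \<open>Cayley graphs and hyperbolic groups\<close>

definition cayley_graph :: "('a, 'm) monoid_scheme \<Rightarrow> 'a set \<Rightarrow> 'a metric_graph" where
  "cayley_graph G S =
     \<lparr>verts = carrier G,
      adj = (\<lambda>x y. x \<noteq> y \<and> inv\<^bsub>G\<^esub> x \<otimes>\<^bsub>G\<^esub> y \<in> symmetrized G S),
      elen = (\<lambda>_ _. 1)\<rparr>"

text \<open>Hyperbolicity does not depend on the finite generating set; we ask for it for all of them.\<close>

definition hyperbolic_group :: "('a, 'm) monoid_scheme \<Rightarrow> bool" where
  "hyperbolic_group G \<longleftrightarrow>
     group G \<and> finitely_generated G \<and>
     (\<forall>S. finite_generating_set G S \<longrightarrow> hyperbolic_graph (cayley_graph G S))"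


section \<open>Relative hyperbolicity\<close>

text \<open>\<open>Cone C\<close> is the cone vertex \<open>v(C)\<close> of the left coset \<open>C\<close>.\<close>

datatype 'a coned = Elt 'a | Cone "'a set"

fun coned_adj :: "('a, 'm) monoid_scheme \<Rightarrow> 'a set \<Rightarrow> 'a coned \<Rightarrow> 'a coned \<Rightarrow> bool" where
  "coned_adj G S (Elt x) (Elt y) \<longleftrightarrow> adj (cayley_graph G S) x y"
| "coned_adj G S (Elt x) (Cone C) \<longleftrightarrow> x \<in> C"
| "coned_adj G S (Cone C) (Elt x) \<longleftrightarrow> x \<in> C"
| "coned_adj G S (Cone C) (Cone C') \<longleftrightarrow> False"

fun coned_len :: "'a coned \<Rightarrow> 'a coned \<Rightarrow> real" where
  "coned_len (Elt x) (Elt y) = 1"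
| "coned_len _ _ = 1 / 2"

definition coned_off :: "('a, 'm) monoid_scheme \<Rightarrow> 'a set \<Rightarrow> 'a set \<Rightarrow> 'a coned metric_graph" where
  "coned_off G H S =
     \<lparr>verts = Elt ` carrier G \<union> Cone ` (lcosets\<^bsub>G\<^esub> H), adj = coned_adj G S, elen = coned_len\<rparr>"

definition weakly_hyperbolic_rel :: "('a, 'm) monoid_scheme \<Rightarrow> 'a set \<Rightarrow> bool" where
  "weakly_hyperbolic_rel G H \<longleftrightarrow>
     (\<exists>S. finite_generating_set G S \<and> hyperbolic_graph (coned_off G H S))"

fun in_coset :: "'a set \<Rightarrow> 'a coned \<Rightarrow> bool" where
  "in_coset C (Elt x) \<longleftrightarrow> x \<in> C"
| "in_coset C (Cone C') \<longleftrightarrow> C' = C"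

definition penetrates :: "'a coned list \<Rightarrow> 'a set \<Rightarrow> bool" where
  "penetrates xs C \<longleftrightarrow> Cone C \<in> set xs"

definition without_backtracking :: "('a, 'm) monoid_scheme \<Rightarrow> 'a set \<Rightarrow> 'a coned list \<Rightarrow> bool" where
  "without_backtracking G H xs \<longleftrightarrow>
     (\<forall>C\<in>lcosets\<^bsub>G\<^esub> H. \<forall>i j k. i \<le> j \<and> j \<le> k \<and> k < length xs \<and>
        in_coset C (xs ! i) \<and> in_coset C (xs ! k) \<longrightarrow> in_coset C (xs ! j))"

definition coset_elements :: "'a set \<Rightarrow> 'a coned list \<Rightarrow> 'a list" where
  "coset_elements C xs = [x. Elt x \<leftarrow> xs, x \<in> C]"

definition entry_vertex :: "'a set \<Rightarrow> 'a coned list \<Rightarrow> 'a" where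
  "entry_vertex C xs = hd (coset_elements C xs)"

definition exit_vertex :: "'a set \<Rightarrow> 'a coned list \<Rightarrow> 'a" where
  "exit_vertex C xs = last (coset_elements C xs)"

text \<open>The common endpoints are group elements. This makes entry and exit vertices of a penetrated
  coset exist; moreover, paths starting at a cone vertex \<open>v(C)\<close> could run from there to an arbitrary
  element of \<open>C\<close> and back, which would make condition (2) fail for every infinite subgroup \<open>H\<close>.
  The distance travelled in a coset is the distance from the entry to the exit vertex.\<close>

definition electric_path_between ::
  "('a, 'm) monoid_scheme \<Rightarrow> 'a set \<Rightarrow> 'a set \<Rightarrow> real \<Rightarrow> 'a \<Rightarrow> 'a \<Rightarrow> 'a coned list \<Rightarrow> bool" where
  "electric_path_between G H S P x y xs \<longleftrightarrow>
     quasigeodesic (coned_off G H S) P xs \<and> without_backtracking G H xs \<and>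
     hd xs = Elt x \<and> last xs = Elt y"

definition bounded_coset_penetration :: "('a, 'm) monoid_scheme \<Rightarrow> 'a set \<Rightarrow> 'a set \<Rightarrow> bool" where
  "bounded_coset_penetration G H S \<longleftrightarrow>
     (\<forall>P\<ge>1. \<exists>D. \<forall>x\<in>carrier G. \<forall>y\<in>carrier G. \<forall>\<alpha> \<beta>.
        electric_path_between G H S P x y \<alpha> \<and> electric_path_between G H S P x y \<beta> \<longrightarrow>
        (\<forall>C\<in>lcosets\<^bsub>G\<^esub> H.
           (penetrates \<alpha> C \<and> \<not> penetrates \<beta> C \<longrightarrow>
              vertex_dist (cayley_graph G S) (entry_vertex C \<alpha>) (exit_vertex C \<alpha>) \<le> D) \<and>
           (penetrates \<alpha> C \<and> penetrates \<beta> C \<longrightarrow>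
              vertex_dist (cayley_graph G S) (entry_vertex C \<alpha>) (entry_vertex C \<beta>) \<le> D \<and>
              vertex_dist (cayley_graph G S) (exit_vertex C \<alpha>) (exit_vertex C \<beta>) \<le> D)))"

definition strongly_hyperbolic_rel :: "('a, 'm) monoid_scheme \<Rightarrow> 'a set \<Rightarrow> bool" where
  "strongly_hyperbolic_rel G H \<longleftrightarrow>
     (\<exists>S. finite_generating_set G S \<and> hyperbolic_graph (coned_off G H S) \<and>
          bounded_coset_penetration G H S)"

end

theory Submission
  imports Defs "HOL-Algebra.Zassenhaus"
begin

text \<open>
  Since \<open>G\<close> preserves cusps, the normalizer \<open>N\<close> of \<open>K1\<close> maps onto \<open>Q\<close> with kernel \<open>K1\<close>. Fix a coset
  \<open>aK1 \<noteq> K1\<close> and let \<open>n \<in> N\<close> act on \<open>K\<close> by \<open>x \<mapsto> n\<^sup>-\<^sup>1 x n\<close>. Multiplying \<open>n\<close> on the right by \<open>k \<in> K1\<close>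
  translates the place where electric geodesics from \<open>K1\<close> to the image of \<open>aK1\<close> leave \<open>K1\<close> by \<open>k\<^sup>-\<^sup>1\<close>, so each
  fibre of \<open>N \<rightarrow> Q\<close> contains an element for which this exit point is \<open>1\<close>; choosing one gives the section.
  Neighbouring elements of \<open>Q\<close> differ by one of finitely many automorphisms, and by bounded coset
  penetration each of them moves exit points to within bounded distance of exit points. Hence the section
  is Lipschitz, and \<open>p\<close> is a Lipschitz left inverse.

  The section, viewed as a map to \<open>G\<close>, together with \<open>p\<close> exhibits \<open>Q\<close> as a quasi-isometrically embedded subset
  of the coned-off graph of \<open>G\<close>, because \<open>p\<close> is constant on the cosets of \<open>K1\<close>; hyperbolicity
  then passes to \<open>Q\<close> by the stability of quasigeodesics.
\<close>

section \<open>Walks and geodesics in metric graphs\<close>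

text \<open>Bounded coset penetration compares only electric quasigeodesics without backtracking
  that share both endpoints, and neither condition comes for free. Geodesics leaving
  \<open>H\<close> from two candidate exit points start at different elements, and an automorphism
  \<open>f\<close> turns an electric geodesic into a path that may backtrack. The first obstacle is
  removed by putting \<open>h\<close>, \<open>Cone H\<close> in front of a path from
  \<open>k\<close>. For the second, the image is thickened to an induced subgraph that is
  undistorted up to constants. Exit points are encoded as the elements of \<open>H\<close> nearest
  in the electric metric. This involves no choice of geodesic and is equivariant under translation
  by \<open>H\<close>. The exit of the replacement path is only known to be close to
  \<open>f x\<close> for some vertex \<open>x\<close> of the old geodesic. Hence the auxiliary
  estimate \<open>nearest_bounded\<close>: if \<open>x\<close> is close to \<open>z\<close> in
  \<open>H\<close> in the word metric, then a nearest point of \<open>x\<close> is close to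
  \<open>z\<close> in the word metric. The final bound lives in the word metric of \<open>K\<close>,
  while the section needs one in that of \<open>N\<close>; finiteness of balls in \<open>K\<close>
  converts one into the other.\<close>

inductive walk :: "'v metric_graph \<Rightarrow> 'v \<Rightarrow> 'v \<Rightarrow> real \<Rightarrow> bool" for \<Gamma> where
  walk_refl: "a \<in> verts \<Gamma> \<Longrightarrow> walk \<Gamma> a a 0"
| walk_step: "a \<in> verts \<Gamma> \<Longrightarrow> adj \<Gamma> a b \<Longrightarrow> walk \<Gamma> b c r \<Longrightarrow> walk \<Gamma> a c (elen \<Gamma> a b + r)"

text \<open>\<open>vertex_dist\<close> is an infimum and says nothing when no path exists. This
  bound asserts a path, so it keeps its meaning in induced subgraphs not known to be
  connected.\<close>

definition walk_le :: "'v metric_graph \<Rightarrow> 'v \<Rightarrow> 'v \<Rightarrow> real \<Rightarrow> bool" where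
  "walk_le \<Gamma> a b r \<longleftrightarrow> (\<exists>r'\<le>r. walk \<Gamma> a b r')"

lemma walk_verts: "walk \<Gamma> a b r \<Longrightarrow> a \<in> verts \<Gamma> \<and> b \<in> verts \<Gamma>"
  by (induction rule: walk.induct) auto

lemma walk_edge: "a \<in> verts \<Gamma> \<Longrightarrow> b \<in> verts \<Gamma> \<Longrightarrow> adj \<Gamma> a b \<Longrightarrow> walk \<Gamma> a b (elen \<Gamma> a b)"
  using walk_step[OF _ _ walk_refl, of a \<Gamma> b] by simp

lemma walk_trans: "walk \<Gamma> a b r \<Longrightarrow> walk \<Gamma> b c s \<Longrightarrow> walk \<Gamma> a c (r + s)"
proof (induction rule: walk.induct)
  case (walk_step a b c r)
  then show ?case using walk.walk_step[of a \<Gamma> b _ "r + s"] by (simp add: add.assoc)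
qed simp

lemma walk_le_refl: "a \<in> verts \<Gamma> \<Longrightarrow> 0 \<le> r \<Longrightarrow> walk_le \<Gamma> a a r"
  unfolding walk_le_def by (intro exI[of _ 0] conjI walk_refl)

lemma walk_le_trans: "walk_le \<Gamma> a b r \<Longrightarrow> walk_le \<Gamma> b c s \<Longrightarrow> walk_le \<Gamma> a c (r + s)"
proof -
  assume "walk_le \<Gamma> a b r" "walk_le \<Gamma> b c s"
  then obtain r' s' where "r' \<le> r" "s' \<le> s" "walk \<Gamma> a b r'" "walk \<Gamma> b c s'"
    unfolding walk_le_def by (elim exE conjE)
  then show "walk_le \<Gamma> a c (r + s)"
    using walk_trans unfolding walk_le_def by (intro exI[of _ "r' + s'"]) simp
qed

lemma walk_le_mono: "walk_le \<Gamma> a b r \<Longrightarrow> r \<le> s \<Longrightarrow> walk_le \<Gamma> a b s"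
  unfolding walk_le_def by (meson order_trans)

lemma walk_le_edge:
  "a \<in> verts \<Gamma> \<Longrightarrow> b \<in> verts \<Gamma> \<Longrightarrow> adj \<Gamma> a b \<Longrightarrow> elen \<Gamma> a b \<le> r \<Longrightarrow> walk_le \<Gamma> a b r"
  unfolding walk_le_def by (intro exI[of _ "elen \<Gamma> a b"] conjI walk_edge)

text \<open>Lipschitz bounds are checked edge by edge; the factor \<open>elen\<close> accommodates
  the half edges at cone vertices.\<close>

lemma walk_le_map:
  assumes "walk_le \<Gamma> a b r" "0 \<le> L"
    and "\<And>a. a \<in> verts \<Gamma> \<Longrightarrow> f a \<in> verts \<Gamma>'"
    and "\<And>a b. a \<in> verts \<Gamma> \<Longrightarrow> b \<in> verts \<Gamma> \<Longrightarrow> adj \<Gamma> a b \<Longrightarrow> walk_le \<Gamma>' (f a) (f b) (L * elen \<Gamma> a b)"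
  shows "walk_le \<Gamma>' (f a) (f b) (L * r)"
proof -
  obtain r' where r': "r' \<le> r" "walk \<Gamma> a b r'" using assms(1) unfolding walk_le_def by blast
  from r'(2) have "walk_le \<Gamma>' (f a) (f b) (L * r')"
  proof (induction rule: walk.induct)
    case (walk_refl a)
    then show ?case using assms(3) by (simp add: walk_le_refl)
  next
    case (walk_step a b c r)
    then have "walk_le \<Gamma>' (f a) (f b) (L * elen \<Gamma> a b)"
      using assms(4) walk_verts by metis
    then show ?case using walk_step.IH walk_le_trans by (metis distrib_left)
  qed
  then show ?thesis by (rule walk_le_mono) (simp add: r'(1) assms(2) mult_left_mono)
qed

lemma walk_le_verts_mono:
  assumes "walk_le (\<Gamma>\<lparr>verts := V\<rparr>) a b r" "V \<subseteq> W"
  shows "walk_le (\<Gamma>\<lparr>verts := W\<rparr>) a b r"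
proof -
  have "walk_le (\<Gamma>\<lparr>verts := W\<rparr>) a b (1 * r)"
    by (rule walk_le_map[OF assms(1), of 1 "\<lambda>x. x"])
      (use assms(2) in \<open>auto intro!: walk_le_edge\<close>)
  then show ?thesis by simp
qed

section \<open>Translation between walks and the edge paths of the definitions\<close>

lemma path_length_split:
  "i \<le> j \<Longrightarrow> j \<le> k \<Longrightarrow> path_length \<Gamma> xs i k = path_length \<Gamma> xs i j + path_length \<Gamma> xs j k"
  unfolding path_length_def by (simp add: sum.atLeastLessThan_concat)

lemma path_length_same [simp]: "path_length \<Gamma> xs i i = 0"
  by (simp add: path_length_def)

lemma path_length_Suc: "path_length \<Gamma> xs i (Suc i) = elen \<Gamma> (xs ! i) (xs ! Suc i)"
  by (simp add: path_length_def)

lemma path_length_verts [simp]: "path_length (\<Gamma>\<lparr>verts := V\<rparr>) = path_length \<Gamma>"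
  by (auto simp: path_length_def fun_eq_iff)

lemma path_length_Cons: "path_length \<Gamma> (x # xs) (Suc i) (Suc j) = path_length \<Gamma> xs i j"
  unfolding path_length_def sum.shift_bounds_Suc_ivl by simp

lemma edge_path_nth:
  assumes "edge_path \<Gamma> xs"
  shows "i < length xs \<Longrightarrow> xs ! i \<in> verts \<Gamma>"
    and "Suc i < length xs \<Longrightarrow> adj \<Gamma> (xs ! i) (xs ! Suc i)"
  using assms unfolding edge_path_def
  by (auto simp: successively_conv_nth)

lemma path_imp_walk:
  assumes "edge_path \<Gamma> xs" "i \<le> j" "j < length xs"
  shows "walk \<Gamma> (xs ! i) (xs ! j) (path_length \<Gamma> xs i j)"
  using assms(2,3)
proof (induction j rule: dec_induct)
  case base
  then show ?case using edge_path_nth[OF assms(1)] by (auto intro: walk_refl)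
next
  case (step j)
  have "walk \<Gamma> (xs ! j) (xs ! Suc j) (path_length \<Gamma> xs j (Suc j))"
    unfolding path_length_Suc
    by (intro walk_edge edge_path_nth[OF assms(1)] step.prems Suc_lessD)
  moreover have "path_length \<Gamma> xs i (Suc j) = path_length \<Gamma> xs i j + path_length \<Gamma> xs j (Suc j)"
    using step.hyps by (intro path_length_split) auto
  ultimately show ?case using step walk_trans by fastforce
qed

lemma walk_imp_path:
  assumes "walk \<Gamma> a b r"
  shows "\<exists>xs. edge_path \<Gamma> xs \<and> hd xs = a \<and> last xs = b \<and> path_length \<Gamma> xs 0 (length xs - 1) = r"
  using assms
proof (induction rule: walk.induct)
  case (walk_refl a)
  then show ?case by (intro exI[of _ "[a]"]) (auto simp: edge_path_def)
next
  case (walk_step a b c r)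
  then obtain xs where xs: "edge_path \<Gamma> xs" "hd xs = b" "last xs = c"
    "path_length \<Gamma> xs 0 (length xs - 1) = r" by blast
  then obtain ys where ys: "xs = b # ys" unfolding edge_path_def by (cases xs) auto
  have "path_length \<Gamma> (a # xs) 0 (Suc (length ys)) = elen \<Gamma> a b + path_length \<Gamma> xs 0 (length ys)"
    using path_length_split[of 0 1 "Suc (length ys)" \<Gamma> "a # xs"] path_length_Cons[of \<Gamma> a xs 0 "length ys"]
    by (simp add: path_length_Suc[of \<Gamma> _ 0, simplified] ys)
  then show ?case using xs ys walk_step
    by (intro exI[of _ "a # xs"]) (auto simp: edge_path_def)
qed

lemma vertex_dist_walk: "vertex_dist \<Gamma> u v = Inf {r. walk \<Gamma> u v r}"
proof -
  have "{path_length \<Gamma> xs 0 (length xs - 1) | xs. edge_path \<Gamma> xs \<and> hd xs = u \<and> last xs = v}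
      = {r. walk \<Gamma> u v r}" (is "?A = ?B")
  proof
    show "?A \<subseteq> ?B"
    proof safe
      fix xs assume xs: "edge_path \<Gamma> xs" "u = hd xs" "v = last xs"
      then have "xs \<noteq> []" unfolding edge_path_def by blast
      then show "walk \<Gamma> (hd xs) (last xs) (path_length \<Gamma> xs 0 (length xs - 1))"
        using path_imp_walk[OF xs(1), of 0 "length xs - 1"] by (simp add: hd_conv_nth last_conv_nth)
    qed
    show "?B \<subseteq> ?A" using walk_imp_path by fastforce
  qed
  then show ?thesis unfolding vertex_dist_def by simp
qed

text \<open>Common frame for Cayley graphs and coned-off graphs. Since all distances are multiples
  of 1/2, shortest paths and nearest points exist.\<close>

definition half_graph :: "'v metric_graph \<Rightarrow> bool" where
  "half_graph \<Gamma> \<longleftrightarrow> (\<forall>a\<in>verts \<Gamma>. \<forall>b\<in>verts \<Gamma>. adj \<Gamma> a b \<longrightarrow> adj \<Gamma> b a \<and> elen \<Gamma> a b = elen \<Gamma> b a \<and>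
     (elen \<Gamma> a b = 1/2 \<or> elen \<Gamma> a b = 1))"

definition geodesic_path :: "'v metric_graph \<Rightarrow> 'v list \<Rightarrow> bool" where
  "geodesic_path \<Gamma> xs \<longleftrightarrow> edge_path \<Gamma> xs \<and>
     (\<forall>i j. i \<le> j \<and> j < length xs \<longrightarrow> path_length \<Gamma> xs i j = vertex_dist \<Gamma> (xs ! i) (xs ! j))"

definition connected_graph :: "'v metric_graph \<Rightarrow> bool" where
  "connected_graph \<Gamma> \<longleftrightarrow> (\<forall>a\<in>verts \<Gamma>. \<forall>b\<in>verts \<Gamma>. \<exists>r. walk \<Gamma> a b r)"

lemma half_graph_verts: "half_graph \<Gamma> \<Longrightarrow> V \<subseteq> verts \<Gamma> \<Longrightarrow> half_graph (\<Gamma>\<lparr>verts := V\<rparr>)"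
  unfolding half_graph_def by auto

context
  fixes \<Gamma> :: "'v metric_graph"
  assumes half: "half_graph \<Gamma>"
begin

lemma walk_half: "walk \<Gamma> a b r \<Longrightarrow> \<exists>n::nat. r = n / 2"
proof (induction rule: walk.induct)
  case (walk_step a b c r)
  then obtain n :: nat where "r = n / 2" by blast
  moreover have "elen \<Gamma> a b = real 1 / 2 \<or> elen \<Gamma> a b = real 2 / 2"
    using walk_step walk_verts[of \<Gamma> b c r] half unfolding half_graph_def by simp
  ultimately show ?case by (metis add_divide_distrib of_nat_add)
qed (auto intro: exI[of _ 0])

lemma path_length_ge:
  assumes "edge_path \<Gamma> xs" "i \<le> j" "j < length xs"
  shows "real (j - i) / 2 \<le> path_length \<Gamma> xs i j"
proof -
  have "(\<Sum>k\<in>{i..<j}. 1 / 2) \<le> path_length \<Gamma> xs i j"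
    unfolding path_length_def
  proof (rule sum_mono)
    fix k assume "k \<in> {i..<j}"
    then have "elen \<Gamma> (xs ! k) (xs ! Suc k) = 1 / 2 \<or> elen \<Gamma> (xs ! k) (xs ! Suc k) = 1"
      using edge_path_nth[OF assms(1)] half assms(3) unfolding half_graph_def by simp
    then show "1 / 2 \<le> elen \<Gamma> (xs ! k) (xs ! Suc k)" by auto
  qed
  then show ?thesis by simp
qed

lemma walk_nonneg: "walk \<Gamma> a b r \<Longrightarrow> 0 \<le> r"
  using walk_half by fastforce

lemma walk_sym: "walk \<Gamma> a b r \<Longrightarrow> walk \<Gamma> b a r"
proof (induction rule: walk.induct)
  case (walk_step a b c r)
  have "walk \<Gamma> b a (elen \<Gamma> a b)"
    using walk_step walk_verts[of \<Gamma> b c] half walk_edge[of b \<Gamma> a] unfolding half_graph_def by metis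
  then show ?case using walk_step.IH walk_trans by (metis add.commute)
qed (rule walk_refl)

lemma walk_le_sym: "walk_le \<Gamma> a b r \<Longrightarrow> walk_le \<Gamma> b a r"
  unfolding walk_le_def using walk_sym by blast

lemma vertex_dist_attained:
  assumes "walk \<Gamma> a b r"
  shows "walk \<Gamma> a b (vertex_dist \<Gamma> a b)" and "vertex_dist \<Gamma> a b \<le> r"
proof -
  obtain n :: nat where "r = n / 2" using walk_half[OF assms] by blast
  then have ex: "\<exists>n::nat. walk \<Gamma> a b (n / 2)" using assms by blast
  define m where "m = (LEAST n::nat. walk \<Gamma> a b (n / 2))"
  have m: "walk \<Gamma> a b (m / 2)" unfolding m_def by (rule LeastI_ex[OF ex])
  have le: "m / 2 \<le> s" if s: "walk \<Gamma> a b s" for s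
  proof -
    obtain k :: nat where k: "s = k / 2" using walk_half[OF s] by blast
    have "m \<le> k" unfolding m_def by (rule Least_le) (use s in \<open>simp only: k\<close>)
    then show ?thesis using k by simp
  qed
  have "vertex_dist \<Gamma> a b = m / 2" unfolding vertex_dist_walk
    by (rule cInf_eq_minimum) (use m le in auto)
  then show "walk \<Gamma> a b (vertex_dist \<Gamma> a b)" "vertex_dist \<Gamma> a b \<le> r"
    using m le[OF assms] by (simp_all only:)
qed

lemma vertex_dist_le: "walk_le \<Gamma> a b r \<Longrightarrow> vertex_dist \<Gamma> a b \<le> r"
  unfolding walk_le_def using vertex_dist_attained(2) by fastforce

lemma vertex_dist_refl: "a \<in> verts \<Gamma> \<Longrightarrow> vertex_dist \<Gamma> a a = 0"
  using vertex_dist_attained[OF walk_refl] walk_nonneg by (metis order_antisym)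

lemma vertex_dist_sym: "vertex_dist \<Gamma> a b = vertex_dist \<Gamma> b a"
proof -
  have "{r. walk \<Gamma> a b r} = {r. walk \<Gamma> b a r}" using walk_sym by blast
  then show ?thesis unfolding vertex_dist_walk by simp
qed

text \<open>Every segment of a shortest path is shortest, because a shorter segment could be spliced
  in.\<close>

lemma geodesic_exists:
  assumes "walk \<Gamma> a b r"
  shows "\<exists>xs. geodesic_path \<Gamma> xs \<and> hd xs = a \<and> last xs = b"
proof -
  obtain xs where xs: "edge_path \<Gamma> xs" "hd xs = a" "last xs = b"
    and len: "path_length \<Gamma> xs 0 (length xs - 1) = vertex_dist \<Gamma> a b"
    using walk_imp_path[OF vertex_dist_attained(1)[OF assms]] by blast
  have ne: "xs \<noteq> []" using xs(1) unfolding edge_path_def by blast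
  have "path_length \<Gamma> xs i j = vertex_dist \<Gamma> (xs ! i) (xs ! j)" if ij: "i \<le> j" "j < length xs" for i j
  proof -
    let ?n = "length xs - 1"
    note w = path_imp_walk[OF xs(1)]
    have d: "walk \<Gamma> (xs ! i) (xs ! j) (vertex_dist \<Gamma> (xs ! i) (xs ! j))"
      "vertex_dist \<Gamma> (xs ! i) (xs ! j) \<le> path_length \<Gamma> xs i j"
      using vertex_dist_attained[OF w[OF ij]] by blast+
    have "walk \<Gamma> (xs ! 0) (xs ! ?n)
        (path_length \<Gamma> xs 0 i + vertex_dist \<Gamma> (xs ! i) (xs ! j) + path_length \<Gamma> xs j ?n)"
      using w[of 0 i] w[of j ?n] d ij ne by (intro walk_trans[OF walk_trans]) auto
    then have "vertex_dist \<Gamma> a b \<le> path_length \<Gamma> xs 0 i + vertex_dist \<Gamma> (xs ! i) (xs ! j) + path_length \<Gamma> xs j ?n"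
      using vertex_dist_attained(2) xs(2,3) ne by (simp add: hd_conv_nth last_conv_nth)
    moreover have "path_length \<Gamma> xs 0 ?n = path_length \<Gamma> xs 0 i + path_length \<Gamma> xs i j + path_length \<Gamma> xs j ?n"
      using path_length_split[of 0 i ?n \<Gamma> xs] path_length_split[of i j ?n \<Gamma> xs] ij by simp
    ultimately show ?thesis using d(2) len by linarith
  qed
  then show ?thesis using xs unfolding geodesic_path_def by blast
qed

context
  assumes conn: "connected_graph \<Gamma>"
begin

lemma vertex_dist_walk_le:
  assumes "a \<in> verts \<Gamma>" "b \<in> verts \<Gamma>"
  shows "walk_le \<Gamma> a b (vertex_dist \<Gamma> a b)"
proof -
  obtain r where "walk \<Gamma> a b r" using assms conn unfolding connected_graph_def by blast
  from vertex_dist_attained(1)[OF this] show ?thesis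
    unfolding walk_le_def by (intro exI[of _ "vertex_dist \<Gamma> a b"] conjI order_refl)
qed

lemma walk_le_iff:
  assumes "a \<in> verts \<Gamma>" "b \<in> verts \<Gamma>"
  shows "walk_le \<Gamma> a b r \<longleftrightarrow> vertex_dist \<Gamma> a b \<le> r"
  using vertex_dist_le walk_le_mono[OF vertex_dist_walk_le[OF assms]] by (intro iffI)

lemma vertex_dist_nonneg: "a \<in> verts \<Gamma> \<Longrightarrow> b \<in> verts \<Gamma> \<Longrightarrow> 0 \<le> vertex_dist \<Gamma> a b"
  using vertex_dist_walk_le walk_nonneg unfolding walk_le_def by force

lemma vertex_dist_triangle:
  "a \<in> verts \<Gamma> \<Longrightarrow> b \<in> verts \<Gamma> \<Longrightarrow> c \<in> verts \<Gamma> \<Longrightarrow>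
    vertex_dist \<Gamma> a c \<le> vertex_dist \<Gamma> a b + vertex_dist \<Gamma> b c"
  by (rule vertex_dist_le[OF walk_le_trans[OF vertex_dist_walk_le vertex_dist_walk_le]])

lemma geodesic_between:
  assumes "a \<in> verts \<Gamma>" "b \<in> verts \<Gamma>"
  obtains xs where "geodesic_path \<Gamma> xs" "hd xs = a" "last xs = b"
  using assms conn geodesic_exists unfolding connected_graph_def by metis

end
end

text \<open>Prefixes of a walk are no longer than the walk, so it never leaves the ball around its
  start. Distances from the centre therefore do not grow when passing to the subgraph induced on the
  ball.\<close>

lemma walk_le_ball:
  assumes half: "half_graph \<Gamma>" and "walk_le \<Gamma> a b r"
  shows "walk_le (\<Gamma>\<lparr>verts := {e \<in> verts \<Gamma>. walk_le \<Gamma> a e r}\<rparr>) a b r"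
proof -
  obtain r' where r': "r' \<le> r" "walk \<Gamma> a b r'" using assms(2) unfolding walk_le_def by (elim exE conjE)
  obtain xs where xs: "edge_path \<Gamma> xs" "hd xs = a" "last xs = b" "path_length \<Gamma> xs 0 (length xs - 1) = r'"
    using walk_imp_path[OF r'(2)] by blast
  let ?n = "length xs - 1"
  have ne: "xs \<noteq> []" using xs(1) unfolding edge_path_def by blast
  have "walk_le \<Gamma> a (xs ! i) r" if "i < length xs" for i
  proof -
    have "path_length \<Gamma> xs 0 ?n = path_length \<Gamma> xs 0 i + path_length \<Gamma> xs i ?n"
      using that by (intro path_length_split) auto
    moreover have "real (?n - i) / 2 \<le> path_length \<Gamma> xs i ?n"
      using that by (intro path_length_ge[OF half xs(1)]) auto
    ultimately have "path_length \<Gamma> xs 0 i \<le> r'" using xs(4) by simp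
    then show ?thesis using path_imp_walk[OF xs(1) _ that, of 0] xs(2) ne r'(1)
      unfolding walk_le_def by (intro exI[of _ "path_length \<Gamma> xs 0 i"]) (simp add: hd_conv_nth)
  qed
  then have "edge_path (\<Gamma>\<lparr>verts := {e \<in> verts \<Gamma>. walk_le \<Gamma> a e r}\<rparr>) xs"
    using xs(1) unfolding edge_path_def by (auto simp: in_set_conv_nth)
  from path_imp_walk[OF this, of 0 ?n] show ?thesis
    using xs ne r'(1) unfolding walk_le_def by (intro exI[of _ r']) (simp add: hd_conv_nth last_conv_nth)
qed

section \<open>Cayley graphs\<close>

locale generated_group = group G for G (structure) +
  fixes S :: "'a set"
  assumes gen: "finite_generating_set G S"
begin

abbreviation cay :: "'a metric_graph" where "cay \<equiv> cayley_graph G S"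

lemma symmetrized_closed: "s \<in> symmetrized G S \<Longrightarrow> s \<in> carrier G"
  using gen unfolding symmetrized_def finite_generating_set_def by auto

lemma symmetrized_inv: "s \<in> symmetrized G S \<Longrightarrow> inv s \<in> symmetrized G S"
  using gen inv_inv unfolding symmetrized_def finite_generating_set_def by auto

lemma finite_symmetrized: "finite (symmetrized G S)"
  using gen unfolding symmetrized_def finite_generating_set_def by auto

lemma cay_simps [simp]:
  "verts cay = carrier G" "adj cay x y \<longleftrightarrow> x \<noteq> y \<and> inv x \<otimes> y \<in> symmetrized G S" "elen cay x y = 1"
  by (simp_all add: cayley_graph_def)

abbreviation word :: "'a list \<Rightarrow> 'a" where "word ws \<equiv> foldr (\<lambda>a b. a \<otimes> b) ws \<one>"

lemma word_closed: "set ws \<subseteq> symmetrized G S \<Longrightarrow> word ws \<in> carrier G"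
  by (induction ws) (auto simp: symmetrized_closed)

lemma word_append:
  "set us \<subseteq> symmetrized G S \<Longrightarrow> set vs \<subseteq> symmetrized G S \<Longrightarrow> word (us @ vs) = word us \<otimes> word vs"
proof (induction us)
  case (Cons a us)
  then show ?case
    using word_closed[of us] word_closed[of vs] by (simp add: m_assoc symmetrized_closed word_closed del: foldr_append)
qed (simp add: word_closed)

lemma word_exists:
  assumes "g \<in> carrier G"
  shows "\<exists>ws. set ws \<subseteq> symmetrized G S \<and> word ws = g"
proof -
  have "g \<in> generate G S" using assms gen unfolding finite_generating_set_def by simp
  then show ?thesis
  proof (induction rule: generate.induct)
    case one
    then show ?case by (intro exI[of _ "[]"]) auto
  next
    case (incl h)
    then show ?case using symmetrized_closed[of h]
      by (intro exI[of _ "[h]"]) (auto simp: symmetrized_def)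
  next
    case (inv h)
    then show ?case using symmetrized_closed[of "inv h"]
      by (intro exI[of _ "[inv h]"]) (auto simp: symmetrized_def)
  next
    case (eng h1 h2)
    then obtain us vs where "set us \<subseteq> symmetrized G S" "word us = h1" "set vs \<subseteq> symmetrized G S" "word vs = h2"
      by blast
    then show ?case using word_append by (intro exI[of _ "us @ vs"]) (auto simp del: foldr_append)
  qed
qed

lemma half_graph_cay: "half_graph cay"
  unfolding half_graph_def
proof (intro ballI impI conjI)
  fix a b assume M: "a \<in> verts cay" "b \<in> verts cay" and ab: "adj cay a b"
  then have "inv b \<otimes> a = inv (inv a \<otimes> b)" by (simp add: inv_mult_group)
  then show "adj cay b a" using ab symmetrized_inv by auto
qed simp_all

lemma walk_le_word:
  assumes "x \<in> carrier G" "set ws \<subseteq> symmetrized G S"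
  shows "walk_le cay x (x \<otimes> word ws) (length ws)"
  using assms
proof (induction ws arbitrary: x)
  case Nil
  then show ?case by (simp add: walk_le_refl)
next
  case (Cons s ws)
  have s: "s \<in> carrier G" "s \<in> symmetrized G S" "word ws \<in> carrier G"
    using Cons.prems symmetrized_closed word_closed by auto
  have "walk_le cay x (x \<otimes> s) 1"
  \<comment> \<open>A generator may be trivial and then gives no edge, since adjacency excludes
    equal vertices.\<close>
  proof (cases "x = x \<otimes> s")
    case True
    then show ?thesis using Cons.prems walk_le_refl[of x cay 1] by simp
  next
    case False
    then show ?thesis using Cons.prems s by (intro walk_le_edge) (simp_all add: inv_solve_left' m_assoc[symmetric])
  qed
  moreover have "walk_le cay (x \<otimes> s) (x \<otimes> s \<otimes> word ws) (length ws)"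
    using Cons s by (intro Cons.IH) auto
  ultimately show ?case using walk_le_trans s Cons.prems by (fastforce simp: m_assoc)
qed

lemma walk_word:
  assumes "walk cay x y r"
  shows "\<exists>ws. set ws \<subseteq> symmetrized G S \<and> x \<otimes> word ws = y \<and> real (length ws) = r"
  using assms
proof (induction rule: walk.induct)
  case (walk_refl a)
  then show ?case by (intro exI[of _ "[]"]) auto
next
  case (walk_step a b c r)
  then obtain ws where ws: "set ws \<subseteq> symmetrized G S" "b \<otimes> word ws = c" "real (length ws) = r" by blast
  have b: "b \<in> carrier G" using walk_step walk_verts[of cay b c] by simp
  have "a \<otimes> word ((inv a \<otimes> b) # ws) = c"
    using ws b walk_step.hyps(1) word_closed[OF ws(1)] by (simp add: m_assoc[symmetric])
  then show ?case using ws walk_step.hyps(2) by (intro exI[of _ "(inv a \<otimes> b) # ws"]) auto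
qed

lemma connected_graph_cay: "connected_graph cay"
  unfolding connected_graph_def
proof (intro ballI)
  fix a b assume "a \<in> verts cay" "b \<in> verts cay"
  then have ab: "a \<in> carrier G" "b \<in> carrier G" by simp_all
  obtain ws where ws: "set ws \<subseteq> symmetrized G S" "word ws = inv a \<otimes> b" using word_exists[of "inv a \<otimes> b"] ab by auto
  have "a \<otimes> word ws = b" unfolding ws using ab by (simp add: m_assoc[symmetric])
  then show "\<exists>r. walk cay a b r" using walk_le_word[OF ab(1) ws(1)] unfolding walk_le_def by auto
qed

text \<open>A walk spells a word of exactly its length. A word read from \<open>x\<close> gives a
  walk of at most its length, as trivial letters contribute nothing. So the two minima
  agree.\<close>

lemma word_dist_eq:
  assumes "x \<in> carrier G" "y \<in> carrier G"
  shows "word_dist G S x y = vertex_dist cay x y"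
proof -
  let ?P = "\<lambda>n. \<exists>ws. length ws = n \<and> set ws \<subseteq> symmetrized G S \<and> word ws = inv x \<otimes> y"
  have iff: "x \<otimes> word ws = y \<longleftrightarrow> word ws = inv x \<otimes> y" if "set ws \<subseteq> symmetrized G S" for ws
    using assms word_closed[OF that] by (metis inv_solve_left)
  have "walk_le cay x y (vertex_dist cay x y)"
    using vertex_dist_walk_le[OF half_graph_cay connected_graph_cay] assms by simp
  have conn: "\<exists>r. walk cay x y r" using assms connected_graph_cay unfolding connected_graph_def by simp
  obtain ws where ws: "set ws \<subseteq> symmetrized G S" "x \<otimes> word ws = y" "real (length ws) = vertex_dist cay x y"
    using walk_word vertex_dist_attained(1)[OF half_graph_cay] conn by blast
  have P: "?P (length ws)" using ws iff by blast
  have "word_length G S (inv x \<otimes> y) = length ws"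
    unfolding word_length_def
  proof (rule Least_equality)
    show "?P (length ws)" by (rule P)
  next
    fix n assume "?P n"
    then obtain us where us: "length us = n" "set us \<subseteq> symmetrized G S" "x \<otimes> word us = y" using iff by blast
    then have "vertex_dist cay x y \<le> n"
      using walk_le_word[OF assms(1) us(2)] vertex_dist_le[OF half_graph_cay] by metis
    then show "length ws \<le> n" using ws by simp
  qed
  then show ?thesis unfolding word_dist_def using ws by simp
qed

lemma walk_le_word_dist:
  "x \<in> carrier G \<Longrightarrow> y \<in> carrier G \<Longrightarrow> walk_le cay x y (word_dist G S x y)"
  unfolding word_dist_eq using vertex_dist_walk_le[OF half_graph_cay connected_graph_cay] by simp

lemma walk_le_cay_iff:
  "x \<in> carrier G \<Longrightarrow> y \<in> carrier G \<Longrightarrow> walk_le cay x y r \<longleftrightarrow> word_dist G S x y \<le> r"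
  unfolding word_dist_eq using walk_le_iff[OF half_graph_cay connected_graph_cay] by simp

lemma walk_le_cay_sym: "walk_le cay x y r \<Longrightarrow> walk_le cay y x r"
  by (rule walk_le_sym[OF half_graph_cay])

lemma word_dist_mult_left:
  "g \<in> carrier G \<Longrightarrow> x \<in> carrier G \<Longrightarrow> y \<in> carrier G \<Longrightarrow> word_dist G S (g \<otimes> x) (g \<otimes> y) = word_dist G S x y"
  unfolding word_dist_def by (simp add: inv_mult_group m_assoc) (simp add: m_assoc[symmetric])

text \<open>Properness of the word metric. It later leaves only finitely many elements by which two
  centred lifts can differ.\<close>

lemma finite_ball: "finite {g \<in> carrier G. word_dist G S \<one> g \<le> r}"
proof -
  have "{g \<in> carrier G. word_dist G S \<one> g \<le> r} \<subseteq> word ` {ws. set ws \<subseteq> symmetrized G S \<and> length ws \<le> nat \<lfloor>r\<rfloor>}"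
  proof
    fix g assume "g \<in> {g \<in> carrier G. word_dist G S \<one> g \<le> r}"
    then have g: "g \<in> carrier G" "word_dist G S \<one> g \<le> r" by auto
    have conn: "\<exists>r. walk cay \<one> g r" using g connected_graph_cay unfolding connected_graph_def by simp
    obtain ws where ws: "set ws \<subseteq> symmetrized G S" "\<one> \<otimes> word ws = g" "real (length ws) = vertex_dist cay \<one> g"
      using walk_word vertex_dist_attained(1)[OF half_graph_cay] conn by blast
    then have "real (length ws) \<le> r" using g word_dist_eq[of \<one> g] by simp
    then have "length ws \<le> nat \<lfloor>r\<rfloor>" by linarith
    then show "g \<in> word ` {ws. set ws \<subseteq> symmetrized G S \<and> length ws \<le> nat \<lfloor>r\<rfloor>}"
      using ws word_closed by (intro image_eqI[of _ _ ws]) auto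
  qed
  then show ?thesis
    by (rule finite_subset) (intro finite_imageI finite_lists_length_le finite_symmetrized)
qed

lemma word_dist_nonneg: "0 \<le> word_dist G S x y"
  unfolding word_dist_def by simp

lemma hom_lipschitz:
  assumes "generated_group G' S'" "f \<in> hom G G'"
  obtains L where "1 \<le> L" "\<And>x y r. walk_le cay x y r \<Longrightarrow> walk_le (cayley_graph G' S') (f x) (f y) (L * r)"
proof -
  interpret G': generated_group G' S' by (rule assms(1))
  interpret f: group_hom G G' f
    by unfold_locales (rule assms(2))
  \<comment> \<open>The sum over the finite generating set bounds every single image; the summand 1
    ensures \<open>1 \<le> L\<close>.\<close>
  define L where "L = 1 + (\<Sum>s\<in>symmetrized G S. word_dist G' S' \<one>\<^bsub>G'\<^esub> (f s))"
  have L1: "1 \<le> L" unfolding L_def using G'.word_dist_nonneg by (simp add: sum_nonneg)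
  have "walk_le G'.cay (f x) (f y) (L * r)" if "walk_le cay x y r" for x y r
  proof (rule walk_le_map[OF that])
    fix a b assume "a \<in> verts cay" "b \<in> verts cay" and adj: "adj cay a b"
    then have ab: "a \<in> carrier G" "b \<in> carrier G" by simp_all
    have "f b = f a \<otimes>\<^bsub>G'\<^esub> f (inv a \<otimes> b)"
      using ab by (simp flip: f.hom_mult add: m_assoc[symmetric] del: f.hom_inv)
    then have "word_dist G' S' (f a) (f b) = word_dist G' S' \<one>\<^bsub>G'\<^esub> (f (inv a \<otimes> b))"
      using ab G'.word_dist_mult_left[of "f a" "\<one>\<^bsub>G'\<^esub>" "f (inv a \<otimes> b)"] by simp
    also have "\<dots> \<le> L"
      using member_le_sum[of "inv a \<otimes> b" "symmetrized G S" "\<lambda>s. word_dist G' S' \<one>\<^bsub>G'\<^esub> (f s)"]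
        adj finite_symmetrized G'.word_dist_nonneg unfolding L_def by simp
    finally show "walk_le G'.cay (f a) (f b) (L * elen cay a b)"
      using ab by (simp add: G'.walk_le_cay_iff)
  qed (use L1 in simp_all)
  then show ?thesis using that L1 by blast
qed

end

section \<open>Coned-off Cayley graphs\<close>

lemma set_coset_elements: "set (coset_elements C xs) = {x \<in> C. Elt x \<in> set xs}"
  unfolding coset_elements_def by (induction xs) (auto split: coned.splits)

fun coned_map :: "('a \<Rightarrow> 'a) \<Rightarrow> 'a coned \<Rightarrow> 'a coned" where
  "coned_map f (Elt x) = Elt (f x)"
| "coned_map f (Cone C) = Cone (f ` C)"

locale coned_group = generated_group +
  fixes H :: "'a set"
  assumes H: "subgroup H G"
begin

abbreviation con :: "'a coned metric_graph" where "con \<equiv> coned_off G H S"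
abbreviation dc :: "'a coned \<Rightarrow> 'a coned \<Rightarrow> real" where "dc \<equiv> vertex_dist con"

lemma con_simps [simp]:
  "verts con = Elt ` carrier G \<union> Cone ` (lcosets H)" "adj con = coned_adj G S" "elen con = coned_len"
  by (simp_all add: coned_off_def)

lemma lcosetI: "x \<in> carrier G \<Longrightarrow> x <# H \<in> lcosets H" "x \<in> carrier G \<Longrightarrow> x \<in> x <# H"
  using H lcos_self by (auto simp: LCOSETS_def)

lemma lcosetD:
  assumes "C \<in> lcosets H" "x \<in> C"
  shows "x \<in> carrier G" and "C = x <# H"
proof -
  show x: "x \<in> carrier G" using assms(2) subgroup.lcosets_carrier[OF H is_group assms(1)] by (rule rev_subsetD)
  show "C = x <# H" using lcos_disjoint[OF H assms(1) lcosetI(1)[OF x]] lcosetI(2)[OF x] assms(2) by blast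
qed

lemma H_lcoset: "H \<in> lcosets H"
proof -
  have "\<one> <# H = H" using H by (simp add: lcos_mult_one subgroup.subset)
  then show ?thesis using lcosetI(1)[OF one_closed] by simp
qed

lemma H_carrier: "h \<in> H \<Longrightarrow> h \<in> carrier G"
  by (rule subgroup.mem_carrier[OF H])

lemma half_graph_con: "half_graph con"
  unfolding half_graph_def
proof (intro ballI impI)
  fix a b assume "a \<in> verts con" "b \<in> verts con" "adj con a b"
  then show "adj con b a \<and> elen con a b = elen con b a \<and> (elen con a b = 1 / 2 \<or> elen con a b = 1)"
  proof (cases a; cases b)
    fix x y assume xy: "a = Elt x" "b = Elt y"
    then have "x \<in> verts cay" "y \<in> verts cay" "adj cay x y"
      using \<open>a \<in> verts con\<close> \<open>b \<in> verts con\<close> \<open>adj con a b\<close> by auto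
    then have "adj cay y x" using half_graph_cay unfolding half_graph_def by blast
    then show ?thesis using xy by simp
  qed (use \<open>adj con a b\<close> in auto)
qed

lemma half_graph_sub: "V \<subseteq> verts con \<Longrightarrow> half_graph (con\<lparr>verts := V\<rparr>)"
  by (rule half_graph_verts[OF half_graph_con])

lemma walk_le_Elt:
  assumes "walk_le (cay\<lparr>verts := E\<rparr>) x y r" "Elt ` E \<subseteq> V"
  shows "walk_le (con\<lparr>verts := V\<rparr>) (Elt x) (Elt y) r"
proof -
  have "walk_le (con\<lparr>verts := V\<rparr>) (Elt x) (Elt y) (1 * r)"
    by (rule walk_le_map[OF assms(1)]) (use assms(2) in \<open>auto intro!: walk_le_edge\<close>)
  then show ?thesis by simp
qed

lemma walk_le_Cone:
  assumes "C \<in> lcosets H" "x \<in> C" "Elt x \<in> V" "Cone C \<in> V"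
  shows "walk_le (con\<lparr>verts := V\<rparr>) (Elt x) (Cone C) (1 / 2)"
    and "walk_le (con\<lparr>verts := V\<rparr>) (Cone C) (Elt x) (1 / 2)"
  using assms by (auto intro!: walk_le_edge)

lemma con_verts_same [simp]: "con\<lparr>verts := Elt ` carrier G \<union> Cone ` (lcosets H)\<rparr> = con"
  by (simp add: coned_off_def)

lemma walk_le_con_Elt:
  assumes "walk_le cay x y r"
  shows "walk_le con (Elt x) (Elt y) r"
proof -
  have "walk_le (cay\<lparr>verts := carrier G\<rparr>) x y r" using assms by (simp add: cayley_graph_def)
  from walk_le_Elt[OF this, of "verts con"] show ?thesis by simp
qed

lemma walk_le_con_Cone:
  assumes "C \<in> lcosets H" "x \<in> C"
  shows "walk_le con (Elt x) (Cone C) (1 / 2)" "walk_le con (Cone C) (Elt x) (1 / 2)"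
  using walk_le_Cone[OF assms, of "verts con"] assms lcosetD by auto

lemma walk_le_same_coset:
  assumes "C \<in> lcosets H" "x \<in> C" "y \<in> C"
  shows "walk_le con (Elt x) (Elt y) 1"
  using walk_le_trans[OF walk_le_con_Cone(1)[OF assms(1,2)] walk_le_con_Cone(2)[OF assms(1,3)]] by simp

lemma connected_graph_con: "connected_graph con"
proof -
  have Elt: "\<exists>r. walk_le con (Elt x) (Elt y) r" if "x \<in> carrier G" "y \<in> carrier G" for x y
    using walk_le_con_Elt[OF walk_le_word_dist[OF that]] by blast
  have near: "\<exists>x\<in>carrier G. \<exists>r. walk_le con a (Elt x) r" if a: "a \<in> verts con" for a
  proof (cases a)
    case (Elt x)
    then show ?thesis using a walk_le_refl[of a con 0] by auto
  next
    case (Cone C)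
    then obtain x where x: "C = x <# H" "x \<in> carrier G" using a by (auto simp: LCOSETS_def)
    then show ?thesis using walk_le_con_Cone(2)[of C x] lcosetI Cone by blast
  qed
  show ?thesis unfolding connected_graph_def
  proof (intro ballI)
    fix a b assume ab: "a \<in> verts con" "b \<in> verts con"
    obtain x r where x: "x \<in> carrier G" "walk_le con a (Elt x) r" using near ab(1) by blast
    obtain y t where y: "y \<in> carrier G" "walk_le con b (Elt y) t" using near ab(2) by blast
    obtain u where "walk_le con (Elt x) (Elt y) u" using Elt x(1) y(1) by blast
    then have "walk_le con a b (r + u + t)"
      using x(2) walk_le_sym[OF half_graph_con y(2)] walk_le_trans by metis
    then show "\<exists>r. walk con a b r" unfolding walk_le_def by blast
  qed
qed

lemmas dc_walk_le = vertex_dist_walk_le[OF half_graph_con connected_graph_con]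
lemmas dc_le = vertex_dist_le[OF half_graph_con]
lemmas dc_tri = vertex_dist_triangle[OF half_graph_con connected_graph_con]
lemmas dc_nonneg = vertex_dist_nonneg[OF half_graph_con connected_graph_con]
lemmas dc_sym = vertex_dist_sym[OF half_graph_con]

text \<open>A map permuting or merging left cosets carries cone edges to cone edges of the same
  length, which is where \<open>1 \<le> L\<close> enters; edges between elements are controlled by
  \<open>lip\<close>.\<close>

lemma coned_map_lipschitz:
  assumes L: "1 \<le> L"
    and f: "\<And>x. x \<in> carrier G \<Longrightarrow> f x \<in> carrier G" "\<And>C. C \<in> lcosets H \<Longrightarrow> f ` C \<in> lcosets H"
    and lip: "\<And>x y r. walk_le cay x y r \<Longrightarrow> walk_le cay (f x) (f y) (L * r)"
    and w: "walk_le con u v r"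
  shows "walk_le con (coned_map f u) (coned_map f v) (L * r)"
proof (rule walk_le_map[OF w])
  show "coned_map f a \<in> verts con" if "a \<in> verts con" for a using that f by auto
  have cone: "walk_le con (Elt (f x)) (Cone (f ` C)) (L * (1 / 2))"
    "walk_le con (Cone (f ` C)) (Elt (f x)) (L * (1 / 2))" if "C \<in> lcosets H" "x \<in> C" for x C
    using walk_le_con_Cone[OF f(2)[OF that(1)] imageI[OF that(2)]] L
    by (auto elim!: walk_le_mono)
  fix a b assume ab: "a \<in> verts con" "b \<in> verts con" "adj con a b"
  have lip1: "walk_le con (Elt (f x)) (Elt (f y)) L"
    if "x \<in> carrier G" "y \<in> carrier G" "adj cay x y" for x y
    using walk_le_con_Elt[OF lip[OF walk_le_edge[of x cay y 1]]] that by simp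
  show "walk_le con (coned_map f a) (coned_map f b) (L * elen con a b)"
    using ab cone lip1 by (cases a; cases b) auto
qed (use L in simp)

text \<open>Geodesics of the subgraph induced on such a set cannot backtrack: two of their vertices in one
  coset are already joined through its cone vertex.\<close>

definition coset_closed :: "'a coned set \<Rightarrow> bool" where
  "coset_closed V \<longleftrightarrow> V \<subseteq> verts con \<and> (\<forall>C\<in>lcosets H. \<forall>a\<in>V. \<forall>b\<in>V.
     in_coset C a \<and> in_coset C b \<and> a \<noteq> b \<longrightarrow> Cone C \<in> V)"

lemma coset_closed_verts: "coset_closed (verts con)"
  unfolding coset_closed_def by auto

lemma geodesic_without_backtracking:
  assumes V: "coset_closed V" and xs: "geodesic_path (con\<lparr>verts := V\<rparr>) xs"
  shows "without_backtracking G H xs"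
  unfolding without_backtracking_def
proof (intro ballI allI impI)
  fix C i j k assume C: "C \<in> lcosets H"
    and *: "i \<le> j \<and> j \<le> k \<and> k < length xs \<and> in_coset C (xs ! i) \<and> in_coset C (xs ! k)"
  let ?Y = "con\<lparr>verts := V\<rparr>"
  have VV: "V \<subseteq> verts con" using V unfolding coset_closed_def by blast
  note half = half_graph_sub[OF VV]
  have ep: "edge_path ?Y xs" using xs unfolding geodesic_path_def by blast
  have mem: "xs ! l \<in> V" if "l < length xs" for l using edge_path_nth(1)[OF ep that] by simp
  have inV: "xs ! i \<in> V" "xs ! k \<in> V" using mem * by auto
  have len: "path_length con xs i k = vertex_dist ?Y (xs ! i) (xs ! k)"
    using xs * unfolding geodesic_path_def by (metis order_trans path_length_verts)
  have ge: "real (k - i) / 2 \<le> path_length con xs i k"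
    using path_length_ge[OF half ep, of i k] * by simp
  consider (eq) "xs ! i = xs ! k" | (EE) x y where "xs ! i = Elt x" "xs ! k = Elt y" "xs ! i \<noteq> xs ! k"
    | (mixed) x where "xs ! i = Elt x \<and> xs ! k = Cone C \<or> xs ! k = Elt x \<and> xs ! i = Cone C"
    using * by (cases "xs ! i"; cases "xs ! k") auto
  then show "in_coset C (xs ! j)"
  proof cases
    case eq
    then have "vertex_dist ?Y (xs ! i) (xs ! k) = 0" using vertex_dist_refl[OF half] inV by simp
    then have "k = i" using len ge * by simp
    then show ?thesis using * by auto
  next
    case mixed
    have "walk_le ?Y (xs ! i) (xs ! k) (1 / 2)"
      using mixed * inV walk_le_Cone[OF C, of x V] by auto
    from vertex_dist_le[OF half this] have "path_length con xs i k \<le> 1 / 2" unfolding len .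
    then have "k - i \<le> 1" using ge by simp
    then have "j = i \<or> j = k" using * by linarith
    then show ?thesis using * by auto
  next
    case EE
    then have "Cone C \<in> V" using V C * inV unfolding coset_closed_def by blast
    then have "walk_le ?Y (xs ! i) (xs ! k) (1 / 2 + 1 / 2)"
      using EE * inV walk_le_Cone[OF C, of x V] walk_le_Cone[OF C, of y V]
      by (intro walk_le_trans[of _ _ "Cone C"]) auto
    then have le: "path_length con xs i k \<le> 1" using vertex_dist_le[OF half] len by fastforce
    \<comment> \<open>Edges have length at least 1/2, so a segment of length at most 1 has at most
      one interior vertex.\<close>
    then have "k - i \<le> 2" using ge by simp
    show ?thesis
    proof (cases "j = i \<or> j = k")
      case True
      then show ?thesis using * by auto
    next
      case False
      then have jk: "j = Suc i" "k = Suc j" using \<open>k - i \<le> 2\<close> * by linarith+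
      have "path_length con xs i k = elen con (xs ! i) (xs ! j) + elen con (xs ! j) (xs ! k)"
        using path_length_split[of i j k con xs] jk by (simp add: path_length_Suc)
      \<comment> \<open>If the interior vertex were an element, the two edges would have total
        length 2. So it is a cone vertex, and its coset contains \<open>x\<close>, hence is
        \<open>C\<close>.\<close>
      then obtain C' where C': "xs ! j = Cone C'" using EE le by (cases "xs ! j") auto
      have "adj ?Y (xs ! i) (xs ! j)" using edge_path_nth(2)[OF ep] jk * by simp
      then have "x \<in> C'" using EE C' by simp
      moreover have "C' \<in> lcosets H" using mem[of j] C' VV * by auto
      ultimately have "C' = C" using lcosetD(2)[OF C] lcosetD(2) EE * by fastforce
      then show ?thesis using C' by simp
    qed
  qed
qed

section \<open>Construction and comparison of electric quasigeodesics\<close>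

lemma edge_path_dc_le:
  assumes "edge_path con xs" "i \<le> j" "j < length xs"
  shows "dc (xs ! i) (xs ! j) \<le> path_length con xs i j"
  using path_imp_walk[OF assms] vertex_dist_attained(2)[OF half_graph_con] by blast

text \<open>A path is never shorter than the distance between its ends, so only the bound of length
  by distance has to be checked.\<close>

lemma quasigeodesicI:
  assumes ep: "edge_path con xs" and P: "1 \<le> P"
    and le: "\<And>i j. i \<le> j \<Longrightarrow> j < length xs \<Longrightarrow> path_length con xs i j \<le> P * (dc (xs ! i) (xs ! j) + P)"
  shows "quasigeodesic con P xs"
  unfolding quasigeodesic_def
proof (intro conjI allI impI)
  fix i j assume ij: "i \<le> j \<and> j < length xs"
  have "(1 / P) * path_length con xs i j \<le> dc (xs ! i) (xs ! j) + P"
    using le ij P by (simp add: field_simps)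
  then show "(1 / P) * path_length con xs i j - P \<le> dc (xs ! i) (xs ! j)" by simp
  have "0 \<le> path_length con xs i j"
    using path_length_ge[OF half_graph_con ep, of i j] ij by (simp add: order_trans[rotated])
  then have "path_length con xs i j \<le> P * path_length con xs i j" using P by (simp add: mult_le_cancel_right1)
  then show "dc (xs ! i) (xs ! j) \<le> P * path_length con xs i j + P"
    using edge_path_dc_le[OF ep, of i j] ij P by simp
qed (rule ep)

lemma quasigeodesicD:
  assumes "quasigeodesic con P xs" "1 \<le> P" "i \<le> j" "j < length xs"
  shows "path_length con xs i j \<le> P * (dc (xs ! i) (xs ! j) + P)"
proof -
  have "(1 / P) * path_length con xs i j - P \<le> dc (xs ! i) (xs ! j)"
    using assms unfolding quasigeodesic_def by blast
  then have "P * ((1 / P) * path_length con xs i j) \<le> P * (dc (xs ! i) (xs ! j) + P)"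
    using assms(2) by (intro mult_left_mono) auto
  then show ?thesis using assms(2) by simp
qed

lemma quasigeodesic_mono:
  assumes "quasigeodesic con P xs" "1 \<le> P" "P \<le> P'"
  shows "quasigeodesic con P' xs"
proof (rule quasigeodesicI)
  show ep: "edge_path con xs" using assms(1) unfolding quasigeodesic_def by blast
  fix i j assume ij: "i \<le> j" "j < length xs"
  have "0 \<le> dc (xs ! i) (xs ! j)" using edge_path_nth(1)[OF ep] ij by (intro dc_nonneg) auto
  then have "P * (dc (xs ! i) (xs ! j) + P) \<le> P' * (dc (xs ! i) (xs ! j) + P')"
    using assms by (intro mult_mono) auto
  then show "path_length con xs i j \<le> P' * (dc (xs ! i) (xs ! j) + P')"
    using quasigeodesicD[OF assms(1,2) ij] by linarith
qed (use assms in simp)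

lemma electric_path_mono:
  "electric_path_between G H S P x y xs \<Longrightarrow> 1 \<le> P \<Longrightarrow> P \<le> P' \<Longrightarrow> electric_path_between G H S P' x y xs"
  unfolding electric_path_between_def using quasigeodesic_mono by blast

text \<open>Source of the admissible paths: a geodesic of the induced subgraph on \<open>V\<close>
  does not backtrack because \<open>V\<close> is coset-closed, and it is an electric quasigeodesic
  because \<open>qc\<close> bounds the distortion of \<open>V\<close>.\<close>

lemma electric_path_exists:
  assumes V: "coset_closed V" and P: "1 \<le> P"
    and xy: "Elt x \<in> V" "Elt y \<in> V"
    and qc: "\<And>a b. a \<in> V \<Longrightarrow> b \<in> V \<Longrightarrow> walk_le (con\<lparr>verts := V\<rparr>) a b (P * (dc a b + P))"
  obtains xs where "electric_path_between G H S P x y xs" "set xs \<subseteq> V"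
proof -
  let ?Y = "con\<lparr>verts := V\<rparr>"
  have VV: "V \<subseteq> verts con" using V unfolding coset_closed_def by blast
  note half = half_graph_sub[OF VV]
  obtain xs where xs: "geodesic_path ?Y xs" "hd xs = Elt x" "last xs = Elt y"
    using geodesic_exists[OF half] qc[OF xy] unfolding walk_le_def by metis
  have ep: "edge_path ?Y xs" using xs unfolding geodesic_path_def by blast
  then have sub: "set xs \<subseteq> V" and epc: "edge_path con xs" using VV unfolding edge_path_def by auto
  have "quasigeodesic con P xs"
  proof (rule quasigeodesicI[OF epc P])
    fix i j assume ij: "i \<le> j" "j < length xs"
    have "path_length con xs i j = vertex_dist ?Y (xs ! i) (xs ! j)"
      using xs(1) ij unfolding geodesic_path_def by (metis path_length_verts)
    also have "\<dots> \<le> P * (dc (xs ! i) (xs ! j) + P)"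
      using sub ij by (intro vertex_dist_le[OF half] qc) auto
    finally show "path_length con xs i j \<le> P * (dc (xs ! i) (xs ! j) + P)" .
  qed
  then show ?thesis
    using that xs sub geodesic_without_backtracking[OF V xs(1)] unfolding electric_path_between_def by blast
qed

text \<open>Changes the starting point within \<open>H\<close>, so that paths from different
  elements of \<open>H\<close> become comparable. The two half edges add length 1, whence
  \<open>P + 1\<close>; \<open>only\<close> keeps the extended path from coming back to
  \<open>H\<close>.\<close>

lemma electric_path_prefix:
  assumes xs: "electric_path_between G H S P k y xs" and P: "1 \<le> P"
    and only: "\<And>j. 0 < j \<Longrightarrow> j < length xs \<Longrightarrow> \<not> in_coset H (xs ! j)"
    and hk: "h \<in> H" "k \<in> H"
  shows "electric_path_between G H S (P + 1) h y (Elt h # Cone H # xs)"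
proof -
  have qg: "quasigeodesic con P xs" and nb: "without_backtracking G H xs" and ends: "hd xs = Elt k" "last xs = Elt y"
    using xs unfolding electric_path_between_def by blast+
  have ep: "edge_path con xs" using qg unfolding quasigeodesic_def by blast
  have ne: "xs \<noteq> []" using ep unfolding edge_path_def by blast
  have xs0: "xs ! 0 = Elt k" using ends ne by (simp add: hd_conv_nth)
  let ?zs = "Elt h # Cone H # xs"
  have epz: "edge_path con ?zs"
    using ep ne ends hk H_carrier H_lcoset unfolding edge_path_def by (simp add: successively_Cons)
  have mem: "?zs ! i \<in> verts con" if "i < length ?zs" for i by (rule edge_path_nth(1)[OF epz that])
  have le1: "dc (?zs ! i) (Elt k) \<le> 1" and pl1: "path_length con ?zs i 2 \<le> 1" if "i \<le> 1" for i
  proof -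
    have i: "i = 0 \<or> i = 1" using that by auto
    then show "dc (?zs ! i) (Elt k) \<le> 1"
      using dc_le[OF walk_le_same_coset[OF H_lcoset hk]] dc_le[OF walk_le_con_Cone(2)[OF H_lcoset hk(2)]] by auto
    have "path_length con ?zs 0 2 = path_length con ?zs 0 (Suc 0) + path_length con ?zs (Suc 0) (Suc (Suc 0))"
      using path_length_split[of 0 1 2 con ?zs] by (simp add: numeral_2_eq_2)
    then show "path_length con ?zs i 2 \<le> 1"
      using i xs0 by (auto simp: path_length_Suc numeral_2_eq_2)
  qed
  have "quasigeodesic con (P + 1) ?zs"
  proof (rule quasigeodesicI[OF epz])
    fix i j assume ij: "i \<le> j" "j < length ?zs"
    have d0: "0 \<le> dc (?zs ! i) (?zs ! j)" using ij mem by (intro dc_nonneg) auto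
    have P0: "0 \<le> P * dc (?zs ! i) (?zs ! j)" using d0 P by simp
    \<comment> \<open>The segment lies in the prefix, straddles its end, or lies in
      \<open>xs\<close>. When straddling, replacing the start by \<open>Elt k\<close> changes both
      length and distance by at most 1.\<close>
    consider "j \<le> 1" | "i \<le> 1" "2 \<le> j" | "2 \<le> i" by linarith
    then show "path_length con ?zs i j \<le> (P + 1) * (dc (?zs ! i) (?zs ! j) + (P + 1))"
    proof cases
      case 1
      have "path_length con ?zs i 2 = path_length con ?zs i j + path_length con ?zs j 2"
        using 1 ij by (intro path_length_split) auto
      moreover have "0 \<le> path_length con ?zs j 2"
        using path_length_ge[OF half_graph_con epz, of j 2] 1 ne by (cases xs) auto
      ultimately have "path_length con ?zs i j \<le> 1" using pl1[of i] 1 ij by linarith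
      also have "1 \<le> (P + 1) * (dc (?zs ! i) (?zs ! j) + (P + 1))"
        using d0 P mult_mono[of 1 "P + 1" 1 "dc (?zs ! i) (?zs ! j) + (P + 1)"] by simp
      finally show ?thesis .
    next
      case 2
      then obtain j' where j': "j = Suc (Suc j')" "j' < length xs" using ij by (cases j; cases "j - 1") auto
      have "path_length con ?zs i j = path_length con ?zs i 2 + path_length con ?zs 2 j"
        using 2 by (intro path_length_split) auto
      also have "path_length con ?zs 2 j = path_length con xs 0 j'"
        unfolding j' numeral_2_eq_2 by (simp only: path_length_Cons)
      also have "\<dots> \<le> P * (dc (xs ! 0) (xs ! j') + P)" using quasigeodesicD[OF qg P] j' by simp
      finally have 3: "path_length con ?zs i j \<le> 1 + P * (dc (xs ! 0) (xs ! j') + P)" using pl1[OF 2(1)] by linarith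
      have "dc (Elt k) (?zs ! j) \<le> dc (Elt k) (?zs ! i) + dc (?zs ! i) (?zs ! j)"
        using ij mem hk H_carrier by (intro dc_tri) auto
      then have "dc (xs ! 0) (xs ! j') \<le> 1 + dc (?zs ! i) (?zs ! j)"
        using le1[of i] 2 dc_sym[of "Elt k"] xs0 j' by simp
      then have "P * (dc (xs ! 0) (xs ! j') + P) \<le> P * (1 + dc (?zs ! i) (?zs ! j) + P)"
        using P by (intro mult_left_mono) auto
      then show ?thesis using 3 d0 P by (simp add: algebra_simps)
    next
      case 3
      then obtain i' j' where i': "i = Suc (Suc i')" and j': "j = Suc (Suc j')" "i' \<le> j'" "j' < length xs"
        using ij by (cases i; cases "i - 1"; cases j; cases "j - 1") auto
      have "path_length con ?zs i j = path_length con xs i' j'"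
        unfolding i' j' by (simp only: path_length_Cons)
      also have "\<dots> \<le> P * (dc (xs ! i') (xs ! j') + P)" using quasigeodesicD[OF qg P] j' by simp
      also have "\<dots> \<le> (P + 1) * (dc (?zs ! i) (?zs ! j) + (P + 1))"
        using P d0 unfolding i' j' by (intro mult_mono) auto
      finally show ?thesis .
    qed
  qed (use P in simp)
  moreover have "without_backtracking G H ?zs"
    unfolding without_backtracking_def
  proof (intro ballI allI impI)
    fix C i j l assume C: "C \<in> lcosets H"
      and *: "i \<le> j \<and> j \<le> l \<and> l < length ?zs \<and> in_coset C (?zs ! i) \<and> in_coset C (?zs ! l)"
    show "in_coset C (?zs ! j)"
    proof (cases "C = H")
      case True
      have "l \<le> 2"
      proof (rule ccontr)
        assume "\<not> l \<le> 2"
        then obtain l' where "l = Suc (Suc l')" "0 < l'" by (cases l; cases "l - 1") auto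
        then show False using only[of l'] * True by simp
      qed
      then have "j = 0 \<or> j = 1 \<or> j = 2" using * by linarith
      then show ?thesis using True hk xs0 by (auto simp: numeral_2_eq_2)
    next
      case False
      \<comment> \<open>A coset other than \<open>H\<close> meets neither vertex of the prefix, so
        the claim is inherited from \<open>xs\<close>.\<close>
      have "h \<notin> C" using False lcosetD(2)[OF C] lcosetD(2)[OF H_lcoset hk(1)] by blast
      then have "2 \<le> i" using * False by (cases i; cases "i - 1") auto
      with * obtain i' j' l' where "i = 2 + i'" "j = 2 + j'" "l = 2 + l'"
        by (metis le_Suc_ex order_trans)
      moreover note nb[unfolded without_backtracking_def, rule_format, OF C, of i' j' l']
      ultimately show ?thesis using * by simp
    qed
  qed
  ultimately show ?thesis unfolding electric_path_between_def using ends ne by simp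
qed

text \<open>Going from \<open>h\<close> through the cone vertex of \<open>H\<close> to \<open>k\<close> and then along \<open>xs\<close> gives a path that
  penetrates \<open>H\<close> and exits at \<open>k\<close>. If \<open>ys\<close> does not penetrate \<open>H\<close>, then \<open>z = h\<close>.\<close>

lemma compare_exits:
  assumes bcp: "bounded_coset_penetration G H S" and P: "1 \<le> P"
  obtains D where "\<And>k h y xs ys. electric_path_between G H S P k y xs \<Longrightarrow>
      (\<And>j. 0 < j \<Longrightarrow> j < length xs \<Longrightarrow> \<not> in_coset H (xs ! j)) \<Longrightarrow>
      electric_path_between G H S P h y ys \<Longrightarrow> k \<in> H \<Longrightarrow> h \<in> H \<Longrightarrow>
      \<exists>z\<in>H. Elt z \<in> set ys \<and> walk_le cay k z D"
proof -
  obtain D where D: "\<And>x y \<alpha> \<beta>. x \<in> carrier G \<Longrightarrow> y \<in> carrier G \<Longrightarrow>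
      electric_path_between G H S (P + 1) x y \<alpha> \<Longrightarrow> electric_path_between G H S (P + 1) x y \<beta> \<Longrightarrow>
      (penetrates \<alpha> H \<and> \<not> penetrates \<beta> H \<longrightarrow>
              vertex_dist cay (entry_vertex H \<alpha>) (exit_vertex H \<alpha>) \<le> D) \<and>
           (penetrates \<alpha> H \<and> penetrates \<beta> H \<longrightarrow>
              vertex_dist cay (exit_vertex H \<alpha>) (exit_vertex H \<beta>) \<le> D)"
  proof -
    have "1 \<le> P + 1" using P by simp
    with bcp show ?thesis using that H_lcoset unfolding bounded_coset_penetration_def by meson
  qed
  have "\<exists>z\<in>H. Elt z \<in> set ys \<and> walk_le cay k z D"
    if xs: "electric_path_between G H S P k y xs"
      and only: "\<And>j. 0 < j \<Longrightarrow> j < length xs \<Longrightarrow> \<not> in_coset H (xs ! j)"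
      and ys: "electric_path_between G H S P h y ys" and hk: "k \<in> H" "h \<in> H" for k h y xs ys
  proof -
    let ?zs = "Elt h # Cone H # xs"
    have zs: "electric_path_between G H S (P + 1) h y ?zs"
      by (rule electric_path_prefix[OF xs P only hk(2,1)])
    have ys': "electric_path_between G H S (P + 1) h y ys"
      by (rule electric_path_mono[OF ys P]) simp
    have xne: "xs \<noteq> []" "hd xs = Elt k" using xs
      unfolding electric_path_between_def quasigeodesic_def edge_path_def by auto
    then obtain us where us: "xs = Elt k # us" by (cases xs) auto
    \<comment> \<open>After its start \<open>xs\<close> avoids \<open>H\<close>, so \<open>h\<close>
      and \<open>k\<close> are exactly the entry and exit vertices of the extended path.\<close>
    have "set (coset_elements H us) = {}"
    proof -
      have "\<not> in_coset H u" if "u \<in> set us" for u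
      proof -
        obtain i where "i < length us" "u = us ! i" using \<open>u \<in> set us\<close> by (auto simp: in_set_conv_nth)
        then show ?thesis using only[of "Suc i"] us by simp
      qed
      then show ?thesis unfolding set_coset_elements by fastforce
    qed
    moreover have "coset_elements H ?zs = h # k # coset_elements H us"
      using hk us unfolding coset_elements_def by simp
    ultimately have "coset_elements H ?zs = [h, k]" by simp
    then have zH: "entry_vertex H ?zs = h" "exit_vertex H ?zs = k" "penetrates ?zs H"
      unfolding entry_vertex_def exit_vertex_def penetrates_def by simp_all
    have yne: "ys \<noteq> []" "hd ys = Elt h" "last ys = Elt y" "set ys \<subseteq> verts con" using ys
      unfolding electric_path_between_def quasigeodesic_def edge_path_def by auto
    then have hys: "Elt h \<in> set ys" "Elt y \<in> set ys" using hd_in_set[OF yne(1)] last_in_set[OF yne(1)] by simp_all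
    then have y: "y \<in> carrier G" using yne(4) by auto
    note DD = D[OF H_carrier[OF hk(2)] y zs ys', unfolded zH]
    show ?thesis
    proof (cases "penetrates ys H")
      case False
      then have "vertex_dist cay h k \<le> D" using DD zH(3) by blast
      then have "walk_le cay h k D"
        using walk_le_iff[OF half_graph_cay connected_graph_cay, of h k] hk H_carrier by simp
      then show ?thesis using walk_le_cay_sym hk(2) hys by blast
    next
      case True
      then have le: "vertex_dist cay k (exit_vertex H ys) \<le> D" using DD zH(3) by blast
      \<comment> \<open>The list is nonempty because \<open>ys\<close> starts in \<open>H\<close>;
        only then is its last entry an element of \<open>H\<close> on \<open>ys\<close>.\<close>
      have "h \<in> set (coset_elements H ys)" unfolding set_coset_elements using hk hys by blast
      then have "exit_vertex H ys \<in> set (coset_elements H ys)"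
        unfolding exit_vertex_def by (intro last_in_set) auto
      then have z: "exit_vertex H ys \<in> H" "Elt (exit_vertex H ys) \<in> set ys" unfolding set_coset_elements by auto
      then have "walk_le cay k (exit_vertex H ys) D"
        using walk_le_iff[OF half_graph_cay connected_graph_cay, of k "exit_vertex H ys"] hk H_carrier le by simp
      then show ?thesis using z by blast
    qed
  qed
  then show ?thesis using that by blast
qed

end

section \<open>Nearest points of the cusp subgroup and their behaviour under automorphisms\<close>

context coned_group
begin

text \<open>Stands for the exit point of electric geodesics from \<open>H\<close> to
  \<open>x\<close>. Elements of \<open>H\<close> have electric distance at most 1 from each other,
  so control of \<open>k\<close> in the word metric has to come from bounded coset
  penetration.\<close>

definition nearest :: "'a \<Rightarrow> 'a \<Rightarrow> bool" where
  "nearest k x \<longleftrightarrow> k \<in> H \<and> (\<forall>h\<in>H. dc (Elt k) (Elt x) \<le> dc (Elt h) (Elt x))"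

lemma geodesic_path_segment:
  assumes xs: "geodesic_path con xs" "hd xs = Elt k" "last xs = Elt x" and j: "j < length xs"
  shows "dc (Elt k) (Elt x) = path_length con xs 0 j + dc (xs ! j) (Elt x)"
    and "path_length con xs 0 j = dc (Elt k) (xs ! j)"
proof -
  have ne: "xs \<noteq> []" using j by auto
  have e: "xs ! 0 = Elt k" "xs ! (length xs - 1) = Elt x" using xs ne by (simp_all add: hd_conv_nth last_conv_nth)
  note geo = xs(1)[unfolded geodesic_path_def, THEN conjunct2, rule_format]
  have "path_length con xs 0 (length xs - 1) = path_length con xs 0 j + path_length con xs j (length xs - 1)"
    using j by (intro path_length_split) auto
  then show "dc (Elt k) (Elt x) = path_length con xs 0 j + dc (xs ! j) (Elt x)"
    using geo[of 0 "length xs - 1"] geo[of j "length xs - 1"] j e by simp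
  show "path_length con xs 0 j = dc (Elt k) (xs ! j)" using geo[of 0 j] j e by simp
qed

text \<open>A later element of \<open>H\<close> on the geodesic would be closer to \<open>x\<close>
  than \<open>k\<close>. This supplies the hypothesis of \<open>compare_exits\<close> that the path
  leaves \<open>H\<close> at once.\<close>

lemma nearest_meets_once:
  assumes xs: "geodesic_path con xs" "hd xs = Elt k" "last xs = Elt x" and near: "nearest k x"
    and j: "0 < j" "j < length xs"
  shows "\<not> in_coset H (xs ! j)"
proof -
  have ep: "edge_path con xs" using xs unfolding geodesic_path_def by blast
  have *: "xs ! l \<noteq> Elt h" if "0 < l" "l < length xs" "h \<in> H" for l h
  proof
    assume h: "xs ! l = Elt h"
    have "real (l - 0) / 2 \<le> path_length con xs 0 l"
      using that by (intro path_length_ge[OF half_graph_con ep]) auto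
    moreover have "0 < real (l - 0) / 2" using that(1) by simp
    ultimately have "0 < path_length con xs 0 l" by linarith
    moreover have "dc (Elt k) (Elt x) \<le> dc (Elt h) (Elt x)" using near that(3) unfolding nearest_def by blast
    ultimately show False using geodesic_path_segment(1)[OF xs that(2)] h by simp
  qed
  show ?thesis
  proof (cases "xs ! j")
    case (Elt h)
    then show ?thesis using *[OF j] by auto
  next
    case (Cone C)
    have ne: "xs \<noteq> []" using j by auto
    have "C \<noteq> H"
    proof
      assume C: "C = H"
      have "xs ! (length xs - 1) = Elt x" using xs ne by (simp add: last_conv_nth)
      \<comment> \<open>The path ends at an element, so \<open>Cone H\<close> has a successor, which
        must be an element of \<open>H\<close>.\<close>
      then have "j \<noteq> length xs - 1" using Cone by auto
      then have j': "Suc j < length xs" using j by simp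
      have "adj con (xs ! j) (xs ! Suc j)" by (rule edge_path_nth(2)[OF ep j'])
      then obtain h where "xs ! Suc j = Elt h" "h \<in> H" using Cone C by (cases "xs ! Suc j") auto
      then show False using *[OF _ j'] by blast
    qed
    then show ?thesis using Cone by simp
  qed
qed

text \<open>An element of \<open>H\<close> closer to \<open>x\<close> would, by going through
  \<open>x\<close>, also be closer to \<open>y\<close>.\<close>

lemma nearest_on_geodesic:
  assumes xs: "geodesic_path con xs" "hd xs = Elt k" "last xs = Elt y" and near: "nearest k y"
    and x: "Elt x \<in> set xs"
  shows "nearest k x"
proof -
  have ep: "edge_path con xs" using xs unfolding geodesic_path_def by blast
  then have sub: "set xs \<subseteq> verts con" and ne: "xs \<noteq> []" unfolding edge_path_def by auto
  then have y: "y \<in> carrier G" and xc: "x \<in> carrier G" using xs(3) last_in_set[OF ne] x by auto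
  obtain j where j: "j < length xs" "xs ! j = Elt x" using x by (auto simp: in_set_conv_nth)
  show ?thesis unfolding nearest_def
  proof (intro conjI ballI)
    show "k \<in> H" using near unfolding nearest_def by blast
    fix h assume h: "h \<in> H"
    have "dc (Elt k) (Elt y) = dc (Elt k) (Elt x) + dc (Elt x) (Elt y)"
      using geodesic_path_segment[OF xs j(1)] j(2) by simp
    moreover have "dc (Elt k) (Elt y) \<le> dc (Elt h) (Elt y)" using near h unfolding nearest_def by blast
    moreover have "dc (Elt h) (Elt y) \<le> dc (Elt h) (Elt x) + dc (Elt x) (Elt y)"
      using h H_carrier xc y by (intro dc_tri) auto
    ultimately show "dc (Elt k) (Elt x) \<le> dc (Elt h) (Elt x)" by linarith
  qed
qed

lemma geodesic_electric:
  assumes "geodesic_path con xs" "hd xs = Elt k" "last xs = Elt x"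
  shows "electric_path_between G H S 1 k x xs"
proof -
  have ep: "edge_path con xs" using assms unfolding geodesic_path_def by blast
  have "quasigeodesic con 1 xs"
  proof (rule quasigeodesicI[OF ep])
    fix i j assume "i \<le> j" "j < length xs"
    then have "path_length con xs i j = dc (xs ! i) (xs ! j)" using assms(1) unfolding geodesic_path_def by blast
    then show "path_length con xs i j \<le> 1 * (dc (xs ! i) (xs ! j) + 1)" by simp
  qed simp
  moreover have "without_backtracking G H xs"
    using geodesic_without_backtracking[OF coset_closed_verts, of xs] assms(1) by simp
  ultimately show ?thesis unfolding electric_path_between_def using assms by blast
qed

lemma geodesic_from_Elt:
  assumes "k \<in> carrier G" "x \<in> carrier G"
  obtains xs where "geodesic_path con xs" "hd xs = Elt k" "last xs = Elt x"
  using geodesic_between[OF half_graph_con connected_graph_con, of "Elt k" "Elt x"] assms by auto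

text \<open>Adding the cone vertex of every coset that meets \<open>E\<close> is the simplest way to
  make \<open>E\<close> coset-closed.\<close>

definition coset_nbhd :: "'a set \<Rightarrow> 'a coned set" where
  "coset_nbhd E = Elt ` E \<union> (\<lambda>e. Cone (e <# H)) ` E"

lemma coset_closed_nbhd:
  assumes "E \<subseteq> carrier G"
  shows "coset_closed (coset_nbhd E)"
  unfolding coset_closed_def
proof (intro conjI ballI impI)
  have "Cone (e <# H) \<in> verts con" if "e \<in> E" for e using lcosetI(1)[of e] that assms by auto
  then show "coset_nbhd E \<subseteq> verts con" unfolding coset_nbhd_def using assms by auto
  fix C a b assume "C \<in> lcosets H" "a \<in> coset_nbhd E" "in_coset C a \<and> in_coset C b \<and> a \<noteq> b"
  then obtain e where "e \<in> E" "e \<in> C \<or> Cone (e <# H) = Cone C" unfolding coset_nbhd_def by auto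
  then have "e \<in> E" "C = e <# H" using lcosetD(2)[OF \<open>C \<in> lcosets H\<close>, of e] by auto
  then show "Cone C \<in> coset_nbhd E" unfolding coset_nbhd_def by blast
qed

text \<open>Compares a geodesic from \<open>k\<close> to \<open>x\<close> with a path from
  \<open>z\<close> to \<open>x\<close> inside the word ball of radius \<open>L\<close> around
  \<open>z\<close>: by \<open>compare_exits\<close>, \<open>k\<close> is close to an element on the
  second path, and all those elements are within \<open>L\<close> of \<open>z\<close>.\<close>

lemma nearest_bounded:
  assumes bcp: "bounded_coset_penetration G H S" and L: "0 \<le> L"
  obtains C where "\<And>k x z. nearest k x \<Longrightarrow> x \<in> carrier G \<Longrightarrow> z \<in> H \<Longrightarrow> walk_le cay z x L \<Longrightarrow> walk_le cay k z C"
proof -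
  \<comment> \<open>Any two vertices of the thickened ball are joined through \<open>z\<close>, at
    cost \<open>L + 1 / 2\<close> each; the halves account for cone vertices.\<close>
  define P where "P = 2 * L + 1"
  have P: "1 \<le> P" unfolding P_def using L by simp
  obtain D where D: "\<And>k h y xs ys. electric_path_between G H S P k y xs \<Longrightarrow>
      (\<And>j. 0 < j \<Longrightarrow> j < length xs \<Longrightarrow> \<not> in_coset H (xs ! j)) \<Longrightarrow>
      electric_path_between G H S P h y ys \<Longrightarrow> k \<in> H \<Longrightarrow> h \<in> H \<Longrightarrow>
      \<exists>z\<in>H. Elt z \<in> set ys \<and> walk_le cay k z D"
    using compare_exits[OF bcp P] by metis
  have "walk_le cay k z (D + L)"
    if near: "nearest k x" and x: "x \<in> carrier G" and z: "z \<in> H" "walk_le cay z x L" for k x z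
  proof -
    have kH: "k \<in> H" using near unfolding nearest_def by blast
    define E where "E = {e \<in> verts cay. walk_le cay z e L}"
    let ?V = "coset_nbhd E"
    have EG: "E \<subseteq> carrier G" unfolding E_def by auto
    have closed: "coset_closed ?V" by (rule coset_closed_nbhd[OF EG])
    have Vsub: "?V \<subseteq> verts con" using closed unfolding coset_closed_def by blast
    have zE: "z \<in> E" unfolding E_def using z(1) H_carrier L walk_le_refl[of z cay L] by simp
    have xE: "x \<in> E" unfolding E_def using z(2) x by simp
    have from_z: "walk_le (con\<lparr>verts := ?V\<rparr>) (Elt z) a (L + 1 / 2)" if a: "a \<in> ?V" for a
    proof -
      obtain e where e: "e \<in> E" "a = Elt e \<or> a = Cone (e <# H)" using a unfolding coset_nbhd_def by blast
      have "walk_le (cay\<lparr>verts := E\<rparr>) z e L"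
        unfolding E_def by (rule walk_le_ball[OF half_graph_cay]) (use e in \<open>simp add: E_def\<close>)
      then have ze: "walk_le (con\<lparr>verts := ?V\<rparr>) (Elt z) (Elt e) L"
        by (rule walk_le_Elt) (simp add: coset_nbhd_def)
      have "walk_le (con\<lparr>verts := ?V\<rparr>) (Elt e) a (1 / 2)"
        using e EG lcosetI[of e] walk_le_refl[of "Elt e" "con\<lparr>verts := ?V\<rparr>" "1 / 2"]
          walk_le_Cone(1)[of "e <# H" e ?V] unfolding coset_nbhd_def by auto
      with ze show ?thesis by (rule walk_le_trans)
    qed
    obtain ys where ys: "electric_path_between G H S P z x ys" "set ys \<subseteq> ?V"
    proof (rule electric_path_exists[OF closed P, of z x])
      show "Elt z \<in> ?V" "Elt x \<in> ?V" using zE xE unfolding coset_nbhd_def by auto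
      fix a b assume ab: "a \<in> ?V" "b \<in> ?V"
      have "walk_le (con\<lparr>verts := ?V\<rparr>) a b ((L + 1 / 2) + (L + 1 / 2))"
        using walk_le_trans[OF walk_le_sym[OF half_graph_sub[OF Vsub] from_z[OF ab(1)]] from_z[OF ab(2)]] .
      moreover have "0 \<le> dc a b" using ab Vsub by (intro dc_nonneg) auto
      then have "P * 1 \<le> P * (dc a b + P)" using P by (intro mult_left_mono) auto
      then have "(L + 1 / 2) + (L + 1 / 2) \<le> P * (dc a b + P)" unfolding P_def by simp
      ultimately show "walk_le (con\<lparr>verts := ?V\<rparr>) a b (P * (dc a b + P))" by (rule walk_le_mono)
    qed blast
    obtain xs where xs: "geodesic_path con xs" "hd xs = Elt k" "last xs = Elt x"
      by (rule geodesic_from_Elt[OF H_carrier[OF kH] x])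
    have exs: "electric_path_between G H S P k x xs"
      by (rule electric_path_mono[OF geodesic_electric[OF xs] order_refl P])
    obtain z' where z': "z' \<in> H" "Elt z' \<in> set ys" "walk_le cay k z' D"
      using D[OF exs nearest_meets_once[OF xs near] ys(1) kH z(1)] by blast
    have "z' \<in> E" using z'(2) ys(2) unfolding coset_nbhd_def by auto
    then have "walk_le cay z' z L" unfolding E_def using walk_le_cay_sym by simp
    with z'(3) show ?thesis by (rule walk_le_trans)
  qed
  then show ?thesis using that by blast
qed

lemma hom_l_coset:
  assumes f: "f \<in> hom G G" "f ` H = H" and x: "x \<in> carrier G"
  shows "f ` (x <# H) = f x <# H"
proof -
  have "f ` (x <# H) = (\<lambda>h. f x \<otimes> f h) ` H"
    unfolding l_coset_def image_UN
    using hom_mult[OF f(1) x H_carrier] by auto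
  also have "\<dots> = f x <# (f ` H)" unfolding l_coset_def by auto
  finally show ?thesis using f(2) by simp
qed

lemma hom_lcosets:
  assumes f: "f \<in> hom G G" "f ` H = H" and C: "C \<in> lcosets H"
  shows "f ` C \<in> lcosets H"
proof -
  obtain x where x: "x \<in> carrier G" "C = x <# H" using C by (auto simp: LCOSETS_def)
  then show ?thesis using hom_l_coset[OF f x(1)] lcosetI(1)[of "f x"] hom_in_carrier[OF f(1) x(1)] by simp
qed

text \<open>The image under \<open>f\<close> of an electric geodesic, with its edges replaced by words, may backtrack. It is
  therefore thickened to a coset-closed set \<open>V\<close>, and replaced by a geodesic of \<open>V\<close>.\<close>

lemma exits_under_automorphism:
  assumes bcp: "bounded_coset_penetration G H S"
    and f: "f \<in> hom G G" "f ` H = H" and g: "g \<in> hom G G"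
    and inv: "\<And>x. x \<in> carrier G \<Longrightarrow> g (f x) = x" "\<And>x. x \<in> carrier G \<Longrightarrow> f (g x) = x"
  obtains R where "\<And>B k y k' y'. B \<in> lcosets H \<Longrightarrow> B \<noteq> H \<Longrightarrow> y \<in> B \<Longrightarrow> nearest k y \<Longrightarrow>
    y' \<in> f ` B \<Longrightarrow> nearest k' y' \<Longrightarrow> walk_le cay (f k) k' R"
proof -
  have gen_grp: "generated_group G S" by unfold_locales
  have fc: "f x \<in> carrier G" "g x \<in> carrier G" if "x \<in> carrier G" for x
    using f(1) g that by (simp_all add: hom_in_carrier)
  have gf: "g ` (f ` A) = A" if "A \<subseteq> carrier G" for A
  proof -
    have "g ` (f ` A) = (\<lambda>x. g (f x)) ` A" by (simp add: image_image)
    also have "\<dots> = (\<lambda>x. x) ` A" by (rule image_cong) (use inv(1) that in auto)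
    finally show ?thesis by simp
  qed
  have gH: "g ` H = H" using gf[of H] f(2) H subgroup.subset by metis
  obtain L1 where L1: "1 \<le> L1" "\<And>x y r. walk_le cay x y r \<Longrightarrow> walk_le cay (f x) (f y) (L1 * r)"
    using hom_lipschitz[OF gen_grp f(1)] by metis
  obtain L2 where L2: "1 \<le> L2" "\<And>x y r. walk_le cay x y r \<Longrightarrow> walk_le cay (g x) (g y) (L2 * r)"
    using hom_lipschitz[OF gen_grp g] by metis
  \<comment> \<open>\<open>K\<close> bounds lengths along the image path by electric distances, and
    \<open>c\<close> bounds the distance in \<open>V\<close> from any vertex to that path.
    \<open>P\<close> absorbs the route from a vertex to the image path, along it, and off again:
    \<open>c + K * (d + 2 * c) + c \<le> P * (d + P)\<close>.\<close>
  define K where "K = L1 * L2"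
  define c where "c = L1 + 1"
  define P where "P = K * (2 * c + 1) + 2 * c"
  have K: "1 \<le> K" unfolding K_def using L1 L2 mult_mono[of 1 L1 1 L2] by simp
  have P: "1 \<le> P" unfolding P_def c_def using K L1 mult_mono[of 1 K 1 "2 * (L1 + 1) + 1"] by simp
  obtain D where D: "\<And>k h y xs ys. electric_path_between G H S P k y xs \<Longrightarrow>
      (\<And>j. 0 < j \<Longrightarrow> j < length xs \<Longrightarrow> \<not> in_coset H (xs ! j)) \<Longrightarrow>
      electric_path_between G H S P h y ys \<Longrightarrow> k \<in> H \<Longrightarrow> h \<in> H \<Longrightarrow>
      \<exists>z\<in>H. Elt z \<in> set ys \<and> walk_le cay k z D"
    using compare_exits[OF bcp P] by metis
  have "0 \<le> L2 * L1" using L1 L2 by simp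
  \<comment> \<open>An element within \<open>L1\<close> of \<open>f x\<close> is sent by
    \<open>g\<close> to within \<open>L2 * L1\<close> of \<open>x\<close>.\<close>
  from bcp this obtain C where C: "\<And>k x z. nearest k x \<Longrightarrow> x \<in> carrier G \<Longrightarrow> z \<in> H \<Longrightarrow> walk_le cay z x (L2 * L1) \<Longrightarrow> walk_le cay k z C"
    using nearest_bounded by metis
  have main: "walk_le cay (f k) k' (L1 * C + D)"
    if B: "B \<in> lcosets H" "B \<noteq> H" and y: "y \<in> B" and near: "nearest k y"
      and y': "y' \<in> f ` B" and near': "nearest k' y'" for B k y k' y'
  proof -
    have kH: "k \<in> H" "k' \<in> H" using near near' unfolding nearest_def by blast+
    have fkH: "f k \<in> H" using f(2) kH by blast
    have fB: "f ` B \<in> lcosets H" by (rule hom_lcosets[OF f B(1)])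
    have fBH: "f ` B \<noteq> H"
    proof
      assume "f ` B = H"
      then have "g ` (f ` B) = H" using gH by simp
      moreover have "B \<subseteq> carrier G" using B(1) lcosetD by blast
      ultimately show False using gf B(2) by simp
    qed
    have yc: "y \<in> carrier G" "y' \<in> carrier G" using lcosetD B y fB y' by blast+
    have y'H: "y' \<notin> H" using lcosetD(2)[OF fB y'] lcosetD(2)[OF H_lcoset] fBH by blast
    obtain al where al: "geodesic_path con al" "hd al = Elt k" "last al = Elt y"
      by (rule geodesic_from_Elt[OF H_carrier[OF kH(1)] yc(1)])
    have ep: "edge_path con al" using al(1) unfolding geodesic_path_def by blast
    then have alsub: "set al \<subseteq> verts con" and alne: "al \<noteq> []" unfolding edge_path_def by auto
    have inal: "Elt k \<in> set al" "Elt y \<in> set al" using hd_in_set[OF alne] last_in_set[OF alne] al by auto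
    have alc: "x \<in> carrier G" if "Elt x \<in> set al" for x using alsub that by auto
    \<comment> \<open>\<open>f\<close> stretches an edge to word distance at most \<open>L1\<close>,
      so the ball around the image of one end contains a walk to the image of the other.\<close>
    define ball where "ball x = {e \<in> verts cay. walk_le cay (f x) e L1}" for x
    define E where "E = (\<Union>x\<in>{x. Elt x \<in> set al}. ball x) \<union> {y'}"
    define V where "V = coset_nbhd E \<union> coned_map f ` set al"
    have EG: "E \<subseteq> carrier G" unfolding E_def ball_def using yc by auto
    have fE: "f x \<in> E" if "Elt x \<in> set al" for x
      
    proof -
      have "f x \<in> ball x" using fc(1)[OF alc[OF that]] walk_le_refl[of "f x" cay L1] L1(1) unfolding ball_def by simp
      then show ?thesis using that unfolding E_def by blast
    qed
    have Vsub: "V \<subseteq> verts con"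
    proof -
      have "coned_map f u \<in> verts con" if "u \<in> verts con" for u
        using that fc(1) hom_lcosets[OF f] by (cases u) auto
      then show ?thesis
        using coset_closed_nbhd[OF EG] alsub unfolding coset_closed_def V_def by blast
    qed
    have EltV: "e \<in> E" if "Elt e \<in> V" for e
    proof -
      from that consider "e \<in> E" | u where "u \<in> set al" "Elt e = coned_map f u"
        unfolding V_def coset_nbhd_def by blast
      then show ?thesis
      proof cases
        case (2 u)
        show ?thesis
        proof (cases u)
          case (Elt x)
          then show ?thesis using fE 2 by auto
        qed (use 2 in simp)
      qed
    qed
    have closed: "coset_closed V"
      unfolding coset_closed_def
    proof (intro conjI ballI impI)
      fix C a b assume C: "C \<in> lcosets H" and a: "a \<in> V" "in_coset C a \<and> in_coset C b \<and> a \<noteq> b"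
      show "Cone C \<in> V"
      proof (cases a)
        case (Cone C')
        then show ?thesis using a by simp
      next
        case (Elt e)
        then have "e \<in> E" using a(1) EltV by blast
        then show ?thesis using lcosetD(2)[OF C, of e] a Elt unfolding V_def coset_nbhd_def by auto
      qed
    qed (rule Vsub)
    let ?Y = "con\<lparr>verts := V\<rparr>"
    note half = half_graph_sub[OF Vsub]
    have in_ball: "walk_le ?Y (Elt (f x)) (Elt e) L1" if x: "Elt x \<in> set al" and e: "walk_le cay (f x) e L1" for x e
    proof -
      have "walk_le (cay\<lparr>verts := ball x\<rparr>) (f x) e L1"
        unfolding ball_def by (rule walk_le_ball[OF half_graph_cay e])
      then show ?thesis
        by (rule walk_le_Elt) (use x in \<open>auto simp: V_def coset_nbhd_def E_def\<close>)
    qed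
    have image: "walk_le ?Y (coned_map f a) (coned_map f b) (K * dc (coned_map f a) (coned_map f b))"
      if ab: "a \<in> set al" "b \<in> set al" for a b
    proof -
      have wlog: "walk_le ?Y (coned_map f (al ! i)) (coned_map f (al ! j)) (K * dc (coned_map f (al ! i)) (coned_map f (al ! j)))"
        if ij: "i \<le> j" "j < length al" for i j
      proof -
        have mem: "al ! i \<in> verts con" "al ! j \<in> verts con" using edge_path_nth(1)[OF ep, of i] edge_path_nth(1)[OF ep, of j] ij by simp_all
        have fmem: "coned_map f (al ! i) \<in> verts con" "coned_map f (al ! j) \<in> verts con"
        proof -
          have "al ! i \<in> set al" "al ! j \<in> set al" using ij by simp_all
          then have "coned_map f (al ! i) \<in> V" "coned_map f (al ! j) \<in> V" unfolding V_def by blast+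
          then show "coned_map f (al ! i) \<in> verts con" "coned_map f (al ! j) \<in> verts con"
            using Vsub by blast+
        qed
        have "edge_path (con\<lparr>verts := set al\<rparr>) al" using ep unfolding edge_path_def by simp
        then have "walk (con\<lparr>verts := set al\<rparr>) (al ! i) (al ! j) (path_length con al i j)"
          using path_imp_walk[of _ al i j] ij by fastforce
        then have "walk_le (con\<lparr>verts := set al\<rparr>) (al ! i) (al ! j) (dc (al ! i) (al ! j))"
          using al(1) ij unfolding geodesic_path_def walk_le_def by auto
        \<comment> \<open>Inside \<open>V\<close> the image of a segment is at most
          \<open>L1\<close> times as long: word edges run in the balls, cone edges go to cone
          edges.\<close>
        then have 1: "walk_le ?Y (coned_map f (al ! i)) (coned_map f (al ! j)) (L1 * dc (al ! i) (al ! j))"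
        proof (rule walk_le_map)
          show "coned_map f a \<in> verts ?Y" if "a \<in> verts (con\<lparr>verts := set al\<rparr>)" for a
            using that unfolding V_def by simp
          have cone: "walk_le ?Y (coned_map f (Elt x)) (coned_map f (Cone C)) (L1 * (1 / 2))"
            "walk_le ?Y (coned_map f (Cone C)) (coned_map f (Elt x)) (L1 * (1 / 2))"
            if "Elt x \<in> set al" "Cone C \<in> set al" "x \<in> C" for x C
          proof -
            have "C \<in> lcosets H" using that(2) alsub by auto
            then have "f ` C \<in> lcosets H" "f x \<in> f ` C" using hom_lcosets[OF f] that by auto
            moreover have "coned_map f (Elt x) \<in> V" "coned_map f (Cone C) \<in> V" unfolding V_def using that by blast+
            ultimately have "walk_le ?Y (coned_map f (Elt x)) (coned_map f (Cone C)) (1 / 2)"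
              "walk_le ?Y (coned_map f (Cone C)) (coned_map f (Elt x)) (1 / 2)"
              using walk_le_Cone[of "f ` C" "f x" V] by simp_all
            then show "walk_le ?Y (coned_map f (Elt x)) (coned_map f (Cone C)) (L1 * (1 / 2))"
              "walk_le ?Y (coned_map f (Cone C)) (coned_map f (Elt x)) (L1 * (1 / 2))"
              using L1(1) by (auto elim!: walk_le_mono)
          qed
          fix a b assume ab: "a \<in> verts (con\<lparr>verts := set al\<rparr>)" "b \<in> verts (con\<lparr>verts := set al\<rparr>)"
            "adj (con\<lparr>verts := set al\<rparr>) a b"
          show "walk_le ?Y (coned_map f a) (coned_map f b) (L1 * elen (con\<lparr>verts := set al\<rparr>) a b)"
          proof (cases "\<exists>x y. a = Elt x \<and> b = Elt y")
            case True
            then obtain x y where xy: "a = Elt x" "b = Elt y" by blast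
            have "walk_le cay x y 1"
              by (rule walk_le_edge) (use xy ab alc in auto)
            then have "walk_le cay (f x) (f y) L1" using L1(2) by fastforce
            then show ?thesis using in_ball[of x "f y"] xy ab by simp
          next
            case False
            then show ?thesis using ab cone by (cases a; cases b) auto
          qed
        qed (use L1 in simp)
        \<comment> \<open>Applying \<open>g\<close> recovers the original vertices, so
          \<open>f\<close> shrinks electric distances by at most the factor
          \<open>L2\<close>.\<close>
        have "walk_le con (coned_map g (coned_map f (al ! i))) (coned_map g (coned_map f (al ! j)))
            (L2 * dc (coned_map f (al ! i)) (coned_map f (al ! j)))"
          by (rule coned_map_lipschitz[OF L2(1) fc(2) hom_lcosets[OF g gH] L2(2) dc_walk_le[OF fmem]])
        moreover have "coned_map g (coned_map f u) = u" if "u \<in> verts con" for u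
          using that inv(1) gf lcosetD(1) by (cases u) (auto simp: image_subset_iff subset_iff)
        ultimately have "dc (al ! i) (al ! j) \<le> L2 * dc (coned_map f (al ! i)) (coned_map f (al ! j))"
          using mem dc_le by simp
        then have "L1 * dc (al ! i) (al ! j) \<le> K * dc (coned_map f (al ! i)) (coned_map f (al ! j))"
          unfolding K_def mult.assoc using L1(1) by (intro mult_left_mono) auto
        with 1 show ?thesis by (rule walk_le_mono)
      qed
      obtain i j where ij: "i < length al" "a = al ! i" "j < length al" "b = al ! j"
        using ab by (auto simp: in_set_conv_nth)
      show ?thesis
      proof (cases "i \<le> j")
        case True
        then show ?thesis using wlog ij by simp
      next
        case False
        then show ?thesis using walk_le_sym[OF half wlog[of j i]] ij dc_sym by simp
      qed
    qed
    \<comment> \<open>A ball element costs \<open>L1\<close>, its cone vertex 1/2 more; the extra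
      endpoint \<open>y'\<close> and its cone vertex are reached from \<open>f y\<close> at cost at
      most 1.\<close>
    have close: "\<exists>u\<in>set al. walk_le ?Y (coned_map f u) a c" if a: "a \<in> V" for a
    proof -
      have Elt_close: "\<exists>u\<in>set al. walk_le ?Y (coned_map f u) (Elt e) (L1 + 1 / 2)" if e: "e \<in> E" "e \<noteq> y'" for e
      proof -
        obtain x where x: "Elt x \<in> set al" "walk_le cay (f x) e L1" using e unfolding E_def ball_def by auto
        then have "walk_le ?Y (coned_map f (Elt x)) (Elt e) (L1 + 1 / 2)"
          using walk_le_mono[OF in_ball[OF x], of "L1 + 1 / 2"] by simp
        then show ?thesis using x(1) by blast
      qed
      have EV: "Elt e \<in> V" "Cone (e <# H) \<in> V" if "e \<in> E" for e using that unfolding V_def coset_nbhd_def by auto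
      have fyV: "Elt (f y) \<in> V" using EV fE inal by blast
      have y'E: "y' \<in> E" unfolding E_def by simp
      have fBy: "f ` B = y' <# H" using lcosetD(2)[OF fB y'] .
      have y1: "walk_le ?Y (coned_map f (Elt y)) (Cone (y' <# H)) (1 / 2)"
        using walk_le_Cone(1)[OF fB imageI[OF y] fyV] EV[OF y'E] fBy by simp
      then have y2: "walk_le ?Y (coned_map f (Elt y)) (Elt y') (1 / 2 + 1 / 2)"
        by (rule walk_le_trans) (use walk_le_Cone(2)[OF fB y'] EV[OF y'E] fBy in simp)
      consider u where "u \<in> set al" "a = coned_map f u" | e where "e \<in> E" "a = Elt e" | e where "e \<in> E" "a = Cone (e <# H)"
        using a unfolding V_def coset_nbhd_def by blast
      then show ?thesis
      proof cases
        case 1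
        then show ?thesis using a walk_le_refl[of a ?Y c] L1(1) unfolding c_def by (intro bexI[of _ u]) auto
      next
        case (2 e)
        show ?thesis
        proof (cases "e = y'")
          case True
          then show ?thesis using walk_le_mono[OF y2, of c] inal 2 L1(1) unfolding c_def by (intro bexI[of _ "Elt y"]) auto
        next
          case False
          then obtain u where "u \<in> set al" "walk_le ?Y (coned_map f u) (Elt e) (L1 + 1 / 2)" using Elt_close 2 by blast
          then show ?thesis using walk_le_mono[of ?Y "coned_map f u" "Elt e" "L1 + 1 / 2" c] 2
            unfolding c_def by (intro bexI[of _ u]) auto
        qed
      next
        case (3 e)
        show ?thesis
        proof (cases "e = y'")
          case True
          then show ?thesis using walk_le_mono[OF y1, of c] inal 3 L1(1) unfolding c_def by (intro bexI[of _ "Elt y"]) auto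
        next
          case False
          then obtain u where u: "u \<in> set al" "walk_le ?Y (coned_map f u) (Elt e) (L1 + 1 / 2)" using Elt_close 3 by blast
          have "e \<in> carrier G" using EG 3 by blast
          then have "walk_le ?Y (Elt e) a (1 / 2)" using walk_le_Cone(1)[OF lcosetI(1) lcosetI(2)] EV 3 by simp
          with u(2) have "walk_le ?Y (coned_map f u) a (L1 + 1 / 2 + 1 / 2)" by (rule walk_le_trans)
          then show ?thesis using u(1) unfolding c_def by (intro bexI[of _ u]) (simp_all add: add.assoc)
        qed
      qed
    qed
    obtain be where be: "electric_path_between G H S P (f k) y' be" "set be \<subseteq> V"
    proof (rule electric_path_exists[OF closed P, of "f k" y'])
      have "f k \<in> E" "y' \<in> E" using fE inal unfolding E_def by blast+
      then show "Elt (f k) \<in> V" "Elt y' \<in> V" unfolding V_def coset_nbhd_def by blast+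
      fix a b assume ab: "a \<in> V" "b \<in> V"
      obtain u where u: "u \<in> set al" "walk_le ?Y (coned_map f u) a c" using close ab by blast
      obtain v where v: "v \<in> set al" "walk_le ?Y (coned_map f v) b c" using close ab by blast
      have mem: "coned_map f u \<in> verts con" "coned_map f v \<in> verts con" "a \<in> verts con" "b \<in> verts con"
      proof -
        have "coned_map f u \<in> V" "coned_map f v \<in> V" using u v unfolding V_def by blast+
        then show "coned_map f u \<in> verts con" "coned_map f v \<in> verts con" "a \<in> verts con" "b \<in> verts con"
          using Vsub ab by blast+
      qed
      have Y_le: "dc p q \<le> r" if "walk_le ?Y p q r" for p q r
        using dc_le[of p q r] walk_le_verts_mono[OF that Vsub] by simp
      have "dc (coned_map f u) (coned_map f v) \<le> dc (coned_map f u) a + dc a (coned_map f v)"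
        "dc a (coned_map f v) \<le> dc a b + dc b (coned_map f v)"
        by (intro dc_tri mem)+
      then have "dc (coned_map f u) (coned_map f v) \<le> dc a b + 2 * c"
        using Y_le[OF u(2)] Y_le[OF v(2)] dc_sym[of b] by simp
      then have "K * dc (coned_map f u) (coned_map f v) \<le> K * (dc a b + 2 * c)"
        using K by (intro mult_left_mono) auto
      have "walk_le ?Y a b (c + K * dc (coned_map f u) (coned_map f v) + c)"
        using walk_le_trans[OF walk_le_trans[OF walk_le_sym[OF half u(2)] image[OF u(1) v(1)]] v(2)] .
      moreover have "c + K * dc (coned_map f u) (coned_map f v) + c \<le> P * (dc a b + P)"
      proof -
        have d0: "0 \<le> dc a b" by (intro dc_nonneg mem)
        have c0: "0 \<le> c" unfolding c_def using L1 by simp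
        have "K \<le> P" unfolding P_def using K c0 by (simp add: algebra_simps)
        then have "K * dc a b \<le> P * dc a b" using d0 by (intro mult_right_mono) auto
        moreover have "P * 1 \<le> P * P" using P by (intro mult_left_mono) auto
        moreover have "K * (2 * c) + 2 * c \<le> P" unfolding P_def using K by (simp add: algebra_simps)
        ultimately show ?thesis
          using \<open>K * dc (coned_map f u) (coned_map f v) \<le> K * (dc a b + 2 * c)\<close> by (simp add: algebra_simps)
      qed
      ultimately show "walk_le ?Y a b (P * (dc a b + P))" by (rule walk_le_mono)
    qed blast
    obtain xs where xs: "geodesic_path con xs" "hd xs = Elt k'" "last xs = Elt y'"
      by (rule geodesic_from_Elt[OF H_carrier[OF kH(2)] yc(2)])
    have exs: "electric_path_between G H S P k' y' xs"
      by (rule electric_path_mono[OF geodesic_electric[OF xs] order_refl P])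
    obtain z where z: "z \<in> H" "Elt z \<in> set be" "walk_le cay k' z D"
      using D[OF exs nearest_meets_once[OF xs near'] be(1) kH(2) fkH] by blast
    \<comment> \<open>Since \<open>z\<close> is in \<open>H\<close> and \<open>y'\<close> is not,
      \<open>z\<close> belongs to a ball around some \<open>f x\<close> with \<open>x\<close> on the
      original geodesic.\<close>
    have "z \<in> E" using z(2) be(2) EltV by blast
    moreover have "z \<noteq> y'" using z(1) y'H by blast
    ultimately obtain x where x: "Elt x \<in> set al" "walk_le cay (f x) z L1" unfolding E_def ball_def by auto
    \<comment> \<open>Pulled back by \<open>g\<close>, the exit becomes an element
      \<open>g z\<close> of \<open>H\<close> close to \<open>x\<close>. As \<open>k\<close> is
      nearest to \<open>x\<close> too, \<open>nearest_bounded\<close> puts \<open>k\<close> close to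
      \<open>g z\<close>, and \<open>f\<close> carries this back to \<open>z\<close>.\<close>
    have "walk_le cay (g (f x)) (g z) (L2 * L1)" by (rule L2(2)[OF x(2)])
    then have "walk_le cay (g z) x (L2 * L1)" using inv(1)[OF alc[OF x(1)]] walk_le_cay_sym by simp
    moreover have "g z \<in> H" using z(1) gH by blast
    ultimately have "walk_le cay k (g z) C"
      using C nearest_on_geodesic[OF al near x(1)] alc[OF x(1)] by blast
    then have "walk_le cay (f k) z (L1 * C)" using L1(2)[of k "g z" C] inv(2)[OF H_carrier[OF z(1)]] by simp
    from walk_le_trans[OF this walk_le_cay_sym[OF z(3)]] show ?thesis .
  qed
  show ?thesis by (rule that) (rule main)
qed

end

section \<open>Quasi-isometric embeddings into hyperbolic spaces\<close>

definition pseudo_metric_on :: "'p set \<Rightarrow> ('p \<Rightarrow> 'p \<Rightarrow> real) \<Rightarrow> bool" where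
  "pseudo_metric_on M d \<longleftrightarrow> (\<forall>x\<in>M. d x x = 0) \<and> (\<forall>x\<in>M. \<forall>y\<in>M. d x y = d y x) \<and>
     (\<forall>x\<in>M. \<forall>y\<in>M. \<forall>z\<in>M. d x z \<le> d x y + d y z)"

text \<open>Discrete geodesic with steps at most 1, because coned-off geodesics mix edges of length
  1/2 and 1. In Cayley graphs the integer parametrisation \<open>unit_chain\<close> is
  available.\<close>

definition geodesic_chain :: "'p set \<Rightarrow> ('p \<Rightarrow> 'p \<Rightarrow> real) \<Rightarrow> (nat \<Rightarrow> 'p) \<Rightarrow> nat \<Rightarrow> bool" where
  "geodesic_chain M d c n \<longleftrightarrow> (\<forall>i\<le>n. c i \<in> M) \<and> (\<forall>i<n. d (c i) (c (Suc i)) \<le> 1) \<and>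
     (\<forall>i j k. i \<le> j \<and> j \<le> k \<and> k \<le> n \<longrightarrow> d (c i) (c k) = d (c i) (c j) + d (c j) (c k))"

definition unit_chain :: "'p set \<Rightarrow> ('p \<Rightarrow> 'p \<Rightarrow> real) \<Rightarrow> (nat \<Rightarrow> 'p) \<Rightarrow> nat \<Rightarrow> bool" where
  "unit_chain M d c n \<longleftrightarrow> (\<forall>i\<le>n. c i \<in> M) \<and> (\<forall>i j. i \<le> j \<and> j \<le> n \<longrightarrow> d (c i) (c j) = real (j - i))"

definition four_point :: "'p set \<Rightarrow> ('p \<Rightarrow> 'p \<Rightarrow> real) \<Rightarrow> real \<Rightarrow> bool" where
  "four_point M d \<delta> \<longleftrightarrow> (\<forall>w\<in>M. \<forall>x\<in>M. \<forall>y\<in>M. \<forall>z\<in>M.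
     gromov_product d w x z \<ge> min (gromov_product d w x y) (gromov_product d w y z) - \<delta>)"

lemma pseudo_metric_nonneg:
  assumes "pseudo_metric_on M d" "x \<in> M" "y \<in> M" shows "0 \<le> d x y"
proof -
  have "d x x \<le> d x y + d y x" "d x x = 0" "d x y = d y x"
    using assms unfolding pseudo_metric_on_def by blast+
  then show ?thesis by linarith
qed

lemma four_pointD:
  "four_point M d \<delta> \<Longrightarrow> w \<in> M \<Longrightarrow> x \<in> M \<Longrightarrow> y \<in> M \<Longrightarrow> z \<in> M \<Longrightarrow>
    min (gromov_product d w x y) (gromov_product d w y z) - \<delta> \<le> gromov_product d w x z"
  unfolding four_point_def by blast

text \<open>Discrete connectedness of an interval covered by two properties, one holding at each
  end: the first index with \<open>Q\<close>, or its predecessor, serves.\<close>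

lemma discrete_crossing:
  fixes n :: nat
  assumes "P 0" "Q n" "\<And>i. i \<le> n \<Longrightarrow> P i \<or> Q i"
  obtains i where "i \<le> n" "P i" "Q i \<or> i < n \<and> Q (Suc i)"
proof -
  define i where "i = (LEAST i. Q i)"
  have i: "Q i" "i \<le> n" unfolding i_def by (fact LeastI[of Q n, OF assms(2)], fact Least_le[of Q n, OF assms(2)])
  show ?thesis
  proof (cases i)
    case 0
    then show ?thesis using that assms(1) i by blast
  next
    case (Suc j)
    then have "\<not> Q j" using not_less_Least[of j Q] unfolding i_def[symmetric] by simp
    then show ?thesis using that[of j] assms(3)[of j] Suc i by auto
  qed
qed

text \<open>With the least admissible \<open>k\<close> the hypothesis bounds \<open>D\<close> by a
  multiple of its own logarithm, and a number so bounded cannot be large.\<close>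

lemma bounded_by_logarithm:
  fixes A B :: real
  assumes "0 \<le> A" "0 \<le> B"
  obtains D0 where "0 \<le> D0"
    "\<And>D. (\<And>k::nat. A * (D + 1) \<le> 2 ^ k \<Longrightarrow> D \<le> B * (k + 1)) \<Longrightarrow> D \<le> D0"
proof -
  have "(\<lambda>k::nat. A * (B * (k + 2) + 1) / 2 ^ k) \<longlonglongrightarrow> 0"
  proof -
    have 1: "(\<lambda>k::nat. of_nat k * (1/2::real) ^ k) \<longlonglongrightarrow> 0"
      by (rule powser_times_n_limit_0) simp
    have 2: "(\<lambda>k::nat. (1/2::real) ^ k) \<longlonglongrightarrow> 0"
      by (rule LIMSEQ_realpow_zero) auto
    have "(\<lambda>k::nat. A * B * (of_nat k * (1/2::real) ^ k) + A * (2 * B + 1) * (1/2::real) ^ k)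
        \<longlonglongrightarrow> A * B * 0 + A * (2 * B + 1) * 0"
      by (intro tendsto_add tendsto_mult tendsto_const 1 2)
    then show ?thesis by (simp add: field_simps power_divide)
  qed
  then have "\<forall>\<^sub>F k::nat in sequentially. A * (B * real (k + 2) + 1) / 2 ^ k < 1"
    by (rule order_tendstoD) simp
  then obtain k0 :: nat where k0: "\<And>k. k0 \<le> k \<Longrightarrow> A * (B * real (k + 2) + 1) / 2 ^ k < 1"
    unfolding eventually_sequentially by blast
  have "D \<le> B * (k0 + 1)"
    if D: "\<And>k::nat. A * (D + 1) \<le> 2 ^ k \<Longrightarrow> D \<le> B * (k + 1)" for D
  proof (rule ccontr)
    assume not: "\<not> D \<le> B * (k0 + 1)"
    have "\<exists>k::nat. A * (D + 1) \<le> 2 ^ k"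
      using real_arch_pow[of 2 "A * (D + 1)"] by (auto intro: less_imp_le)
    then obtain k where k: "A * (D + 1) \<le> 2 ^ k" "\<And>j::nat. j < k \<Longrightarrow> \<not> A * (D + 1) \<le> 2 ^ j"
      using exists_least_iff[of "\<lambda>k::nat. A * (D + 1) \<le> 2 ^ k"] by blast
    have Dk: "D \<le> B * (k + 1)" by (rule D[OF k(1)])
    have "\<not> k \<le> k0"
    proof
      assume "k \<le> k0"
      then have "B * (k + 1) \<le> B * (k0 + 1)" using assms(2) by (intro mult_left_mono) auto
      then show False using Dk not by linarith
    qed
    then obtain j where j: "k = Suc j" "k0 \<le> j" by (cases k) auto
    \<comment> \<open>Minimality of \<open>k\<close> fails the test at \<open>j = k - 1\<close>;
      inserting \<open>D \<le> B * (j + 2)\<close> contradicts the choice of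
      \<open>k0\<close>.\<close>
    have "2 ^ j < A * (D + 1)" using k(2)[of j] j by simp
    moreover have "A * (D + 1) \<le> A * (B * real (j + 2) + 1)"
      using Dk j assms(1) by (intro mult_left_mono) (auto simp: algebra_simps)
    moreover have "A * (B * real (j + 2) + 1) < 2 ^ j" using k0[OF j(2)] by (simp add: divide_less_eq)
    ultimately show False by linarith
  qed
  then show ?thesis using that[of "B * (k0 + 1)"] assms(2) by auto
qed

section \<open>Stability of quasigeodesics under the four-point condition\<close>

context
  fixes M :: "'p set" and d :: "'p \<Rightarrow> 'p \<Rightarrow> real" and \<delta> :: real
  assumes pm: "pseudo_metric_on M d" and fp: "four_point M d \<delta>" and delta: "0 \<le> \<delta>"
begin

lemma d_sym: "x \<in> M \<Longrightarrow> y \<in> M \<Longrightarrow> d x y = d y x"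
  using pm unfolding pseudo_metric_on_def by blast

lemma d_tri: "x \<in> M \<Longrightarrow> y \<in> M \<Longrightarrow> z \<in> M \<Longrightarrow> d x z \<le> d x y + d y z"
  using pm unfolding pseudo_metric_on_def by blast

lemma d_refl: "x \<in> M \<Longrightarrow> d x x = 0"
  using pm unfolding pseudo_metric_on_def by blast

text \<open>Bisection: each halving of the chain costs one four-point inequality, so up to
  \<open>2 ^ k\<close> steps lose only \<open>k * \<delta>\<close>.\<close>

lemma gromov_product_along_path:
  fixes k :: nat
  assumes "w \<in> M" "n \<le> 2 ^ k"
    and "\<And>i. p \<le> i \<Longrightarrow> i \<le> p + n \<Longrightarrow> y i \<in> M \<and> m \<le> d (y i) w"
    and "\<And>i. p \<le> i \<Longrightarrow> i < p + n \<Longrightarrow> m \<le> gromov_product d w (y i) (y (Suc i))"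
  shows "m - k * \<delta> \<le> gromov_product d w (y p) (y (p + n))"
  using assms(2-4)
proof (induction k arbitrary: n p)
  case 0
  then consider "n = 0" | "n = 1" by fastforce
  then show ?case
  proof cases
    case 1
    then show ?thesis using 0(2)[of p] d_refl[of "y p"] by (simp add: gromov_product_def)
  next
    case 2
    then show ?thesis using 0(3)[of p] by simp
  qed
next
  case (Suc k)
  define a b where "a = n div 2" and "b = n - n div 2"
  have n: "n = a + b" "a \<le> 2 ^ k" "b \<le> 2 ^ k" unfolding a_def b_def using Suc.prems(1) by auto
  have "m - k * \<delta> \<le> gromov_product d w (y p) (y (p + a))"
    using Suc.prems n by (intro Suc.IH) auto
  moreover have "m - k * \<delta> \<le> gromov_product d w (y (p + a)) (y (p + a + b))"
    using Suc.prems n by (intro Suc.IH) auto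
  moreover have "min (gromov_product d w (y p) (y (p + a))) (gromov_product d w (y (p + a)) (y (p + a + b))) - \<delta>
      \<le> gromov_product d w (y p) (y (p + a + b))"
    using Suc.prems(2) n assms(1) by (intro four_pointD[OF fp]) auto
  moreover have "p + a + b = p + n" using n by simp
  ultimately have "m - k * \<delta> - \<delta> \<le> gromov_product d w (y p) (y (p + n))" by simp
  then show ?case by (simp add: algebra_simps)
qed

text \<open>Following the geodesic \<open>c\<close> from its end \<open>w = c N\<close> at distance at least \<open>D\<close> from \<open>Y\<close> until
  distance \<open>2D\<close> from \<open>w\<close>, and then jumping to \<open>Y\<close>, one stays outside the \<open>D\<close>-ball around \<open>w\<close>.\<close>

lemma escape_point:
  assumes c: "\<And>i. i \<le> N \<Longrightarrow> c i \<in> M" "\<And>i. i < N \<Longrightarrow> d (c i) (c (Suc i)) \<le> 1"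
    and Y: "Y \<subseteq> M" "c 0 \<in> Y" "\<And>i. i \<le> N \<Longrightarrow> \<exists>z\<in>Y. d (c i) z \<le> D"
    and far: "\<And>z. z \<in> Y \<Longrightarrow> D \<le> d z (c N)" and D: "0 \<le> D"
  shows "\<exists>a\<le>N. \<exists>z\<in>Y. d (c a) z \<le> D \<and> d (c a) (c N) \<le> 2 * D + 1 \<and> D \<le> gromov_product d (c N) (c a) z"
proof (cases "d (c 0) (c N) \<le> 2 * D + 1")
  case True
  then show ?thesis using Y far[OF Y(2)] c(1)[of 0] d_refl[of "c 0"] D
    by (intro exI[of _ 0] conjI bexI[of _ "c 0"]) (auto simp: gromov_product_def)
next
  case False
  \<comment> \<open>The first vertex within \<open>2 * D + 1\<close> of the end is still at distance
    at least \<open>2 * D\<close>, as steps have length at most 1. With \<open>z\<close> within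
    \<open>D\<close> of it and at least \<open>D\<close> from the end, the product is at least
    \<open>(2 * D + D - D) / 2\<close>.\<close>
  define a where "a = (LEAST a. d (c a) (c N) \<le> 2 * D + 1)"
  have "d (c N) (c N) \<le> 2 * D + 1" using d_refl[of "c N"] c D by simp
  then have a: "d (c a) (c N) \<le> 2 * D + 1" "a \<le> N" unfolding a_def
    by (rule LeastI, rule Least_le)
  then obtain b where b: "a = Suc b" using False by (cases a) auto
  then have "2 * D + 1 < d (c b) (c N)"
    using not_less_Least[of b "\<lambda>a. d (c a) (c N) \<le> 2 * D + 1"] unfolding a_def[symmetric] by simp
  moreover have "d (c b) (c N) \<le> d (c b) (c a) + d (c a) (c N)" using a b c by (intro d_tri) auto
  moreover have "d (c b) (c a) \<le> 1" using c(2)[of b] a b by simp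
  ultimately have ge: "2 * D \<le> d (c a) (c N)" by linarith
  obtain z where z: "z \<in> Y" "d (c a) z \<le> D" using Y(3)[OF a(2)] by blast
  then have "D \<le> gromov_product d (c N) (c a) z" using ge far[OF z(1)] by (simp add: gromov_product_def)
  then show ?thesis using a z by blast
qed

text \<open>Let \<open>w\<close> on the geodesic be farthest from the quasigeodesic, at distance
  \<open>D\<close>. A detour along the quasigeodesic joins points of the geodesic on both sides of
  \<open>w\<close>, avoids the \<open>D\<close>-ball around \<open>w\<close>, and has O(D) steps.
  Its ends have Gromov product 0 at \<open>w\<close>, yet bisection makes this product at least
  \<open>D\<close> minus O(log D).\<close>

lemma geodesic_near_quasigeodesic:
  assumes "1 \<le> R"
  obtains D0 where "0 \<le> D0"
    "\<And>c m y n i. geodesic_chain M d c m \<Longrightarrow> c 0 = y 0 \<Longrightarrow> c m = y n \<Longrightarrow>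
       (\<And>j. j \<le> n \<Longrightarrow> y j \<in> M) \<Longrightarrow> (\<And>j. j < n \<Longrightarrow> d (y j) (y (Suc j)) \<le> R) \<Longrightarrow>
       (\<And>j l. j \<le> l \<Longrightarrow> l \<le> n \<Longrightarrow> real (l - j) \<le> R * (d (y j) (y l) + 1)) \<Longrightarrow>
       i \<le> m \<Longrightarrow> \<exists>j\<le>n. d (c i) (y j) \<le> D0"
proof -
  \<comment> \<open>\<open>6 * R * (D + 1)\<close> bounds the number of steps of the detour between
    \<open>z\<close> and \<open>z'\<close>; \<open>R + 2 * \<delta>\<close> absorbs the losses
    \<open>R / 2\<close> and \<open>(k + 2) * \<delta>\<close> found at the end.\<close>
  obtain D0 where D0: "0 \<le> D0"
    "\<And>D. (\<And>k::nat. (6 * R) * (D + 1) \<le> 2 ^ k \<Longrightarrow> D \<le> (R + 2 * \<delta>) * (k + 1)) \<Longrightarrow> D \<le> D0"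
    using bounded_by_logarithm[of "6 * R" "R + 2 * \<delta>"] assms delta by auto
  have "\<exists>j\<le>n. d (c i) (y j) \<le> D0"
    if c: "geodesic_chain M d c m" and ends: "c 0 = y 0" "c m = y n"
      and y: "\<And>j. j \<le> n \<Longrightarrow> y j \<in> M" "\<And>j. j < n \<Longrightarrow> d (y j) (y (Suc j)) \<le> R"
        "\<And>j l. j \<le> l \<Longrightarrow> l \<le> n \<Longrightarrow> real (l - j) \<le> R * (d (y j) (y l) + 1)"
      and i: "i \<le> m" for c :: "nat \<Rightarrow> 'p" and m y n i
  proof -
    define f where "f i = Min ((\<lambda>j. d (c i) (y j)) ` {..n})" for i
    define D where "D = Max (f ` {..m})"
    have f_att: "\<exists>j\<le>n. f i = d (c i) (y j)" for i
    proof -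
      have "f i \<in> (\<lambda>j. d (c i) (y j)) ` {..n}" unfolding f_def by (intro Min_in) auto
      then show ?thesis by auto
    qed
    have f_le: "f i \<le> d (c i) (y j)" if "j \<le> n" for i j
      unfolding f_def using that by (intro Min_le) auto
    have "D \<in> f ` {..m}" unfolding D_def by (intro Max_in) auto
    then obtain i0 where i0: "i0 \<le> m" "D = f i0" by auto
    have fD: "f i \<le> D" if "i \<le> m" for i unfolding D_def using that by (intro Max_ge) auto
    define w where "w = c i0"
    have cM: "\<And>i. i \<le> m \<Longrightarrow> c i \<in> M" and cstep: "\<And>i. i < m \<Longrightarrow> d (c i) (c (Suc i)) \<le> 1"
      and cadd: "\<And>i j k. i \<le> j \<Longrightarrow> j \<le> k \<Longrightarrow> k \<le> m \<Longrightarrow> d (c i) (c k) = d (c i) (c j) + d (c j) (c k)"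
      using c unfolding geodesic_chain_def by blast+
    have wM: "w \<in> M" unfolding w_def using cM i0 by blast
    define Y where "Y = y ` {..n}"
    have YM: "Y \<subseteq> M" unfolding Y_def using y(1) by auto
    have near: "\<exists>z\<in>Y. d (c i) z \<le> D" if "i \<le> m" for i
      using f_att[of i] fD[OF that] unfolding Y_def by auto
    have far: "D \<le> d z w" if "z \<in> Y" for z
    proof -
      have "D \<le> d w z" using that f_le[of _ i0] unfolding Y_def i0 w_def by auto
      then show ?thesis using d_sym wM YM that by auto
    qed
    have D_nonneg: "0 \<le> D"
      using f_att[of i0] pseudo_metric_nonneg[OF pm cM[OF i0(1)]] y(1) i0(2) by auto
    have "\<exists>a\<le>i0. \<exists>z\<in>Y. d (c a) z \<le> D \<and> d (c a) (c i0) \<le> 2 * D + 1 \<and> D \<le> gromov_product d (c i0) (c a) z"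
    proof (rule escape_point[OF _ _ YM])
      show "c 0 \<in> Y" unfolding Y_def ends by simp
    qed (use cM cstep i0 near far D_nonneg in \<open>auto simp: w_def\<close>)
    then obtain a z where a: "a \<le> i0" "z \<in> Y" "d (c a) z \<le> D" "d (c a) w \<le> 2 * D + 1"
      "D \<le> gromov_product d w (c a) z" unfolding w_def by blast
    \<comment> \<open>The same escape on the other side of \<open>w\<close>, along the reversed
      geodesic.\<close>
    define c' where "c' i = c (m - i)" for i
    have c'w: "c' (m - i0) = w" unfolding c'_def w_def using i0 by simp
    have "\<exists>b\<le>m - i0. \<exists>z\<in>Y. d (c' b) z \<le> D \<and> d (c' b) (c' (m - i0)) \<le> 2 * D + 1 \<and>
        D \<le> gromov_product d (c' (m - i0)) (c' b) z"
    proof (rule escape_point[OF _ _ YM])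
      show "c' 0 \<in> Y" unfolding Y_def c'_def by (simp add: ends)
      show "d (c' i) (c' (Suc i)) \<le> 1" if "i < m - i0" for i
      proof -
        have "m - i = Suc (m - Suc i)" using that by simp
        then show ?thesis using cstep[of "m - Suc i"] d_sym[OF cM cM, of "m - i" "m - Suc i"] that
          unfolding c'_def by simp
      qed
    qed (use cM near far D_nonneg c'w in \<open>auto simp: c'_def\<close>)
    then obtain b' z' where b': "b' \<le> m - i0" "z' \<in> Y" "d (c' b') z' \<le> D" "d (c' b') w \<le> 2 * D + 1"
      "D \<le> gromov_product d w (c' b') z'" unfolding c'w by blast
    define b where "b = m - b'"
    have b: "i0 \<le> b" "b \<le> m" "d (c b) z' \<le> D" "d (c b) w \<le> 2 * D + 1" "D \<le> gromov_product d w (c b) z'"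
      using b' i0 unfolding b_def c'_def by auto
    have am: "a \<le> m" using a i0 by simp
    \<comment> \<open>\<open>w\<close> lies on the geodesic between \<open>c a\<close> and
      \<open>c b\<close>.\<close>
    have gp0: "gromov_product d w (c a) (c b) = 0"
      using cadd[of a i0 b] a b d_sym[OF cM cM, of i0 b] i0 unfolding gromov_product_def w_def by simp
    have zM: "z \<in> M" "z' \<in> M" using a b' YM by auto
    have dzz: "d z z' \<le> 6 * D + 2"
    proof -
      \<comment> \<open>Two jumps of length at most \<open>D\<close> and two geodesic pieces of
        length at most \<open>2 * D + 1\<close>.\<close>
      have "d z z' \<le> d z (c a) + d (c a) z'" by (intro d_tri zM cM am)
      also have "d (c a) z' \<le> d (c a) w + d w z'" by (intro d_tri zM cM am wM)
      also have "d w z' \<le> d w (c b) + d (c b) z'" by (intro d_tri zM cM b wM)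
      finally show ?thesis using a b d_sym[OF zM(1) cM[OF am]] d_sym[OF wM cM[OF b(2)]] by linarith
    qed
    obtain j l where jl: "j \<le> n" "l \<le> n" "z = y j" "z' = y l" using a b' unfolding Y_def by auto
    have "D \<le> D0"
    proof (rule D0(2))
      fix k :: nat assume k: "6 * R * (D + 1) \<le> 2 ^ k"
      \<comment> \<open>Consecutive vertices are at least \<open>D\<close> from \<open>w\<close> and
        at most \<open>R\<close> apart, so their product at \<open>w\<close> is at least
        \<open>D - R / 2\<close>.\<close>
      have path: "D - R / 2 - k * \<delta> \<le> gromov_product d w (y p) (y q)"
        if pq: "p \<le> q" "q \<le> n" "d (y p) (y q) \<le> 6 * D + 2" for p q
      proof -
        have "real (q - p) \<le> R * (d (y p) (y q) + 1)" using y(3) pq by blast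
        also have "\<dots> \<le> R * (6 * D + 3)" using assms pq by (intro mult_left_mono) auto
        also have "\<dots> \<le> R * (6 * (D + 1))" using assms by (intro mult_left_mono) auto
        also have "\<dots> \<le> 2 ^ k" using k by (simp add: algebra_simps)
        finally have "real (q - p) \<le> real (2 ^ k)" by simp
        then have n: "q - p \<le> 2 ^ k" by linarith
        have "D - R / 2 - k * \<delta> \<le> gromov_product d w (y p) (y (p + (q - p)))"
        proof (rule gromov_product_along_path[OF wM n])
          fix i assume i: "p \<le> i" "i \<le> p + (q - p)"
          then have "D \<le> d (y i) w" using far[of "y i"] pq unfolding Y_def by auto
          then show "y i \<in> M \<and> D - R / 2 \<le> d (y i) w" using y(1) i pq assms by auto
        next
          fix i assume i: "p \<le> i" "i < p + (q - p)"
          then have "D \<le> d (y i) w" "D \<le> d (y (Suc i)) w" "d (y i) (y (Suc i)) \<le> R"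
            using far[of "y i"] far[of "y (Suc i)"] y(2) pq unfolding Y_def by auto
          then show "D - R / 2 \<le> gromov_product d w (y i) (y (Suc i))" by (simp add: gromov_product_def)
        qed
        then show ?thesis using pq by simp
      qed
      have zz: "D - R / 2 - k * \<delta> \<le> gromov_product d w z z'"
      proof (cases "j \<le> l")
        case True
        then show ?thesis using path[of j l] jl dzz by simp
      next
        case False
        then show ?thesis using path[of l j] jl dzz d_sym[OF zM] by (simp add: gromov_product_def)
      qed
      have "min (gromov_product d w (c a) z) (gromov_product d w z z') - \<delta> \<le> gromov_product d w (c a) z'"
        by (intro four_pointD[OF fp] wM cM am zM)
      moreover have "min (gromov_product d w (c a) z') (gromov_product d w z' (c b)) - \<delta> \<le> gromov_product d w (c a) (c b)"
        by (intro four_pointD[OF fp] wM cM am b zM)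
      moreover have "gromov_product d w z' (c b) = gromov_product d w (c b) z'"
        using d_sym[OF zM(2) cM[OF b(2)]] by (simp add: gromov_product_def)
      moreover have "0 \<le> k * \<delta>" using delta by simp
      ultimately have "D - R / 2 - k * \<delta> - 2 * \<delta> \<le> 0" using zz a b gp0 assms delta by linarith
      then have "D \<le> R / 2 + (k + 2) * \<delta>" by (simp add: algebra_simps)
      also have "\<dots> \<le> (R + 2 * \<delta>) * (k + 1)"
      proof -
        have "R / 2 \<le> R * (k + 1)" using assms by (simp add: algebra_simps)
        moreover have "(k + 2) * \<delta> \<le> (2 * (k + 1)) * \<delta>" using delta by (intro mult_right_mono) auto
        ultimately show ?thesis by (simp add: algebra_simps)
      qed
      finally show "D \<le> (R + 2 * \<delta>) * (k + 1)" .
    qed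
    then show ?thesis using f_att[of i] fD[OF i] by force
  qed
  then show ?thesis using that D0(1) by blast
qed

text \<open>In the comparison tripod of \<open>c 0\<close>, \<open>c m\<close> and \<open>w\<close>,
  the branch point is at distance \<open>t\<close> from \<open>c 0\<close> and at distance the
  Gromov product from \<open>w\<close>. The first vertex of the chain at distance at least
  \<open>t\<close> approximates it; the 1 is the step size.\<close>

lemma point_near_geodesic:
  assumes c: "geodesic_chain M d c m" and w: "w \<in> M"
  shows "\<exists>a\<le>m. d w (c a) \<le> gromov_product d w (c 0) (c m) + 2 * \<delta> + 1"
proof -
  have cM: "\<And>i. i \<le> m \<Longrightarrow> c i \<in> M" and cstep: "\<And>i. i < m \<Longrightarrow> d (c i) (c (Suc i)) \<le> 1"
    and cadd: "\<And>i j k. i \<le> j \<Longrightarrow> j \<le> k \<Longrightarrow> k \<le> m \<Longrightarrow> d (c i) (c k) = d (c i) (c j) + d (c j) (c k)"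
    using c unfolding geodesic_chain_def by blast+
  define t where "t = gromov_product d (c 0) w (c m)"
  have sym0: "d (c i) (c 0) = d (c 0) (c i)" if "i \<le> m" for i using d_sym cM that by simp
  have t: "0 \<le> t" "t \<le> d (c 0) (c m)"
    using d_tri[of w "c 0" "c m"] d_tri[of "c m" w "c 0"] d_tri[of w "c m" "c 0"] w cM d_sym[OF w cM, of m] sym0[of m]
      d_sym[OF w cM, of 0]
    unfolding t_def gromov_product_def by auto
  define a where "a = (LEAST a. t \<le> d (c 0) (c a))"
  have a: "t \<le> d (c 0) (c a)" "a \<le> m" unfolding a_def
    by (rule LeastI[of _ m], use t in simp) (rule Least_le, use t in simp)
  have le: "d (c 0) (c a) \<le> t + 1"
  proof (cases a)
    case 0
    then show ?thesis using d_refl[OF cM, of 0] t by simp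
  next
    case (Suc b)
    then have "d (c 0) (c b) < t"
      using not_less_Least[of b "\<lambda>a. t \<le> d (c 0) (c a)"] unfolding a_def[symmetric] by simp
    moreover have "d (c 0) (c a) \<le> d (c 0) (c b) + d (c b) (c a)" using a Suc by (intro d_tri cM) auto
    ultimately show ?thesis using cstep[of b] a Suc by simp
  qed
  have "gromov_product d (c 0) (c m) (c a) = d (c 0) (c a)"
    using cadd[of 0 a m] a sym0 d_sym[OF cM cM, of a m] unfolding gromov_product_def by simp
  moreover have "min t (gromov_product d (c 0) (c m) (c a)) - \<delta> \<le> gromov_product d (c 0) w (c a)"
    unfolding t_def using w a cM by (intro four_pointD[OF fp]) auto
  ultimately have "t - \<delta> \<le> gromov_product d (c 0) w (c a)" using a by simp
  then have "d w (c a) \<le> d w (c 0) - t + 2 * \<delta> + 1"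
    using le sym0[of a] a unfolding gromov_product_def by simp
  also have "d w (c 0) - t = gromov_product d w (c 0) (c m)"
    unfolding t_def gromov_product_def using sym0[of m] d_sym[OF w cM, of 0] d_sym[OF w cM, of m] by (simp add: field_simps)
  finally show ?thesis using a by auto
qed

text \<open>By connectedness some \<open>c i\<close> is near vertices of the quasigeodesic both
  before and after \<open>q\<close>. Their indices then differ by a bounded amount, so
  \<open>y q\<close> is near \<open>c i\<close>, whose distance to \<open>y q\<close> bounds the
  product because \<open>c i\<close> lies between the ends.\<close>

lemma quasigeodesic_near_geodesic:
  fixes y :: "nat \<Rightarrow> 'p"
  assumes c: "geodesic_chain M d c m" "c 0 = y 0" "c m = y n"
    and y: "\<And>j. j \<le> n \<Longrightarrow> y j \<in> M"
      "\<And>j l. j \<le> l \<Longrightarrow> l \<le> n \<Longrightarrow> d (y j) (y l) \<le> R * real (l - j)"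
      "\<And>j l. j \<le> l \<Longrightarrow> l \<le> n \<Longrightarrow> real (l - j) \<le> R * (d (y j) (y l) + 1)"
    and near: "\<And>i. i \<le> m \<Longrightarrow> \<exists>j\<le>n. d (c i) (y j) \<le> D0" and D0: "0 \<le> D0" and R: "1 \<le> R" and q: "q \<le> n"
  shows "gromov_product d (y q) (y 0) (y n) \<le> D0 + R * (R * (2 * D0 + 2))"
proof -
  have cM: "\<And>i. i \<le> m \<Longrightarrow> c i \<in> M" and cstep: "\<And>i. i < m \<Longrightarrow> d (c i) (c (Suc i)) \<le> 1"
    and cadd: "\<And>i j k. i \<le> j \<Longrightarrow> j \<le> k \<Longrightarrow> k \<le> m \<Longrightarrow> d (c i) (c k) = d (c i) (c j) + d (c j) (c k)"
    using c unfolding geodesic_chain_def by blast+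
  define P where "P i \<longleftrightarrow> (\<exists>j\<le>q. d (c i) (y j) \<le> D0)" for i
  define S where "S i \<longleftrightarrow> (\<exists>l\<le>n. q \<le> l \<and> d (c i) (y l) \<le> D0)" for i
  have "P 0" unfolding P_def using c(2) d_refl[of "y 0"] y(1)[of 0] D0 by (intro exI[of _ 0]) auto
  moreover have "S m" unfolding S_def using c(3) d_refl[of "y n"] y(1)[of n] D0 q by (intro exI[of _ n]) auto
  moreover have "P i \<or> S i" if "i \<le> m" for i using near[OF that] unfolding P_def S_def by (meson nle_le)
  ultimately obtain i where i: "i \<le> m" "P i" "S i \<or> i < m \<and> S (Suc i)"
    by (rule discrete_crossing)
  then obtain j where j: "j \<le> q" "d (c i) (y j) \<le> D0" unfolding P_def by blast
  obtain l where l: "l \<le> n" "q \<le> l" "d (c i) (y l) \<le> D0 + 1"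
  proof -
    consider "S i" | "i < m" "S (Suc i)" using i by blast
    then show ?thesis
    proof cases
      case 1
      then obtain l where l: "l \<le> n" "q \<le> l" "d (c i) (y l) \<le> D0" unfolding S_def by blast
      then show ?thesis using that[of l] by simp
    next
      case 2
      then obtain l where l: "l \<le> n" "q \<le> l" "d (c (Suc i)) (y l) \<le> D0" unfolding S_def by blast
      have "d (c i) (y l) \<le> d (c i) (c (Suc i)) + d (c (Suc i)) (y l)"
        using 2 l by (intro d_tri cM y) auto
      then show ?thesis using that[of l] l cstep[OF 2(1)] by simp
    qed
  qed
  have mem: "y j \<in> M" "y l \<in> M" "y q \<in> M" "c i \<in> M" "y 0 \<in> M" "y n \<in> M" using y(1) cM i j l q by auto
  have "d (y j) (y l) \<le> d (y j) (c i) + d (c i) (y l)" by (intro d_tri mem)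
  then have djl: "d (y j) (y l) \<le> 2 * D0 + 1" using j l d_sym[OF mem(1,4)] by simp
  \<comment> \<open>\<open>y j\<close> and \<open>y l\<close> are within \<open>2 * D0 + 1\<close>,
    so the index gap is at most \<open>R * (2 * D0 + 2)\<close>; another factor \<open>R\<close>
    turns it back into distance.\<close>
  have "real (q - j) \<le> real (l - j)" using l j by simp
  also have "\<dots> \<le> R * (d (y j) (y l) + 1)" using y(3) j l by auto
  also have "\<dots> \<le> R * (2 * D0 + 2)" using djl R by (intro mult_left_mono) auto
  finally have "R * real (q - j) \<le> R * (R * (2 * D0 + 2))" using R by (intro mult_left_mono) auto
  moreover have "d (y j) (y q) \<le> R * real (q - j)" using y(2) j q by auto
  moreover have "d (c i) (y q) \<le> d (c i) (y j) + d (y j) (y q)" by (intro d_tri mem)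
  ultimately have iq: "d (c i) (y q) \<le> D0 + R * (R * (2 * D0 + 2))" using j by linarith
  have "d (y 0) (y q) \<le> d (y 0) (c i) + d (c i) (y q)" "d (y n) (y q) \<le> d (y n) (c i) + d (c i) (y q)"
    by (intro d_tri mem)+
  moreover have "d (y 0) (y n) = d (y 0) (c i) + d (y n) (c i)"
    using cadd[of 0 i m] i c d_sym[OF mem(4,6)] by simp
  ultimately show ?thesis using iq unfolding gromov_product_def by simp
qed

end

section \<open>Thin triangles and transport of hyperbolicity along an embedding\<close>

lemma unit_chain_geodesic: "unit_chain M d c n \<Longrightarrow> geodesic_chain M d c n"
  unfolding unit_chain_def geodesic_chain_def by auto

text \<open>The product of \<open>x\<close> and \<open>z\<close> at \<open>w\<close> is, up to
  \<open>2 * T + 1\<close>, at least the distance from \<open>w\<close> to a suitable vertex of the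
  side \<open>xz\<close>. That vertex is within \<open>T\<close> of one of the other sides of the
  triangle \<open>xyz\<close>, so the smaller of the other two products exceeds its distance from
  \<open>w\<close> by at most \<open>T\<close>.\<close>

lemma thin_triangles_four_point:
  assumes pm: "pseudo_metric_on M d"
    and geod: "\<And>x y. x \<in> M \<Longrightarrow> y \<in> M \<Longrightarrow> \<exists>c n. unit_chain M d c n \<and> c 0 = x \<and> c n = y"
    and T: "0 \<le> T"
    and thin: "\<And>a l b m c n i. unit_chain M d a l \<Longrightarrow> unit_chain M d b m \<Longrightarrow> unit_chain M d c n \<Longrightarrow>
      a 0 = c 0 \<Longrightarrow> a l = b 0 \<Longrightarrow> b m = c n \<Longrightarrow> i \<le> n \<Longrightarrow>
      (\<exists>j\<le>l. d (c i) (a j) \<le> T) \<or> (\<exists>j\<le>m. d (c i) (b j) \<le> T)"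
  shows "four_point M d (3 * T + 1)"
  unfolding four_point_def
proof (intro ballI)
  fix w x y z assume M: "w \<in> M" "x \<in> M" "y \<in> M" "z \<in> M"
  have sym: "\<And>x y. x \<in> M \<Longrightarrow> y \<in> M \<Longrightarrow> d x y = d y x" and refl: "\<And>x. x \<in> M \<Longrightarrow> d x x = 0"
    and tri: "\<And>x y z. x \<in> M \<Longrightarrow> y \<in> M \<Longrightarrow> z \<in> M \<Longrightarrow> d x z \<le> d x y + d y z"
    using pm unfolding pseudo_metric_on_def by blast+
  obtain c n where c: "unit_chain M d c n" "c 0 = x" "c n = z" using geod M by blast
  have chainM: "\<And>c n i. unit_chain M d c n \<Longrightarrow> i \<le> n \<Longrightarrow> c i \<in> M"
    unfolding unit_chain_def by blast
  have on: "d x y = d x (c i) + d (c i) y" if "unit_chain M d c n" "c 0 = x" "c n = y" "i \<le> n" for c n x y i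
    using that unit_chain_geodesic[of M d c n] unfolding geodesic_chain_def by blast
  \<comment> \<open>Thinness of the triangle \<open>x\<close>, \<open>w\<close>, \<open>z\<close>:
    the crossing vertex of the side \<open>xz\<close> is near both sides issuing from
    \<open>w\<close>.\<close>
  have "\<exists>i\<le>n. d w (c i) - 2 * T - 1 \<le> gromov_product d w x z"
  proof -
    obtain a l where a: "unit_chain M d a l" "a 0 = x" "a l = w" using geod M by blast
    obtain b m where b: "unit_chain M d b m" "b 0 = w" "b m = z" using geod M by blast
    define P where "P i \<longleftrightarrow> (\<exists>j\<le>l. d (c i) (a j) \<le> T)" for i
    define S where "S i \<longleftrightarrow> (\<exists>j\<le>m. d (c i) (b j) \<le> T)" for i
    have "P 0" unfolding P_def using a c refl M T by (intro exI[of _ 0]) auto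
    moreover have "S n" unfolding S_def using b c refl M T by (intro exI[of _ m]) auto
    moreover have "P i \<or> S i" if "i \<le> n" for i
      unfolding P_def S_def using that a b c by (intro thin) auto
    ultimately obtain i where i: "i \<le> n" "P i" "S i \<or> i < n \<and> S (Suc i)"
      by (rule discrete_crossing)
    have ciM: "c i \<in> M" using chainM c(1) i(1) by blast
    obtain j where j: "j \<le> l" "d (c i) (a j) \<le> T" using i unfolding P_def by blast
    have ajM: "a j \<in> M" using chainM a(1) j(1) by blast
    obtain k where k: "k \<le> m" "d (c i) (b k) \<le> T + 1"
    proof -
      consider "S i" | "i < n" "S (Suc i)" using i by blast
      then show ?thesis
      proof cases
        case 1
        then obtain k where "k \<le> m" "d (c i) (b k) \<le> T" unfolding S_def by blast
        then show ?thesis using that[of k] by simp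
      next
        case 2
        then obtain k where k: "k \<le> m" "d (c (Suc i)) (b k) \<le> T" unfolding S_def by blast
        have "d (c i) (b k) \<le> d (c i) (c (Suc i)) + d (c (Suc i)) (b k)"
          using ciM chainM[OF c(1), of "Suc i"] chainM[OF b(1) k(1)] 2 by (intro tri) auto
        moreover have "d (c i) (c (Suc i)) \<le> 1" using unit_chain_geodesic[OF c(1)] 2 unfolding geodesic_chain_def by blast
        ultimately show ?thesis using that[of k] k by simp
      qed
    qed
    have bkM: "b k \<in> M" using chainM b(1) k(1) by blast
    have "d x w = d x (a j) + d (a j) w" using on[OF a j(1)] .
    moreover have "d w z = d w (b k) + d (b k) z" using on[OF b k(1)] .
    moreover have "d x z = d x (c i) + d (c i) z" using on[OF c i(1)] .
    moreover have "d x (c i) \<le> d x (a j) + d (a j) (c i)" "d (c i) w \<le> d (c i) (a j) + d (a j) w"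
      "d w (c i) \<le> d w (b k) + d (b k) (c i)" "d (c i) z \<le> d (c i) (b k) + d (b k) z"
      by (intro tri M ciM ajM bkM)+
    moreover have "d (a j) (c i) = d (c i) (a j)" "d (b k) (c i) = d (c i) (b k)" "d (c i) w = d w (c i)" "d w z = d z w"
      by (intro sym M ciM ajM bkM)+
    ultimately have "d w (c i) - 2 * T - 1 \<le> gromov_product d w x z"
      using j k unfolding gromov_product_def by simp
    then show ?thesis using i by blast
  qed
  then obtain i where i: "i \<le> n" "d w (c i) - 2 * T - 1 \<le> gromov_product d w x z" by blast
  have ciM: "c i \<in> M" using chainM c(1) i(1) by blast
  have bound: "gromov_product d w x y \<le> d w (c i) + T"
    if a: "unit_chain M d a l" "a 0 = x" "a l = y" "j \<le> l" "d (c i) (a j) \<le> T"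
      and xy: "x \<in> M" "y \<in> M" for a l j x y
  proof -
    have ajM: "a j \<in> M" using chainM a by blast
    have "d x y = d x (a j) + d (a j) y" using on a by blast
    moreover have "d x w \<le> d x (a j) + d (a j) w" "d y w \<le> d y (a j) + d (a j) w"
      "d w (a j) \<le> d w (c i) + d (c i) (a j)"
      by (intro tri M ciM ajM xy)+
    moreover have "d w (a j) = d (a j) w" "d y (a j) = d (a j) y" by (intro sym M ajM xy)+
    ultimately have "d x w + d y w - d x y \<le> 2 * d w (a j)" "d w (a j) \<le> d w (c i) + T"
      using a(5) by linarith+
    then show ?thesis unfolding gromov_product_def by (simp add: field_simps)
  qed
  obtain a l where a: "unit_chain M d a l" "a 0 = x" "a l = y" using geod M by blast
  obtain b m where b: "unit_chain M d b m" "b 0 = y" "b m = z" using geod M by blast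
  have "(\<exists>j\<le>l. d (c i) (a j) \<le> T) \<or> (\<exists>j\<le>m. d (c i) (b j) \<le> T)"
    using a b c i by (intro thin) auto
  then have "min (gromov_product d w x y) (gromov_product d w y z) \<le> d w (c i) + T"
    using bound[OF a _ _ M(2,3)] bound[OF b _ _ M(3,4)] by (auto simp: min_le_iff_disj)
  then show "min (gromov_product d w x y) (gromov_product d w y z) - (3 * T + 1) \<le> gromov_product d w x z"
    using i by linarith
qed

text \<open>A vertex on one side of a triangle in \<open>Q\<close> has, in \<open>X\<close>, bounded
  Gromov product with the ends of that side. The four-point inequality passes this bound to one of
  the other sides, and stability then places the vertex near the image of that side; so triangles in
  \<open>Q\<close> are thin.\<close>

theorem four_point_quasi_isometric_embedding:
  assumes X: "pseudo_metric_on X d" "four_point X d \<delta>" "0 \<le> \<delta>"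
    "\<And>x y. x \<in> X \<Longrightarrow> y \<in> X \<Longrightarrow> \<exists>c n. geodesic_chain X d c n \<and> c 0 = x \<and> c n = y"
    and Q: "pseudo_metric_on Q e"
    "\<And>x y. x \<in> Q \<Longrightarrow> y \<in> Q \<Longrightarrow> \<exists>c n. unit_chain Q e c n \<and> c 0 = x \<and> c n = y"
    and R: "1 \<le> R"
    and s: "\<And>x. x \<in> Q \<Longrightarrow> s x \<in> X"
    "\<And>x y. x \<in> Q \<Longrightarrow> y \<in> Q \<Longrightarrow> d (s x) (s y) \<le> R * e x y"
    "\<And>x y. x \<in> Q \<Longrightarrow> y \<in> Q \<Longrightarrow> e x y \<le> R * (d (s x) (s y) + 1)"
  shows "\<exists>\<delta>'\<ge>0. four_point Q e \<delta>'"
proof -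
  obtain D0 where D0: "0 \<le> D0"
    "\<And>c m y n i. geodesic_chain X d c m \<Longrightarrow> c 0 = y 0 \<Longrightarrow> c m = y n \<Longrightarrow>
       (\<And>j. j \<le> n \<Longrightarrow> y j \<in> X) \<Longrightarrow> (\<And>j. j < n \<Longrightarrow> d (y j) (y (Suc j)) \<le> R) \<Longrightarrow>
       (\<And>j l. j \<le> l \<Longrightarrow> l \<le> n \<Longrightarrow> real (l - j) \<le> R * (d (y j) (y l) + 1)) \<Longrightarrow>
       i \<le> m \<Longrightarrow> \<exists>j\<le>n. d (c i) (y j) \<le> D0"
    using geodesic_near_quasigeodesic[OF X(1-3) R] by metis
  \<comment> \<open>\<open>C\<close> is the bound of \<open>quasigeodesic_near_geodesic\<close>.
    \<open>T\<close> adds \<open>\<delta>\<close> from the four-point inequality,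
    \<open>2 * \<delta> + 1\<close> from reaching the geodesic, \<open>D0\<close> from there to the
    side, and the additive 1 in the return to \<open>Q\<close>.\<close>
  define C where "C = D0 + R * (R * (2 * D0 + 2))"
  define T where "T = R * (C + 3 * \<delta> + 2 + D0)"
  have C: "0 \<le> C" unfolding C_def using D0 R by simp
  have T: "0 \<le> T" unfolding T_def using D0 R C X by simp
  have sc: "s (c i) \<in> X" "\<And>j. j \<le> n \<Longrightarrow> i \<le> j \<Longrightarrow> d (s (c i)) (s (c j)) \<le> R * real (j - i)"
      "\<And>j. j \<le> n \<Longrightarrow> i \<le> j \<Longrightarrow> real (j - i) \<le> R * (d (s (c i)) (s (c j)) + 1)"
    if "unit_chain Q e c n" "i \<le> n" for c n i
  proof -
    have cQ: "c k \<in> Q" if "k \<le> n" for k using \<open>unit_chain Q e c n\<close> that unfolding unit_chain_def by blast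
    then show "s (c i) \<in> X" using s(1) that by blast
    fix j assume j: "j \<le> n" "i \<le> j"
    then have "e (c i) (c j) = real (j - i)" using that unfolding unit_chain_def by blast
    then show "d (s (c i)) (s (c j)) \<le> R * real (j - i)" "real (j - i) \<le> R * (d (s (c i)) (s (c j)) + 1)"
      using s(2,3)[OF cQ[OF that(2)] cQ[OF j(1)]] by simp_all
  qed
  have near: "\<exists>j\<le>n. d (g i) (s (c j)) \<le> D0"
    if c: "unit_chain Q e c n" and g: "geodesic_chain X d g m" "g 0 = s (c 0)" "g m = s (c n)" "i \<le> m"
    for c n g m i
  proof (rule D0(2)[OF g(1), of "\<lambda>i. s (c i)"])
    show "d (s (c j)) (s (c (Suc j))) \<le> R" if "j < n" for j
      using sc(2)[OF c, of j "Suc j"] that by simp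
  qed (use sc[OF c] g in auto)
  have chain_gp: "gromov_product d (s (c q)) (s (c 0)) (s (c n)) \<le> C"
    if c: "unit_chain Q e c n" and q: "q \<le> n" for c n q
  proof -
    obtain g m where g: "geodesic_chain X d g m" "g 0 = s (c 0)" "g m = s (c n)"
      using X(4)[OF sc(1)[OF c] sc(1)[OF c], of 0 n] by auto
    show ?thesis unfolding C_def
      by (rule quasigeodesic_near_geodesic[OF X(1-3) g(1), of "\<lambda>i. s (c i)"])
        (use sc[OF c] near[OF c g] g D0 R q in auto)
  qed
  have close: "\<exists>j\<le>n. e x (c j) \<le> T"
    if c: "unit_chain Q e c n" and x: "x \<in> Q" "gromov_product d (s x) (s (c 0)) (s (c n)) \<le> C + \<delta>" for c n x
  proof -
    obtain g m where g: "geodesic_chain X d g m" "g 0 = s (c 0)" "g m = s (c n)"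
      using X(4)[OF sc(1)[OF c] sc(1)[OF c], of 0 n] by auto
    obtain a where a: "a \<le> m" "d (s x) (g a) \<le> C + \<delta> + 2 * \<delta> + 1"
      using point_near_geodesic[OF X(1-3) g(1) s(1)[OF x(1)]] x(2) g by fastforce
    obtain j where j: "j \<le> n" "d (g a) (s (c j)) \<le> D0" using near[OF c g a(1)] by blast
    have "c j \<in> Q" using c j unfolding unit_chain_def by blast
    moreover have "g a \<in> X" using g a unfolding geodesic_chain_def by blast
    ultimately have "d (s x) (s (c j)) \<le> d (s x) (g a) + d (g a) (s (c j))"
      using d_tri[OF X(1-3) s(1)[OF x(1)] _ s(1)] by blast
    then have "d (s x) (s (c j)) + 1 \<le> C + 3 * \<delta> + 2 + D0" using a j by linarith
    then have "R * (d (s x) (s (c j)) + 1) \<le> T" unfolding T_def using R by (intro mult_left_mono) auto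
    then show ?thesis using s(3)[OF x(1) \<open>c j \<in> Q\<close>] j by (intro exI[of _ j]) linarith
  qed
  have "four_point Q e (3 * T + 1)"
  proof (rule thin_triangles_four_point[OF Q T])
    fix a b c :: "nat \<Rightarrow> 'b" and l m n i
    assume *: "unit_chain Q e a l" "unit_chain Q e b m" "unit_chain Q e c n"
      "a 0 = c 0" "a l = b 0" "b m = c n" "i \<le> n"
    have Qm: "c i \<in> Q" using * unfolding unit_chain_def by blast
    have "min (gromov_product d (s (c i)) (s (a 0)) (s (a l))) (gromov_product d (s (c i)) (s (b 0)) (s (b m))) - \<delta>
        \<le> gromov_product d (s (c i)) (s (c 0)) (s (c n))"
      using four_pointD[OF X(2) s(1)[OF Qm] sc(1)[OF *(3), of 0] sc(1)[OF *(1), of l] sc(1)[OF *(3), of n]] * by simp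
    also have "\<dots> \<le> C" using chain_gp[OF *(3,7)] .
    finally show "(\<exists>j\<le>l. e (c i) (a j) \<le> T) \<or> (\<exists>j\<le>m. e (c i) (b j) \<le> T)"
      using close[OF *(1) Qm] close[OF *(2) Qm] by (auto simp: min_def split: if_splits)
  qed
  then show ?thesis using T by (intro exI[of _ "3 * T + 1"]) auto
qed

lemma gromov_hyperbolic_four_point: "gromov_hyperbolic M d \<longleftrightarrow> (\<exists>\<delta>\<ge>0. four_point M d \<delta>)"
  unfolding gromov_hyperbolic_def four_point_def ..

section \<open>Hyperbolicity of a graph read off from its vertices\<close>

context
  fixes \<Gamma> :: "'v metric_graph"
  assumes half: "half_graph \<Gamma>" and conn: "connected_graph \<Gamma>"
begin

lemma pseudo_metric_vertex_dist: "pseudo_metric_on (verts \<Gamma>) (vertex_dist \<Gamma>)"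
  unfolding pseudo_metric_on_def
proof (intro conjI ballI)
  show "vertex_dist \<Gamma> x y = vertex_dist \<Gamma> y x" for x y by (rule vertex_dist_sym[OF half])
qed (rule vertex_dist_refl[OF half], assumption, rule vertex_dist_triangle[OF half conn])

lemma geodesic_chain_exists:
  assumes "a \<in> verts \<Gamma>" "b \<in> verts \<Gamma>"
  shows "\<exists>c n. geodesic_chain (verts \<Gamma>) (vertex_dist \<Gamma>) c n \<and> c 0 = a \<and> c n = b \<and>
    ((\<forall>u v. adj \<Gamma> u v \<longrightarrow> elen \<Gamma> u v = 1) \<longrightarrow> unit_chain (verts \<Gamma>) (vertex_dist \<Gamma>) c n)"
proof -
  obtain xs where xs: "geodesic_path \<Gamma> xs" "hd xs = a" "last xs = b"
    by (rule geodesic_between[OF half conn assms])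
  have ep: "edge_path \<Gamma> xs" using xs unfolding geodesic_path_def by blast
  have ne: "xs \<noteq> []" using ep unfolding edge_path_def by blast
  let ?n = "length xs - 1"
  have geo: "vertex_dist \<Gamma> (xs ! i) (xs ! j) = path_length \<Gamma> xs i j" if "i \<le> j" "j \<le> ?n" for i j
    using xs(1) that ne unfolding geodesic_path_def by (cases xs) auto
  have mem: "xs ! i \<in> verts \<Gamma>" if "i \<le> ?n" for i
    using edge_path_nth(1)[OF ep, of i] that ne by (cases xs) auto
  have ad: "adj \<Gamma> (xs ! i) (xs ! Suc i)" if "i < ?n" for i
    using edge_path_nth(2)[OF ep, of i] that ne by (cases xs) auto
  have "geodesic_chain (verts \<Gamma>) (vertex_dist \<Gamma>) ((!) xs) ?n"
    unfolding geodesic_chain_def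
  proof (intro conjI allI impI)
    show "vertex_dist \<Gamma> (xs ! i) (xs ! Suc i) \<le> 1" if "i < ?n" for i
    proof -
      have "elen \<Gamma> (xs ! i) (xs ! Suc i) = 1 / 2 \<or> elen \<Gamma> (xs ! i) (xs ! Suc i) = 1"
        using half ad[OF that] mem[of i] mem[of "Suc i"] that unfolding half_graph_def by auto
      then show ?thesis using geo[of i "Suc i"] that by (auto simp: path_length_Suc)
    qed
    show "vertex_dist \<Gamma> (xs ! i) (xs ! k) = vertex_dist \<Gamma> (xs ! i) (xs ! j) + vertex_dist \<Gamma> (xs ! j) (xs ! k)"
      if "i \<le> j \<and> j \<le> k \<and> k \<le> ?n" for i j k
      using geo[of i k] geo[of i j] geo[of j k] that path_length_split[of i j k \<Gamma> xs] by simp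
  qed (rule mem)
  moreover have "unit_chain (verts \<Gamma>) (vertex_dist \<Gamma>) ((!) xs) ?n"
    if one: "\<And>u v. adj \<Gamma> u v \<Longrightarrow> elen \<Gamma> u v = 1"
    unfolding unit_chain_def
  proof (intro conjI allI impI)
    show "vertex_dist \<Gamma> (xs ! i) (xs ! j) = real (j - i)" if ij: "i \<le> j \<and> j \<le> ?n" for i j
    proof -
      have "path_length \<Gamma> xs i j = (\<Sum>k\<in>{i..<j}. 1)"
        unfolding path_length_def by (rule sum.cong) (use ij in \<open>auto intro!: one ad\<close>)
      then show ?thesis using geo ij by simp
    qed
  qed (rule mem)
  ultimately show ?thesis using xs ne
    by (intro exI[of _ "(!) xs"] exI[of _ ?n]) (auto simp: hd_conv_nth last_conv_nth)
qed

text \<open>The name \<open>(u, u, 0)\<close> of a vertex has \<open>(u, elen \<Gamma> u u)\<close>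
  among its \<open>edge_ends\<close>, even without a loop at \<open>u\<close>. The value of
  \<open>elen\<close> on such a pair therefore enters \<open>point_dist\<close> and has to be
  bounded.\<close>

context
  assumes loop: "\<And>u. u \<in> verts \<Gamma> \<Longrightarrow> 0 \<le> elen \<Gamma> u u \<and> elen \<Gamma> u u \<le> 1"
begin

lemma finite_along_edge: "finite (along_edge \<Gamma> x y)"
proof -
  have if_finite: "finite (if b then {c} else {})" for b and c :: real by (cases b) simp_all
  obtain u v s where x: "x = (u, v, s)" by (cases x)
  obtain u' v' t where y: "y = (u', v', t)" by (cases y)
  show ?thesis unfolding x y along_edge.simps by (intro finite_UnI if_finite)
qed

lemma finite_edge_ends: "finite (edge_ends \<Gamma> x)"
  by (cases x) simp

lemma point_dist_vertices:
  assumes "u \<in> verts \<Gamma>" "v \<in> verts \<Gamma>"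
  shows "point_dist \<Gamma> (u, u, 0) (v, v, 0) = vertex_dist \<Gamma> u v"
  unfolding point_dist_def
proof (rule Min_eqI)
  show "vertex_dist \<Gamma> u v \<in> along_edge \<Gamma> (u, u, 0) (v, v, 0) \<union>
      (\<lambda>((u, a), (v, b)). a + vertex_dist \<Gamma> u v + b) ` (edge_ends \<Gamma> (u, u, 0) \<times> edge_ends \<Gamma> (v, v, 0))"
    by (intro UnI2 image_eqI[of _ _ "((u, 0), (v, 0))"]) auto
  fix r assume "r \<in> along_edge \<Gamma> (u, u, 0) (v, v, 0) \<union>
      (\<lambda>((u, a), (v, b)). a + vertex_dist \<Gamma> u v + b) ` (edge_ends \<Gamma> (u, u, 0) \<times> edge_ends \<Gamma> (v, v, 0))"
  then show "vertex_dist \<Gamma> u v \<le> r"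
    using loop[OF assms(1)] loop[OF assms(2)] vertex_dist_refl[OF half assms(1)]
    by (auto split: if_splits)
qed (simp add: finite_along_edge)

lemma hyperbolic_vertices:
  assumes "hyperbolic_graph \<Gamma>"
  obtains \<delta> where "0 \<le> \<delta>" "four_point (verts \<Gamma>) (vertex_dist \<Gamma>) \<delta>"
proof -
  obtain \<delta> where \<delta>: "0 \<le> \<delta>" "four_point (graph_points \<Gamma>) (point_dist \<Gamma>) \<delta>"
    using assms unfolding hyperbolic_graph_def gromov_hyperbolic_four_point by blast
  have P: "(u, u, 0) \<in> graph_points \<Gamma>" if "u \<in> verts \<Gamma>" for u
    using that unfolding graph_points_def by blast
  have "four_point (verts \<Gamma>) (vertex_dist \<Gamma>) \<delta>"
    unfolding four_point_def
  proof (intro ballI)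
    fix w x y z assume M: "w \<in> verts \<Gamma>" "x \<in> verts \<Gamma>" "y \<in> verts \<Gamma>" "z \<in> verts \<Gamma>"
    show "min (gromov_product (vertex_dist \<Gamma>) w x y) (gromov_product (vertex_dist \<Gamma>) w y z) - \<delta>
        \<le> gromov_product (vertex_dist \<Gamma>) w x z"
      using four_pointD[OF \<delta>(2) P[OF M(1)] P[OF M(2)] P[OF M(3)] P[OF M(4)]]
      unfolding gromov_product_def point_dist_vertices[OF M(2,1)] point_dist_vertices[OF M(3,1)]
        point_dist_vertices[OF M(4,1)] point_dist_vertices[OF M(2,3)] point_dist_vertices[OF M(3,4)]
        point_dist_vertices[OF M(2,4)] .
  qed
  then show ?thesis using that \<delta>(1) by blast
qed

lemma graph_pointD:
  assumes "(u, v, t) \<in> graph_points \<Gamma>"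
  shows "u \<in> verts \<Gamma>" "v \<in> verts \<Gamma>" "0 \<le> t" "t \<le> 1" "0 \<le> elen \<Gamma> u v - t" "elen \<Gamma> u v - t \<le> 1"
    "vertex_dist \<Gamma> u v \<le> 1"
proof -
  from assms consider "u = v" "t = 0" "u \<in> verts \<Gamma>"
    | "u \<in> verts \<Gamma>" "v \<in> verts \<Gamma>" "adj \<Gamma> u v" "0 \<le> t" "t \<le> elen \<Gamma> u v"
    unfolding graph_points_def by auto
  then have "u \<in> verts \<Gamma> \<and> v \<in> verts \<Gamma> \<and> 0 \<le> t \<and> t \<le> 1 \<and> 0 \<le> elen \<Gamma> u v - t \<and> elen \<Gamma> u v - t \<le> 1 \<and>
    vertex_dist \<Gamma> u v \<le> 1"
  proof cases
    case 1
    then show ?thesis using loop[of u] vertex_dist_refl[OF half, of u] by simp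
  next
    case 2
    then have "elen \<Gamma> u v = 1 / 2 \<or> elen \<Gamma> u v = 1" using half unfolding half_graph_def by blast
    then have le: "elen \<Gamma> u v \<le> 1" by auto
    then have "walk_le \<Gamma> u v 1" by (intro walk_le_edge 2)
    then show ?thesis using 2 le vertex_dist_le[OF half] by simp
  qed
  then show "u \<in> verts \<Gamma>" "v \<in> verts \<Gamma>" "0 \<le> t" "t \<le> 1" "0 \<le> elen \<Gamma> u v - t" "elen \<Gamma> u v - t \<le> 1"
    "vertex_dist \<Gamma> u v \<le> 1" by blast+
qed

text \<open>Every point is within 1 of both ends of its edge, so distances between points and
  between first ends differ by a constant.\<close>

lemma point_dist_approx:
  assumes x: "x \<in> graph_points \<Gamma>" and y: "y \<in> graph_points \<Gamma>"
  shows "\<bar>point_dist \<Gamma> x y - vertex_dist \<Gamma> (fst x) (fst y)\<bar> \<le> 4"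
proof -
  obtain u v t where xx: "x = (u, v, t)" by (cases x)
  obtain u' v' t' where yy: "y = (u', v', t')" by (cases y)
  note X = graph_pointD[OF x[unfolded xx]] and Y = graph_pointD[OF y[unfolded yy]]
  note tri = vertex_dist_triangle[OF half conn] and sym = vertex_dist_sym[OF half]
  let ?A = "along_edge \<Gamma> x y \<union>
    (\<lambda>((u, a), (v, b)). a + vertex_dist \<Gamma> u v + b) ` (edge_ends \<Gamma> x \<times> edge_ends \<Gamma> y)"
  have fin: "finite ?A" by (simp add: finite_along_edge finite_edge_ends)
  have elem: "t + vertex_dist \<Gamma> u u' + t' \<in> ?A"
    unfolding xx yy by (intro UnI2 image_eqI[of _ _ "((u, t), (u', t'))"]) auto
  have "point_dist \<Gamma> x y \<le> t + vertex_dist \<Gamma> u u' + t'"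
    unfolding point_dist_def by (rule Min_le[OF fin elem])
  moreover have "vertex_dist \<Gamma> u u' - 2 \<le> point_dist \<Gamma> x y"
    unfolding point_dist_def
  proof (rule Min.boundedI[OF fin])
    show "?A \<noteq> {}" using elem by blast
    fix r assume "r \<in> ?A"
    then show "vertex_dist \<Gamma> u u' - 2 \<le> r"
    proof
      assume "r \<in> along_edge \<Gamma> x y"
      \<comment> \<open>Two points on a common edge have first ends that coincide or are the two
        ends of that edge.\<close>
      then have "0 \<le> r \<and> (u = u' \<or> u' = v)" unfolding xx yy along_edge.simps
        by (elim UnE) (simp_all split: if_split_asm)
      then show ?thesis using X(7) vertex_dist_refl[OF half X(1)] by auto
    next
      assume "r \<in> (\<lambda>((u, a), (v, b)). a + vertex_dist \<Gamma> u v + b) ` (edge_ends \<Gamma> x \<times> edge_ends \<Gamma> y)"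
      then obtain e a e' b where r: "r = a + vertex_dist \<Gamma> e e' + b"
        and ea: "(e, a) \<in> edge_ends \<Gamma> x" "(e', b) \<in> edge_ends \<Gamma> y" by auto
      have e: "e \<in> verts \<Gamma>" "vertex_dist \<Gamma> u e \<le> 1" "0 \<le> a"
        using ea(1) X vertex_dist_refl[OF half X(1)] unfolding xx by auto
      have e': "e' \<in> verts \<Gamma>" "vertex_dist \<Gamma> u' e' \<le> 1" "0 \<le> b"
        using ea(2) Y vertex_dist_refl[OF half Y(1)] unfolding yy by auto
      have "vertex_dist \<Gamma> u u' \<le> vertex_dist \<Gamma> u e + vertex_dist \<Gamma> e u'"
        "vertex_dist \<Gamma> e u' \<le> vertex_dist \<Gamma> e e' + vertex_dist \<Gamma> e' u'"
        by (rule tri[OF X(1) e(1) Y(1)], rule tri[OF e(1) e'(1) Y(1)])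
      then show ?thesis using e e' r sym[of u' e'] by linarith
    qed
  qed
  ultimately show ?thesis using X Y unfolding xx yy by (simp add: abs_le_iff)
qed

lemma hyperbolic_graphI:
  assumes "0 \<le> \<delta>" and fp: "four_point (verts \<Gamma>) (vertex_dist \<Gamma>) \<delta>"
  shows "hyperbolic_graph \<Gamma>"
  unfolding hyperbolic_graph_def gromov_hyperbolic_four_point
\<comment> \<open>Three distances, each off by at most 4, change a Gromov product by at most 6; this
  occurs on both sides of the inequality.\<close>
proof (intro exI[of _ "\<delta> + 12"] conjI)
  show "four_point (graph_points \<Gamma>) (point_dist \<Gamma>) (\<delta> + 12)"
    unfolding four_point_def
  proof (intro ballI)
    fix w x y z assume M: "w \<in> graph_points \<Gamma>" "x \<in> graph_points \<Gamma>" "y \<in> graph_points \<Gamma>" "z \<in> graph_points \<Gamma>"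
    have V: "fst a \<in> verts \<Gamma>" if "a \<in> graph_points \<Gamma>" for a
      using graph_pointD(1)[of "fst a" "fst (snd a)" "snd (snd a)"] that by simp
    have gp: "\<bar>gromov_product (point_dist \<Gamma>) w a b - gromov_product (vertex_dist \<Gamma>) (fst w) (fst a) (fst b)\<bar> \<le> 6"
      if "a \<in> graph_points \<Gamma>" "b \<in> graph_points \<Gamma>" for a b
      using point_dist_approx[OF that(1) M(1)] point_dist_approx[OF that(2) M(1)] point_dist_approx[OF that]
      unfolding gromov_product_def by (simp add: abs_le_iff field_simps)
    show "min (gromov_product (point_dist \<Gamma>) w x y) (gromov_product (point_dist \<Gamma>) w y z) - (\<delta> + 12)
        \<le> gromov_product (point_dist \<Gamma>) w x z"
      using four_pointD[OF fp V[OF M(1)] V[OF M(2)] V[OF M(3)] V[OF M(4)]]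
        gp[OF M(2,3)] gp[OF M(3,4)] gp[OF M(2,4)]
      by (simp add: abs_le_iff min_def split: if_splits)
  qed
qed (use assms in simp)

end
end

section \<open>Left translations and existence of nearest points\<close>

context coned_group
begin

text \<open>Left multiplication permutes left cosets, hence acts on the coned-off graph. One
  inequality is stated, to be applied to an element and to its inverse.\<close>

lemma dc_mult_left:
  assumes g: "g \<in> carrier G" and xy: "x \<in> carrier G" "y \<in> carrier G"
  shows "dc (Elt (g \<otimes> x)) (Elt (g \<otimes> y)) \<le> dc (Elt x) (Elt y)"
proof -
  have "walk_le con (coned_map (\<lambda>x. g \<otimes> x) (Elt x)) (coned_map (\<lambda>x. g \<otimes> x) (Elt y)) (1 * dc (Elt x) (Elt y))"
  proof (rule coned_map_lipschitz)
    show "(\<lambda>x. g \<otimes> x) ` C \<in> lcosets H" if C: "C \<in> lcosets H" for C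
    proof -
      obtain c where c: "c \<in> carrier G" "C = c <# H" using C by (auto simp: LCOSETS_def)
      have "(\<lambda>x. g \<otimes> x) ` C = g <# C" unfolding l_coset_def by auto
      also have "\<dots> = (g \<otimes> c) <# H" using c g lcos_m_assoc[OF subgroup.subset[OF H]] by simp
      finally show ?thesis using lcosetI(1)[of "g \<otimes> c"] g c by simp
    qed
    fix x y r assume w: "walk_le cay x y r"
    then have "x \<in> carrier G" "y \<in> carrier G" unfolding walk_le_def using walk_verts by fastforce+
    then show "walk_le cay (g \<otimes> x) (g \<otimes> y) (1 * r)"
      using w walk_le_cay_iff word_dist_mult_left g by simp
  qed (use g xy dc_walk_le in auto)
  then show ?thesis using dc_le by simp
qed

lemma nearest_mult_left:
  assumes h: "h \<in> H" and near: "nearest k y" and y: "y \<in> carrier G"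
  shows "nearest (h \<otimes> k) (h \<otimes> y)"
  unfolding nearest_def
proof (intro conjI ballI)
  have k: "k \<in> H" using near unfolding nearest_def by blast
  show "h \<otimes> k \<in> H" using h k H by (simp add: subgroup.m_closed)
  fix h' assume h': "h' \<in> H"
  have "inv h \<otimes> h' \<in> H" using h h' H by (simp add: subgroup.m_closed subgroup.m_inv_closed)
  then have "dc (Elt k) (Elt y) \<le> dc (Elt (inv h \<otimes> h')) (Elt y)" using near unfolding nearest_def by blast
  moreover have "dc (Elt (h \<otimes> k)) (Elt (h \<otimes> y)) \<le> dc (Elt k) (Elt y)"
    using h k y H_carrier by (intro dc_mult_left) auto
  moreover have "dc (Elt (inv h \<otimes> h')) (Elt (inv h \<otimes> (h \<otimes> y))) \<le> dc (Elt h') (Elt (h \<otimes> y))"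
    using h h' y H_carrier by (intro dc_mult_left) auto
  moreover have "inv h \<otimes> (h \<otimes> y) = y" using h y H_carrier by (simp add: m_assoc[symmetric])
  ultimately show "dc (Elt (h \<otimes> k)) (Elt (h \<otimes> y)) \<le> dc (Elt h') (Elt (h \<otimes> y))" by simp
qed

lemma nearest_exists:
  assumes y: "y \<in> carrier G"
  obtains k where "nearest k y"
proof -
  \<comment> \<open>Electric distances are multiples of 1/2; doubling makes them naturals, among
    which a least one exists.\<close>
  define m where "m h = nat \<lfloor>2 * dc (Elt h) (Elt y)\<rfloor>" for h
  have m: "real (m h) = 2 * dc (Elt h) (Elt y)" if "h \<in> H" for h
  proof -
    have "\<exists>r. walk con (Elt h) (Elt y) r"
      using connected_graph_con that H_carrier y unfolding connected_graph_def by simp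
    then have "walk con (Elt h) (Elt y) (dc (Elt h) (Elt y))"
      using vertex_dist_attained(1)[OF half_graph_con] by blast
    then obtain n :: nat where "dc (Elt h) (Elt y) = n / 2" using walk_half[OF half_graph_con] by blast
    then have eq: "2 * dc (Elt h) (Elt y) = real n" by simp
    show ?thesis unfolding m_def eq by simp
  qed
  have "\<one> \<in> H" using H by (rule subgroup.one_closed)
  then obtain k where k: "k \<in> H" "\<And>h. h \<in> H \<Longrightarrow> m k \<le> m h"
    using ex_has_least_nat[of "\<lambda>h. h \<in> H" \<one> m] by blast
  have "nearest k y" unfolding nearest_def
  proof (intro conjI ballI k(1))
    fix h assume "h \<in> H"
    then show "dc (Elt k) (Elt y) \<le> dc (Elt h) (Elt y)"
      using k(2)[of h] m[of h] m[OF k(1)] by linarith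
  qed
  then show ?thesis by (rule that)
qed

end

section \<open>Centred lifts\<close>

locale cusp_extension = K: coned_group K S H + G: group G + Q: group Q
  for K :: "('k, 'a) monoid_scheme" and S H and G :: "('g, 'b) monoid_scheme" and Q :: "('q, 'c) monoid_scheme" +
  fixes i :: "'k \<Rightarrow> 'g" and p :: "'g \<Rightarrow> 'q"
  assumes bcp: "bounded_coset_penetration K H S"
    and proper: "H \<noteq> carrier K"
    and i_hom: "i \<in> hom K G" and i_inj: "inj_on i (carrier K)"
    and p_hom: "p \<in> hom G Q" and ker: "kernel G Q p = i ` carrier K"
    and N_surj: "p ` normalizer G (i ` H) = carrier Q"
    and N_ker: "n \<in> normalizer G (i ` H) \<Longrightarrow> p n = \<one>\<^bsub>Q\<^esub> \<Longrightarrow> n \<in> i ` H"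
begin

abbreviation N :: "'g set" where "N \<equiv> normalizer G (i ` H)"

sublocale i: group_hom K G i
  by unfold_locales (rule i_hom)

sublocale p: group_hom G Q p
  by unfold_locales (rule p_hom)

lemma subgroup_iH: "subgroup (i ` H) G"
  by (rule i.subgroup_img_is_subgroup[OF K.H])

lemma subgroup_N: "subgroup N G"
  by (rule G.normalizer_imp_subgroup[OF subgroup.subset[OF subgroup_iH]])

lemma N_carrier: "n \<in> N \<Longrightarrow> n \<in> carrier G"
  by (rule subgroup.mem_carrier[OF subgroup_N])

lemma N_conj:
  assumes n: "n \<in> N" and h: "h \<in> H"
  shows "n \<otimes>\<^bsub>G\<^esub> i h \<otimes>\<^bsub>G\<^esub> inv\<^bsub>G\<^esub> n \<in> i ` H"
proof -
  have "i ` H \<subseteq> carrier G" using subgroup.subset[OF subgroup_iH] .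
  then have "n <#\<^bsub>G\<^esub> (i ` H) #>\<^bsub>G\<^esub> inv\<^bsub>G\<^esub> n = i ` H"
    using n unfolding normalizer_def stabilizer_def by simp
  moreover have "n \<otimes>\<^bsub>G\<^esub> i h \<otimes>\<^bsub>G\<^esub> inv\<^bsub>G\<^esub> n \<in> n <#\<^bsub>G\<^esub> (i ` H) #>\<^bsub>G\<^esub> inv\<^bsub>G\<^esub> n"
    using h unfolding l_coset_def r_coset_def by blast
  ultimately show ?thesis by simp
qed

lemma iH_N: "h \<in> H \<Longrightarrow> i h \<in> N"
proof -
  assume h: "h \<in> H"
  interpret n: normal "i ` H" "G\<lparr>carrier := N\<rparr>"
    by (rule G.subgroup_in_normalizer[OF subgroup_iH])
  show "i h \<in> N" using n.subset h by auto
qed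

lemma N_lift:
  assumes "q \<in> carrier Q"
  obtains n where "n \<in> N" "p n = q"
proof -
  have "q \<in> p ` N" unfolding N_surj by (rule assms)
  then show ?thesis using that by (elim imageE) simp
qed

section \<open>The conjugation action of \<open>G\<close> on \<open>K\<close>\<close>

lemma p_i: "x \<in> carrier K \<Longrightarrow> p (i x) = \<one>\<^bsub>Q\<^esub>"
  using ker unfolding kernel_def by blast

text \<open>Defined through \<open>inv_into\<close> because \<open>K\<close> is only embedded in
  \<open>G\<close> by \<open>i\<close>. With the inverse on the left this is a right action, so
  changing a lift \<open>n\<close> on its right acts last, on the coset already obtained from
  \<open>n\<close>.\<close>

definition conjugate :: "'g \<Rightarrow> 'k \<Rightarrow> 'k" where
  "conjugate n x = inv_into (carrier K) i (inv\<^bsub>G\<^esub> n \<otimes>\<^bsub>G\<^esub> i x \<otimes>\<^bsub>G\<^esub> n)"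

lemma conjugate:
  assumes n: "n \<in> carrier G" and x: "x \<in> carrier K"
  shows conjugate_closed: "conjugate n x \<in> carrier K" and i_conjugate: "i (conjugate n x) = inv\<^bsub>G\<^esub> n \<otimes>\<^bsub>G\<^esub> i x \<otimes>\<^bsub>G\<^esub> n"
proof -
  let ?c = "inv\<^bsub>G\<^esub> n \<otimes>\<^bsub>G\<^esub> i x \<otimes>\<^bsub>G\<^esub> n"
  have "p ?c = \<one>\<^bsub>Q\<^esub>" using n x p_i[OF x] by simp
  then have "?c \<in> i ` carrier K" unfolding ker[symmetric] kernel_def using n x by simp
  then show "conjugate n x \<in> carrier K" "i (conjugate n x) = ?c" unfolding conjugate_def
    by (rule inv_into_into, rule f_inv_into_f)
qed

lemma conjugate_eqI:
  assumes "n \<in> carrier G" "x \<in> carrier K" "y \<in> carrier K" "i y = inv\<^bsub>G\<^esub> n \<otimes>\<^bsub>G\<^esub> i x \<otimes>\<^bsub>G\<^esub> n"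
  shows "conjugate n x = y"
  using inj_onD[OF i_inj, of "conjugate n x" y] conjugate assms by simp

lemma conjugate_hom: "n \<in> carrier G \<Longrightarrow> conjugate n \<in> hom K K"
proof (rule homI)
  fix x y assume *: "n \<in> carrier G" "x \<in> carrier K" "y \<in> carrier K"
  then show "conjugate n (x \<otimes>\<^bsub>K\<^esub> y) = conjugate n x \<otimes>\<^bsub>K\<^esub> conjugate n y"
    by (intro conjugate_eqI) (simp_all add: conjugate G.m_assoc, simp add: G.m_assoc[symmetric])
qed (rule conjugate_closed)

lemma conjugate_mult:
  assumes "n \<in> carrier G" "m \<in> carrier G" "x \<in> carrier K"
  shows "conjugate (n \<otimes>\<^bsub>G\<^esub> m) x = conjugate m (conjugate n x)"
  using assms by (intro conjugate_eqI) (simp_all add: conjugate G.m_assoc G.inv_mult_group)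

lemma conjugate_inv:
  assumes "n \<in> carrier G" "x \<in> carrier K"
  shows "conjugate (inv\<^bsub>G\<^esub> n) (conjugate n x) = x" "conjugate n (conjugate (inv\<^bsub>G\<^esub> n) x) = x"
  using assms by (intro conjugate_eqI; simp add: conjugate G.m_assoc; simp add: G.m_assoc[symmetric])+

lemma conjugate_i:
  assumes "k \<in> carrier K" "x \<in> carrier K"
  shows "conjugate (i k) x = inv\<^bsub>K\<^esub> k \<otimes>\<^bsub>K\<^esub> x \<otimes>\<^bsub>K\<^esub> k"
  using assms by (intro conjugate_eqI) simp_all

lemma conjugate_H:
  assumes n: "n \<in> N"
  shows "conjugate n ` H = H"
proof -
  have sub: "conjugate n ` H \<subseteq> H" if n: "n \<in> N" for n
  proof
    fix y assume "y \<in> conjugate n ` H"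
    then obtain h where h: "h \<in> H" "y = conjugate n h" by blast
    have nc: "n \<in> carrier G" using n N_carrier by blast
    have hK: "h \<in> carrier K" using h K.H_carrier by blast
    have "inv\<^bsub>G\<^esub> n \<in> N" by (rule subgroup.m_inv_closed[OF subgroup_N n])
    from N_conj[OF this h(1)] have "i y \<in> i ` H" using h nc hK by (simp add: conjugate)
    then obtain h' where h': "h' \<in> H" "i y = i h'" by blast
    have "y = h'" using inj_onD[OF i_inj h'(2)] h h' hK nc K.H_carrier conjugate_closed by blast
    then show "y \<in> H" using h' by simp
  qed
  have "H \<subseteq> conjugate n ` H"
  proof
    fix h assume h: "h \<in> H"
    have nc: "n \<in> carrier G" using n N_carrier by blast
    have "inv\<^bsub>G\<^esub> n \<in> N" by (rule subgroup.m_inv_closed[OF subgroup_N n])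
    then have "conjugate (inv\<^bsub>G\<^esub> n) h \<in> H" using sub h by blast
    moreover have "conjugate n (conjugate (inv\<^bsub>G\<^esub> n) h) = h" using conjugate_inv(2)[OF nc] h K.H_carrier by blast
    ultimately show "h \<in> conjugate n ` H" by (metis imageI)
  qed
  then show ?thesis using sub[OF n] by blast
qed

text \<open>A lift \<open>n\<close> is centred if some shortest electric path from \<open>H\<close> to an element of \<open>cusp n\<close> leaves
  \<open>H\<close> at the identity.\<close>

definition base :: 'k where "base = (SOME a. a \<in> carrier K \<and> a \<notin> H)"

definition cusp :: "'g \<Rightarrow> 'k set" where "cusp n = conjugate n ` (base <#\<^bsub>K\<^esub> H)"

definition centred :: "'g \<Rightarrow> bool" where
  "centred n \<longleftrightarrow> n \<in> N \<and> (\<exists>y\<in>cusp n. K.nearest \<one>\<^bsub>K\<^esub> y)"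

lemma base: "base \<in> carrier K" "base \<notin> H"
proof -
  have "\<exists>a. a \<in> carrier K \<and> a \<notin> H" using proper K.H_carrier by blast
  then have "base \<in> carrier K \<and> base \<notin> H" unfolding base_def by (rule someI_ex)
  then show "base \<in> carrier K" "base \<notin> H" by blast+
qed

lemma cusp_lcoset: 
  assumes n: "n \<in> N"
  shows "cusp n \<in> lcosets\<^bsub>K\<^esub> H" and "cusp n \<noteq> H" and "cusp n = conjugate n base <#\<^bsub>K\<^esub> H"
proof -
  have nc: "n \<in> carrier G" using n N_carrier by blast
  show eq: "cusp n = conjugate n base <#\<^bsub>K\<^esub> H" unfolding cusp_def
    by (rule K.hom_l_coset[OF conjugate_hom[OF nc] conjugate_H[OF n] base(1)])
  show "cusp n \<in> lcosets\<^bsub>K\<^esub> H" unfolding eq using K.lcosetI(1) conjugate_closed[OF nc base(1)] by blast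
  show "cusp n \<noteq> H"
  proof
    assume "cusp n = H"
    then have "conjugate n base \<in> H" using eq K.lcosetI(2)[OF conjugate_closed[OF nc base(1)]] by simp
    moreover have "inv\<^bsub>G\<^esub> n \<in> N" by (rule subgroup.m_inv_closed[OF subgroup_N n])
    ultimately have "conjugate (inv\<^bsub>G\<^esub> n) (conjugate n base) \<in> H" using conjugate_H by blast
    then show False using conjugate_inv(1)[OF nc base(1)] base(2) by simp
  qed
qed

lemma cusp_mult_right:
  assumes "n \<in> N" "y \<in> cusp n" "h \<in> H"
  shows "y \<otimes>\<^bsub>K\<^esub> h \<in> cusp n" and "y \<in> carrier K"
proof -
  show y: "y \<in> carrier K" using K.lcosetD(1)[OF cusp_lcoset(1)[OF assms(1)] assms(2)] .
  have "cusp n = y <#\<^bsub>K\<^esub> H" using K.lcosetD(2)[OF cusp_lcoset(1)[OF assms(1)] assms(2)] .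
  then show "y \<otimes>\<^bsub>K\<^esub> h \<in> cusp n" using assms(3) unfolding l_coset_def by blast
qed

lemma cusp_mult: "n \<in> N \<Longrightarrow> m \<in> N \<Longrightarrow> cusp (n \<otimes>\<^bsub>G\<^esub> m) = conjugate m ` cusp n"
proof -
  assume nm: "n \<in> N" "m \<in> N"
  have "base <#\<^bsub>K\<^esub> H \<subseteq> carrier K" using K.lcosetD(1)[OF K.lcosetI(1)[OF base(1)]] by blast
  then show "cusp (n \<otimes>\<^bsub>G\<^esub> m) = conjugate m ` cusp n"
    unfolding cusp_def image_image using nm N_carrier by (intro image_cong refl) (auto simp: conjugate_mult)
qed

text \<open>Of the conjugation by \<open>k\<close>, the right factor is absorbed by the left coset
  and only translation by the inverse of \<open>k\<close> survives. This is what allows a lift to be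
  corrected within its fibre.\<close>

lemma cusp_i:
  assumes n: "n \<in> N" and k: "k \<in> H"
  shows "cusp (n \<otimes>\<^bsub>G\<^esub> i k) = (\<lambda>y. inv\<^bsub>K\<^esub> k \<otimes>\<^bsub>K\<^esub> y) ` cusp n"
proof -
  have kc: "k \<in> carrier K" by (rule K.H_carrier[OF k])
  have "cusp (n \<otimes>\<^bsub>G\<^esub> i k) = (\<lambda>y. inv\<^bsub>K\<^esub> k \<otimes>\<^bsub>K\<^esub> (y \<otimes>\<^bsub>K\<^esub> k)) ` cusp n"
    unfolding cusp_mult[OF n iH_N[OF k]]
    by (rule image_cong) (use cusp_mult_right(2)[OF n _ k] kc in \<open>auto simp: conjugate_i K.m_assoc\<close>)
  also have "\<dots> = (\<lambda>y. inv\<^bsub>K\<^esub> k \<otimes>\<^bsub>K\<^esub> y) ` ((\<lambda>y. y \<otimes>\<^bsub>K\<^esub> k) ` cusp n)" by (simp add: image_image)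
  also have "(\<lambda>y. y \<otimes>\<^bsub>K\<^esub> k) ` cusp n = cusp n"
  proof
    show "(\<lambda>y. y \<otimes>\<^bsub>K\<^esub> k) ` cusp n \<subseteq> cusp n" using cusp_mult_right(1)[OF n _ k] by blast
    show "cusp n \<subseteq> (\<lambda>y. y \<otimes>\<^bsub>K\<^esub> k) ` cusp n"
    proof
      fix y assume y: "y \<in> cusp n"
      have "inv\<^bsub>K\<^esub> k \<in> H" by (rule subgroup.m_inv_closed[OF K.H k])
      then have "y \<otimes>\<^bsub>K\<^esub> inv\<^bsub>K\<^esub> k \<in> cusp n" using cusp_mult_right(1)[OF n y] by blast
      moreover have "y \<otimes>\<^bsub>K\<^esub> inv\<^bsub>K\<^esub> k \<otimes>\<^bsub>K\<^esub> k = y"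
        using cusp_mult_right(2)[OF n y k] kc by (simp add: K.m_assoc)
      ultimately show "y \<in> (\<lambda>y. y \<otimes>\<^bsub>K\<^esub> k) ` cusp n" by (metis imageI)
    qed
  qed
  finally show ?thesis .
qed

lemma centred_lift_exists:
  assumes q: "q \<in> carrier Q"
  shows "\<exists>n. centred n \<and> p n = q"
proof -
  obtain n where n: "n \<in> N" "p n = q" by (rule N_lift[OF q])
  have "conjugate n base \<in> carrier K" by (rule conjugate_closed[OF N_carrier[OF n(1)] base(1)])
  moreover from this have "conjugate n base \<in> cusp n" unfolding cusp_lcoset(3)[OF n(1)] by (rule K.lcosetI(2))
  ultimately obtain y where y: "y \<in> cusp n" "y \<in> carrier K" by (intro that)
  obtain k where k: "K.nearest k y" using K.nearest_exists[OF y(2)] .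
  then have kH: "k \<in> H" unfolding K.nearest_def by blast
  have kc: "k \<in> carrier K" by (rule K.H_carrier[OF kH])
  have "inv\<^bsub>K\<^esub> k \<in> H" by (rule subgroup.m_inv_closed[OF K.H kH])
  \<comment> \<open>Translation by the inverse of \<open>k\<close> moves the nearest point
    \<open>k\<close> to the identity.\<close>
  from K.nearest_mult_left[OF this k y(2)]
  have "K.nearest \<one>\<^bsub>K\<^esub> (inv\<^bsub>K\<^esub> k \<otimes>\<^bsub>K\<^esub> y)" using kc by simp
  moreover have "inv\<^bsub>K\<^esub> k \<otimes>\<^bsub>K\<^esub> y \<in> cusp (n \<otimes>\<^bsub>G\<^esub> i k)" unfolding cusp_i[OF n(1) kH] using y by blast
  moreover have "n \<otimes>\<^bsub>G\<^esub> i k \<in> N" using subgroup.m_closed[OF subgroup_N n(1) iH_N[OF kH]] .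
  moreover have "p (n \<otimes>\<^bsub>G\<^esub> i k) = q" using n kc N_carrier p_i q by simp
  ultimately show ?thesis unfolding centred_def by blast
qed

text \<open>Write \<open>n' = n t k\<close> with \<open>k\<close> in \<open>H\<close>. Centredness
  of \<open>n'\<close> says that \<open>k\<close> is nearest to a point of the image under
  \<open>t\<close> of \<open>cusp n\<close>, while centredness of \<open>n\<close> gives the nearest
  point 1 before applying \<open>t\<close>. As \<open>conjugate t\<close> fixes 1,
  \<open>exits_under_automorphism\<close> bounds \<open>k\<close> independently of
  \<open>n\<close>.\<close>

lemma centred_step:
  assumes N_gen: "generated_group (G\<lparr>carrier := N\<rparr>) SN" and t: "t \<in> N"
  shows "\<exists>R\<ge>0. \<forall>n n'. centred n \<and> centred n' \<and> p n' = p n \<otimes>\<^bsub>Q\<^esub> p t \<longrightarrow>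
    word_dist (G\<lparr>carrier := N\<rparr>) SN n n' \<le> R"
proof -
  interpret N: generated_group "G\<lparr>carrier := N\<rparr>" SN by (rule N_gen)
  have tc: "t \<in> carrier G" by (rule N_carrier[OF t])
  have tinv: "inv\<^bsub>G\<^esub> t \<in> carrier G" using tc by simp
  obtain R0 where R0: "\<And>B k y k' y'. B \<in> lcosets\<^bsub>K\<^esub> H \<Longrightarrow> B \<noteq> H \<Longrightarrow> y \<in> B \<Longrightarrow> K.nearest k y \<Longrightarrow>
    y' \<in> conjugate t ` B \<Longrightarrow> K.nearest k' y' \<Longrightarrow> walk_le K.cay (conjugate t k) k' R0"
    using K.exits_under_automorphism[OF bcp conjugate_hom[OF tc] conjugate_H[OF t] conjugate_hom[OF tinv] conjugate_inv[OF tc]] by metis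
  \<comment> \<open>The bound on \<open>k\<close> is in the word metric of \<open>K\<close>. The
    finiteness of \<open>F\<close> turns it into the bound \<open>R\<close> in the word metric of
    \<open>N\<close>.\<close>
  define F where "F = {k \<in> carrier K. word_dist K S \<one>\<^bsub>K\<^esub> k \<le> R0} \<inter> H"
  have finF: "finite F" unfolding F_def using K.finite_ball by simp
  define R where "R = (\<Sum>k\<in>F. word_dist (G\<lparr>carrier := N\<rparr>) SN \<one>\<^bsub>G\<^esub> (t \<otimes>\<^bsub>G\<^esub> i k))"
  have "0 \<le> R" unfolding R_def by (intro sum_nonneg N.word_dist_nonneg)
  moreover have "word_dist (G\<lparr>carrier := N\<rparr>) SN n n' \<le> R"
    if n: "centred n" and n': "centred n'" and pn: "p n' = p n \<otimes>\<^bsub>Q\<^esub> p t" for n n'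
  proof -
    have nN: "n \<in> N" "n' \<in> N" using n n' unfolding centred_def by blast+
    have nc: "n \<in> carrier G" "n' \<in> carrier G" using nN N_carrier by blast+
    have ntN: "n \<otimes>\<^bsub>G\<^esub> t \<in> N" by (rule subgroup.m_closed[OF subgroup_N nN(1) t])
    define m where "m = inv\<^bsub>G\<^esub> (n \<otimes>\<^bsub>G\<^esub> t) \<otimes>\<^bsub>G\<^esub> n'"
    have "m \<in> N" unfolding m_def
      using subgroup.m_closed[OF subgroup_N subgroup.m_inv_closed[OF subgroup_N ntN] nN(2)] .
    moreover have "p m = \<one>\<^bsub>Q\<^esub>" unfolding m_def using nc tc pn by simp
    ultimately obtain k where k: "k \<in> H" "m = i k" using N_ker by blast
    have kc: "k \<in> carrier K" by (rule K.H_carrier[OF k(1)])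
    have n'_eq: "n' = n \<otimes>\<^bsub>G\<^esub> t \<otimes>\<^bsub>G\<^esub> i k"
      unfolding k(2)[symmetric] m_def using nc tc by (simp add: G.m_assoc[symmetric] del: G.m_assoc) 
    obtain y where y: "y \<in> cusp n" "K.nearest \<one>\<^bsub>K\<^esub> y" using n unfolding centred_def by blast
    obtain y' where y': "y' \<in> cusp n'" "K.nearest \<one>\<^bsub>K\<^esub> y'" using n' unfolding centred_def by blast
    have y'c: "y' \<in> carrier K" using cusp_mult_right(2)[OF nN(2) y'(1) k(1)] .
    obtain z where z: "z \<in> conjugate t ` cusp n" "y' = inv\<^bsub>K\<^esub> k \<otimes>\<^bsub>K\<^esub> z"
      using y'(1) unfolding n'_eq cusp_i[OF ntN k(1)] cusp_mult[OF nN(1) t] by blast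
    have zc: "z \<in> carrier K" using z(1) conjugate_closed[OF tc] cusp_mult_right(2)[OF nN(1) _ k(1)] by blast
    have "K.nearest (k \<otimes>\<^bsub>K\<^esub> \<one>\<^bsub>K\<^esub>) (k \<otimes>\<^bsub>K\<^esub> y')" by (rule K.nearest_mult_left[OF k(1) y'(2) y'c])
    moreover have "k \<otimes>\<^bsub>K\<^esub> y' = z" unfolding z(2) using kc zc by (simp add: K.m_assoc[symmetric])
    ultimately have "K.nearest k z" using kc by simp
    from R0[OF cusp_lcoset(1,2)[OF nN(1)] y z(1) this]
    have "walk_le K.cay (conjugate t \<one>\<^bsub>K\<^esub>) k R0" .
    moreover have "conjugate t \<one>\<^bsub>K\<^esub> = \<one>\<^bsub>K\<^esub>" using tc by (intro conjugate_eqI) simp_all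
    ultimately have "k \<in> F" unfolding F_def using kc k(1) K.walk_le_cay_iff by simp
    then have le: "word_dist (G\<lparr>carrier := N\<rparr>) SN \<one>\<^bsub>G\<^esub> (t \<otimes>\<^bsub>G\<^esub> i k) \<le> R"
      unfolding R_def by (rule member_le_sum[OF _ _ finF]) (rule N.word_dist_nonneg)
    have "t \<otimes>\<^bsub>G\<^esub> i k \<in> N" by (rule subgroup.m_closed[OF subgroup_N t iH_N[OF k(1)]])
    then have "word_dist (G\<lparr>carrier := N\<rparr>) SN (n \<otimes>\<^bsub>G\<^esub> \<one>\<^bsub>G\<^esub>) (n \<otimes>\<^bsub>G\<^esub> (t \<otimes>\<^bsub>G\<^esub> i k))
        = word_dist (G\<lparr>carrier := N\<rparr>) SN \<one>\<^bsub>G\<^esub> (t \<otimes>\<^bsub>G\<^esub> i k)"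
      using N.word_dist_mult_left[of n "\<one>\<^bsub>G\<^esub>" "t \<otimes>\<^bsub>G\<^esub> i k"] nN subgroup.one_closed[OF subgroup_N] by simp
    then show ?thesis using le nc tc kc unfolding n'_eq by (simp add: G.m_assoc)
  qed
  ultimately show ?thesis by blast
qed

theorem quasi_isometric_section:
  assumes Q_gen: "generated_group Q SQ" and N_gen: "generated_group (G\<lparr>carrier := N\<rparr>) SN"
  shows "\<exists>s R. 1 \<le> R \<and> (\<forall>q\<in>carrier Q. s q \<in> N \<and> p (s q) = q) \<and>
    (\<forall>q\<in>carrier Q. \<forall>q'\<in>carrier Q.
      word_dist Q SQ q q' \<le> R * word_dist (G\<lparr>carrier := N\<rparr>) SN (s q) (s q') \<and>
      word_dist (G\<lparr>carrier := N\<rparr>) SN (s q) (s q') \<le> R * word_dist Q SQ q q')"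
proof -
  interpret Q: generated_group Q SQ by (rule Q_gen)
  interpret N: generated_group "G\<lparr>carrier := N\<rparr>" SN by (rule N_gen)
  obtain s where s: "\<And>q. q \<in> carrier Q \<Longrightarrow> centred (s q) \<and> p (s q) = q"
    using centred_lift_exists by metis
  have sN: "s q \<in> N" if "q \<in> carrier Q" for q using s[OF that] unfolding centred_def by blast
  have "\<exists>R\<ge>0. \<forall>n n'. centred n \<and> centred n' \<and> p n' = p n \<otimes>\<^bsub>Q\<^esub> t \<longrightarrow>
      word_dist (G\<lparr>carrier := N\<rparr>) SN n n' \<le> R" if t: "t \<in> carrier Q" for t
  proof -
    obtain n where n: "n \<in> N" "p n = t" by (rule N_lift[OF t])
    show ?thesis using centred_step[OF N_gen n(1)] unfolding n(2) .
  qed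
  then obtain r where r: "\<And>t. t \<in> carrier Q \<Longrightarrow> 0 \<le> r t"
    "\<And>t n n'. t \<in> carrier Q \<Longrightarrow> centred n \<Longrightarrow> centred n' \<Longrightarrow> p n' = p n \<otimes>\<^bsub>Q\<^esub> t \<Longrightarrow>
      word_dist (G\<lparr>carrier := N\<rparr>) SN n n' \<le> r t" by metis
  have "p \<in> hom (G\<lparr>carrier := N\<rparr>) Q"
    using p_hom N_carrier unfolding hom_def by auto
  then obtain L where L: "1 \<le> L" "\<And>x y d. walk_le N.cay x y d \<Longrightarrow> walk_le Q.cay (p x) (p y) (L * d)"
    using N.hom_lipschitz[OF Q_gen] by metis
  \<comment> \<open>\<open>L\<close> is the Lipschitz constant of \<open>p\<close> and gives the
    lower estimate; the sum over generators dominates each \<open>centred_step\<close> constant and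
    gives the upper one.\<close>
  define R where "R = L + (\<Sum>t\<in>symmetrized Q SQ. r t)"
  have sum0: "0 \<le> (\<Sum>t\<in>symmetrized Q SQ. r t)" by (intro sum_nonneg r Q.symmetrized_closed)
  have rR: "r t \<le> R" if "t \<in> symmetrized Q SQ" for t
    using member_le_sum[OF that _ Q.finite_symmetrized, of r] r(1) Q.symmetrized_closed L(1)
    unfolding R_def by fastforce
  have R1: "1 \<le> R" unfolding R_def using L(1) sum0 by simp
  have upper: "word_dist (G\<lparr>carrier := N\<rparr>) SN (s q) (s q') \<le> R * word_dist Q SQ q q'"
    if q: "q \<in> carrier Q" "q' \<in> carrier Q" for q q'
  proof -
    have "walk_le N.cay (s q) (s q') (R * word_dist Q SQ q q')"
    proof (rule walk_le_map[OF Q.walk_le_word_dist[OF q]])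
      fix a b assume ab: "a \<in> verts Q.cay" "b \<in> verts Q.cay" "adj Q.cay a b"
      then have c: "a \<in> carrier Q" "b \<in> carrier Q" and t: "inv\<^bsub>Q\<^esub> a \<otimes>\<^bsub>Q\<^esub> b \<in> symmetrized Q SQ" by simp_all
      have "p (s b) = p (s a) \<otimes>\<^bsub>Q\<^esub> (inv\<^bsub>Q\<^esub> a \<otimes>\<^bsub>Q\<^esub> b)"
        using s c by (simp add: Q.m_assoc[symmetric])
      then have "word_dist (G\<lparr>carrier := N\<rparr>) SN (s a) (s b) \<le> r (inv\<^bsub>Q\<^esub> a \<otimes>\<^bsub>Q\<^esub> b)"
        using s c by (intro r(2)) auto
      also have "\<dots> \<le> R" by (rule rR[OF t])
      finally show "walk_le N.cay (s a) (s b) (R * elen Q.cay a b)"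
        using N.walk_le_cay_iff sN c by simp
    qed (use sN R1 in auto)
    then show ?thesis using N.walk_le_cay_iff sN q by simp
  qed
  have lower: "word_dist Q SQ q q' \<le> R * word_dist (G\<lparr>carrier := N\<rparr>) SN (s q) (s q')"
    if q: "q \<in> carrier Q" "q' \<in> carrier Q" for q q'
  proof -
    have "walk_le Q.cay q q' (L * word_dist (G\<lparr>carrier := N\<rparr>) SN (s q) (s q'))"
      using L(2)[OF N.walk_le_word_dist[of "s q" "s q'"]] s sN q by simp
    then have "word_dist Q SQ q q' \<le> L * word_dist (G\<lparr>carrier := N\<rparr>) SN (s q) (s q')"
      using Q.walk_le_cay_iff q by simp
    also have "\<dots> \<le> R * word_dist (G\<lparr>carrier := N\<rparr>) SN (s q) (s q')"
      unfolding R_def using sum0 N.word_dist_nonneg by (intro mult_right_mono) auto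
    finally show ?thesis .
  qed
  show ?thesis using R1 sN s upper lower by (intro exI[of _ s] exI[of _ R]) blast
qed

end

section \<open>Hyperbolicity of the quotient\<close>

context cusp_extension
begin

text \<open>The upper estimate composes the section with the Lipschitz inclusions of
  \<open>N\<close> into \<open>G\<close> and of \<open>G\<close> into the coned-off graph. The lower
  one comes from extending \<open>p\<close> to a Lipschitz retraction \<open>r\<close> of that
  graph.\<close>

theorem hyperbolic_quotient:
  assumes Q_gen: "generated_group Q SQ" and N_gen: "generated_group (G\<lparr>carrier := N\<rparr>) SN"
    and weak: "weakly_hyperbolic_rel G (i ` H)"
  shows "hyperbolic_graph (cayley_graph Q SQ)"
proof -
  obtain SG where SG: "finite_generating_set G SG" "hyperbolic_graph (coned_off G (i ` H) SG)"
    using weak unfolding weakly_hyperbolic_rel_def by blast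
  interpret C: coned_group G SG "i ` H"
    by (intro coned_group.intro generated_group.intro generated_group_axioms.intro
        coned_group_axioms.intro G.is_group SG(1) subgroup_iH)
  interpret Q: generated_group Q SQ by (rule Q_gen)
  interpret N: generated_group "G\<lparr>carrier := N\<rparr>" SN by (rule N_gen)
  have G_gen: "generated_group G SG" by unfold_locales
  note cayQ = Q.half_graph_cay Q.connected_graph_cay and conG = C.half_graph_con C.connected_graph_con
  have loopC: "0 \<le> elen C.con u u \<and> elen C.con u u \<le> 1" for u by (cases u) auto
  have loopQ: "0 \<le> elen Q.cay u u \<and> elen Q.cay u u \<le> 1" for u by simp
  obtain \<delta> where \<delta>: "0 \<le> \<delta>" "four_point (verts C.con) C.dc \<delta>"
    using hyperbolic_vertices[OF conG loopC SG(2)] by metis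
  obtain s R where R: "1 \<le> R" and s: "\<And>q. q \<in> carrier Q \<Longrightarrow> s q \<in> N \<and> p (s q) = q"
    and sR: "\<And>q q'. q \<in> carrier Q \<Longrightarrow> q' \<in> carrier Q \<Longrightarrow>
      word_dist (G\<lparr>carrier := N\<rparr>) SN (s q) (s q') \<le> R * word_dist Q SQ q q'"
    using quasi_isometric_section[OF Q_gen N_gen] by metis
  have sc: "s q \<in> carrier G" if "q \<in> carrier Q" for q using s[OF that] N_carrier by blast
  have "(\<lambda>x. x) \<in> hom (G\<lparr>carrier := N\<rparr>) G" using N_carrier unfolding hom_def by auto
  then obtain L1 where L1: "1 \<le> L1" "\<And>x y d. walk_le N.cay x y d \<Longrightarrow> walk_le C.cay x y (L1 * d)"
    using N.hom_lipschitz[OF G_gen] by metis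
  obtain L2 where L2: "1 \<le> L2" "\<And>x y d. walk_le C.cay x y d \<Longrightarrow> walk_le Q.cay (p x) (p y) (L2 * d)"
    using C.hom_lipschitz[OF Q_gen p_hom] by metis
  define M where "M = L1 * R + L2"
  have M: "1 \<le> M" "L1 * R \<le> M" "L2 \<le> M"
    unfolding M_def using L1(1) L2(1) R mult_nonneg_nonneg[of L1 R] by linarith+
  define r where "r u = (case u of Elt x \<Rightarrow> p x | Cone D \<Rightarrow> p (SOME x. x \<in> D))" for u
  have r_Cone: "r (Cone D) = p x" if D: "D \<in> lcosets\<^bsub>G\<^esub> (i ` H)" "x \<in> D" for D x
  proof -
    have xc: "x \<in> carrier G" and "D = x <#\<^bsub>G\<^esub> (i ` H)" using C.lcosetD[OF D] by blast+
    moreover have "(SOME y. y \<in> D) \<in> D" using D(2) by (rule someI)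
    ultimately obtain h where h: "h \<in> H" "(SOME y. y \<in> D) = x \<otimes>\<^bsub>G\<^esub> i h" unfolding l_coset_def by auto
    then show ?thesis unfolding r_def using p_i K.H_carrier xc by simp
  qed
  have r_Elt: "r (Elt x) = p x" for x unfolding r_def by simp
  have retract: "walk_le Q.cay (r u) (r v) (L2 * d)" if "walk_le C.con u v d" for u v d
  proof (rule walk_le_map[OF that])
    show r_verts: "r a \<in> verts Q.cay" if a: "a \<in> verts C.con" for a
    proof (cases a)
      case (Elt x)
      then show ?thesis using a r_Elt by auto
    next
      case (Cone D)
      then obtain x where x: "x \<in> carrier G" "D = x <#\<^bsub>G\<^esub> (i ` H)" using a by (auto simp: LCOSETS_def)
      then show ?thesis using r_Cone[of D x] C.lcosetI[OF x(1)] Cone by simp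
    qed
    fix a b assume ab: "a \<in> verts C.con" "b \<in> verts C.con" "adj C.con a b"
    show "walk_le Q.cay (r a) (r b) (L2 * elen C.con a b)"
    proof (cases "\<exists>x y. a = Elt x \<and> b = Elt y")
      case True
      then obtain x y where xy: "a = Elt x" "b = Elt y" by blast
      then have "walk_le C.cay x y 1" using ab by (intro walk_le_edge) auto
      then show ?thesis using L2(2)[of x y 1] xy r_Elt by simp
    next
      case False
      then have "r a = r b" using ab r_Cone r_Elt by (cases a; cases b) auto
      moreover have "0 \<le> L2 * elen C.con a b" using L2(1) by (cases a; cases b) auto
      ultimately show ?thesis using r_verts[OF ab(2)] walk_le_refl by metis
    qed
  qed (use L2 in simp)
  have "\<exists>\<delta>'\<ge>0. four_point (verts Q.cay) (vertex_dist Q.cay) \<delta>'"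
  proof (rule four_point_quasi_isometric_embedding[OF pseudo_metric_vertex_dist[OF conG] \<delta>(2,1) _
        pseudo_metric_vertex_dist[OF cayQ] _ M(1)])
    show "\<exists>c n. geodesic_chain (verts C.con) C.dc c n \<and> c 0 = x \<and> c n = y"
      if "x \<in> verts C.con" "y \<in> verts C.con" for x y
      using geodesic_chain_exists[OF conG that] by blast
    show "\<exists>c n. unit_chain (verts Q.cay) (vertex_dist Q.cay) c n \<and> c 0 = x \<and> c n = y"
      if xy: "x \<in> verts Q.cay" "y \<in> verts Q.cay" for x y
    proof -
      obtain c n where "c 0 = x" "c n = y"
        "(\<forall>u v. adj Q.cay u v \<longrightarrow> elen Q.cay u v = 1) \<longrightarrow> unit_chain (verts Q.cay) (vertex_dist Q.cay) c n"
        using geodesic_chain_exists[OF cayQ xy] by blast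
      then show ?thesis using Q.cay_simps(3) by blast
    qed
    fix x assume "x \<in> verts Q.cay"
    then have x: "x \<in> carrier Q" by simp
    show "Elt (s x) \<in> verts C.con" using sc[OF x] by simp
    fix y assume "y \<in> verts Q.cay"
    then have y: "y \<in> carrier Q" by simp
    have mem: "Elt (s x) \<in> verts C.con" "Elt (s y) \<in> verts C.con" using sc x y by simp_all
    have dist: "word_dist Q SQ x y = vertex_dist Q.cay x y" by (rule Q.word_dist_eq[OF x y])
    have d0: "0 \<le> vertex_dist Q.cay x y" using Q.word_dist_nonneg[of x y] dist by simp
    have "walk_le N.cay (s x) (s y) (R * word_dist Q SQ x y)"
      using N.walk_le_cay_iff sR[OF x y] s[OF x] s[OF y] by simp
    then have "C.dc (Elt (s x)) (Elt (s y)) \<le> L1 * (R * word_dist Q SQ x y)"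
      by (intro C.dc_le C.walk_le_con_Elt L1(2))
    also have "\<dots> \<le> M * vertex_dist Q.cay x y"
      unfolding dist mult.assoc[symmetric] using M(2) d0 by (rule mult_right_mono)
    finally show "C.dc (Elt (s x)) (Elt (s y)) \<le> M * vertex_dist Q.cay x y" .
    have "walk_le Q.cay x y (L2 * C.dc (Elt (s x)) (Elt (s y)))"
      using retract[OF C.dc_walk_le[OF mem]] r_Elt s[OF x] s[OF y] by simp
    then have "vertex_dist Q.cay x y \<le> L2 * C.dc (Elt (s x)) (Elt (s y))"
      by (rule vertex_dist_le[OF Q.half_graph_cay])
    also have "\<dots> \<le> M * (C.dc (Elt (s x)) (Elt (s y)) + 1)"
      using M L2(1) C.dc_nonneg[OF mem] by (intro mult_mono) auto
    finally show "vertex_dist Q.cay x y \<le> M * (C.dc (Elt (s x)) (Elt (s y)) + 1)" .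
  qed
  then show ?thesis using hyperbolic_graphI[OF cayQ loopQ] by metis
qed

end

section \<open>Reduction of the sequence of pairs to the cusp setting\<close>

theorem corollary2p11:
  fixes K :: "'k monoid" and G :: "'g monoid" and Q :: "'q monoid"
    and K1 :: "'k set" and Q1 :: "'q set"
    and i :: "'k \<Rightarrow> 'g" and p :: "'g \<Rightarrow> 'q"
    and SQ :: "'q set" and SN :: "'g set"
  assumes "short_exact_pairs i p K K1 G Q Q1"
    and "finitely_generated K" and "finitely_generated (K\<lparr>carrier := K1\<rparr>)"
    and "finitely_generated G" and "finitely_generated (normalizer_group G (i ` K1))"
    and "finitely_generated Q" and "finitely_generated (Q\<lparr>carrier := Q1\<rparr>)"
    and "non_elementary K K1"
    and "strongly_hyperbolic_rel K K1"
    and "preserves_cusps i K K1 G"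
    and "finite_generating_set Q SQ"
    and "finite_generating_set (normalizer_group G (i ` K1)) SN"
  shows "Q1 = carrier Q \<and>
    (\<exists>s R \<epsilon>. R \<ge> 1 \<and> \<epsilon> \<ge> 0 \<and>
       (\<forall>q\<in>carrier Q. s q \<in> normalizer G (i ` K1) \<and> p (s q) = q) \<and>
       (\<forall>q\<in>carrier Q. \<forall>q'\<in>carrier Q.
          (1 / R) * word_dist Q SQ q q' - \<epsilon>
            \<le> word_dist (normalizer_group G (i ` K1)) SN (s q) (s q') \<and>
          word_dist (normalizer_group G (i ` K1)) SN (s q) (s q')
            \<le> R * word_dist Q SQ q q' + \<epsilon>)) \<and>
    (weakly_hyperbolic_rel G (i ` K1) \<longrightarrow> hyperbolic_group Q)"
proof -
  have subK: "subgroup K1 K" and subQ: "subgroup Q1 Q" and grp: "group K" "group G" "group Q"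
    and i: "i \<in> hom K G" "inj_on i (carrier K)" and p: "p \<in> hom G Q" "p ` carrier G = carrier Q"
    and ker: "kernel G Q p = i ` carrier K"
    and pN: "p ` normalizer G (i ` K1) = Q1"
    and kerN: "kernel (normalizer_group G (i ` K1)) (Q\<lparr>carrier := Q1\<rparr>) p = i ` K1"
    and grpN: "group (normalizer_group G (i ` K1))"
    using assms(1) unfolding short_exact_pairs_def short_exact_def mon_def epi_def by auto
  interpret K: group K by (rule grp(1))
  interpret G: group G by (rule grp(2))
  interpret Q: group Q by (rule grp(3))
  interpret i: group_hom K G i by unfold_locales (rule i(1))
  interpret p: group_hom G Q p by unfold_locales (rule p(1))
  have iK1: "i ` K1 \<subseteq> carrier G"
    using subgroup.subset[OF i.subgroup_img_is_subgroup[OF subK]] .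
  let ?N = "normalizer G (i ` K1)"
  have conj_conj: "(inv\<^bsub>G\<^esub> k \<otimes>\<^bsub>G\<^esub> g) <#\<^bsub>G\<^esub> A #>\<^bsub>G\<^esub> inv\<^bsub>G\<^esub> (inv\<^bsub>G\<^esub> k \<otimes>\<^bsub>G\<^esub> g) =
      inv\<^bsub>G\<^esub> k <#\<^bsub>G\<^esub> (g <#\<^bsub>G\<^esub> A #>\<^bsub>G\<^esub> inv\<^bsub>G\<^esub> g) #>\<^bsub>G\<^esub> k"
    if "g \<in> carrier G" "k \<in> carrier G" "A \<subseteq> carrier G" for g k A
  proof -
    have "inv\<^bsub>G\<^esub> k \<otimes>\<^bsub>G\<^esub> g \<otimes>\<^bsub>G\<^esub> a \<otimes>\<^bsub>G\<^esub> inv\<^bsub>G\<^esub> (inv\<^bsub>G\<^esub> k \<otimes>\<^bsub>G\<^esub> g) =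
        inv\<^bsub>G\<^esub> k \<otimes>\<^bsub>G\<^esub> (g \<otimes>\<^bsub>G\<^esub> a \<otimes>\<^bsub>G\<^esub> inv\<^bsub>G\<^esub> g) \<otimes>\<^bsub>G\<^esub> k" if "a \<in> A" for a
      using \<open>g \<in> carrier G\<close> \<open>k \<in> carrier G\<close> subsetD[OF \<open>A \<subseteq> carrier G\<close> that]
      by (simp add: G.m_assoc G.inv_mult_group)
    then show ?thesis unfolding l_coset_def r_coset_def by simp
  qed
  have Q1: "Q1 = carrier Q"
  proof
    show "Q1 \<subseteq> carrier Q" by (rule subgroup.subset[OF subQ])
    show "carrier Q \<subseteq> Q1"
    proof
      fix q assume "q \<in> carrier Q"
      then obtain g where g: "g \<in> carrier G" "p g = q" using p(2) by (metis imageE)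
      obtain k where k: "k \<in> carrier K"
        "g <#\<^bsub>G\<^esub> (i ` K1) #>\<^bsub>G\<^esub> inv\<^bsub>G\<^esub> g = i k <#\<^bsub>G\<^esub> (i ` K1) #>\<^bsub>G\<^esub> inv\<^bsub>G\<^esub> (i k)"
        using assms(10) g(1) unfolding preserves_cusps_def by blast
      let ?n = "inv\<^bsub>G\<^esub> (i k) \<otimes>\<^bsub>G\<^esub> g"
      have c: "i k \<in> carrier G" by (rule i.hom_closed[OF k(1)])
      have "?n <#\<^bsub>G\<^esub> (i ` K1) #>\<^bsub>G\<^esub> inv\<^bsub>G\<^esub> ?n =
          (inv\<^bsub>G\<^esub> (i k) \<otimes>\<^bsub>G\<^esub> i k) <#\<^bsub>G\<^esub> (i ` K1) #>\<^bsub>G\<^esub> inv\<^bsub>G\<^esub> (inv\<^bsub>G\<^esub> (i k) \<otimes>\<^bsub>G\<^esub> i k)"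
        unfolding conj_conj[OF g(1) c iK1] conj_conj[OF c c iK1] k(2) ..
      also have "\<dots> = i ` K1"
        unfolding G.l_inv[OF c] G.inv_one G.lcos_mult_one[OF iK1] by (rule G.coset_mult_one[OF iK1])
      finally have "?n <#\<^bsub>G\<^esub> (i ` K1) #>\<^bsub>G\<^esub> inv\<^bsub>G\<^esub> ?n = i ` K1" .
      then have "?n \<in> ?N" unfolding normalizer_def stabilizer_def using iK1 g k by simp
      moreover have "p ?n = q"
      proof -
        have "i k \<in> kernel G Q p" unfolding ker using k by blast
        then have "p (i k) = \<one>\<^bsub>Q\<^esub>" unfolding kernel_def by blast
        then show ?thesis using g k \<open>q \<in> carrier Q\<close> by simp
      qed
      ultimately show "q \<in> Q1" unfolding pN[symmetric] by (metis imageI)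
    qed
  qed
  obtain S where S: "finite_generating_set K S" "bounded_coset_penetration K K1 S"
    using assms(9) unfolding strongly_hyperbolic_rel_def by blast
  interpret cusp_extension K S K1 G Q i p
  proof unfold_locales
    show "K1 \<noteq> carrier K" using assms(8) unfolding non_elementary_def by blast
    show "n \<in> i ` K1" if "n \<in> ?N" "p n = \<one>\<^bsub>Q\<^esub>" for n
    proof -
      have "n \<in> kernel (normalizer_group G (i ` K1)) (Q\<lparr>carrier := Q1\<rparr>) p"
        unfolding kernel_def using that by simp
      then show ?thesis unfolding kerN .
    qed
  qed (use S i p ker pN Q1 subgroup.subset[OF subK] subgroup.m_closed[OF subK]
      subgroup.one_closed[OF subK] subgroup.m_inv_closed[OF subK] in simp_all)
  have N_gen: "generated_group (normalizer_group G (i ` K1)) SN"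
    unfolding generated_group_def generated_group_axioms_def using grpN assms(12) by blast
  \<comment> \<open>Stated for arbitrary \<open>T\<close>, since \<open>hyperbolic_group\<close>
    quantifies over all finite generating sets.\<close>
  have Q_gen: "generated_group Q T" if "finite_generating_set Q T" for T
    unfolding generated_group_def generated_group_axioms_def using grp(3) that by blast
  obtain s R where R: "1 \<le> R" and s: "\<And>q. q \<in> carrier Q \<Longrightarrow> s q \<in> ?N \<and> p (s q) = q"
    and lower: "\<And>q q'. q \<in> carrier Q \<Longrightarrow> q' \<in> carrier Q \<Longrightarrow>
      word_dist Q SQ q q' \<le> R * word_dist (normalizer_group G (i ` K1)) SN (s q) (s q')"
    and upper: "\<And>q q'. q \<in> carrier Q \<Longrightarrow> q' \<in> carrier Q \<Longrightarrow>
      word_dist (normalizer_group G (i ` K1)) SN (s q) (s q') \<le> R * word_dist Q SQ q q'"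
    using quasi_isometric_section[OF Q_gen[OF assms(11)] N_gen] by metis
  have "\<exists>s R \<epsilon>. R \<ge> 1 \<and> \<epsilon> \<ge> 0 \<and>
       (\<forall>q\<in>carrier Q. s q \<in> normalizer G (i ` K1) \<and> p (s q) = q) \<and>
       (\<forall>q\<in>carrier Q. \<forall>q'\<in>carrier Q.
          (1 / R) * word_dist Q SQ q q' - \<epsilon>
            \<le> word_dist (normalizer_group G (i ` K1)) SN (s q) (s q') \<and>
          word_dist (normalizer_group G (i ` K1)) SN (s q) (s q')
            \<le> R * word_dist Q SQ q q' + \<epsilon>)"
  \<comment> \<open>The estimates for the section are purely multiplicative, so the additive
    constant is 0.\<close>
  proof (rule exI[of _ s], rule exI[of _ R], rule exI[of _ 0], intro conjI ballI)
    fix q q' assume q: "q \<in> carrier Q" "q' \<in> carrier Q"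
    show "(1 / R) * word_dist Q SQ q q' - 0 \<le> word_dist (normalizer_group G (i ` K1)) SN (s q) (s q')"
      using lower[OF q] R by (simp add: divide_le_eq mult.commute)
    show "word_dist (normalizer_group G (i ` K1)) SN (s q) (s q') \<le> R * word_dist Q SQ q q' + 0"
      using upper[OF q] by simp
  qed (use R s in auto)
  moreover have "hyperbolic_group Q" if "weakly_hyperbolic_rel G (i ` K1)"
    unfolding hyperbolic_group_def
    using hyperbolic_quotient[OF Q_gen N_gen that] grp(3) assms(6) by blast
  ultimately show ?thesis using Q1 by blast
qed

end
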